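(* Let $\alpha$ be a composition and $n$ a positive integer. Then $$\Psi_n\cdot\mathbf s_\alpha=\sum_{\beta\in P_{\alpha,n}}(-1)^{ht(\beta/\!\!/\alpha)}\,\mathbf s_\beta ,$$ where $P_{\alpha,n}$ is the set of compositions $\beta$ with $\alpha<_c\beta$ such that $\beta/\!\!/\alpha$ is an nc border strip with $n$ boxes and $NE(\beta/\!\!/\alpha)=\emptyset$.
   Context: A composition is a finite sequence $\alpha=(\alpha_1,\dots,\alpha_k)$ of positive integers; $\ell(\alpha)=k$, $|\alpha|=\sum_i\alpha_i$, and $\alpha\vDash N$ means $|\alpha|=N$. Its diagram is the set of boxes $(i,j)$ with $1\le i\le\ell(\alpha)$, $1\le j\le\alpha_i$; box $(i,j)$ lies in row $i$ and column $j$, rows numbered top to bottom, columns left to right. For compositions $\gamma=(\gamma_1,\dots,\gamma_l)$ and $\delta$ write $\gamma\lessdot_c\delta$ if either $\delta=(1,\gamma_1,\dots,\gamma_l)$, or $\delta=(\gamma_1,\dots,\gamma_k+1,\dots,\gamma_l)$ for some $k$ with $\gamma_i\ne\gamma_k$ for all $i<k$. Let $<_c$ be the transitive closure of $\lessdot_c$. If $\gamma<_c\delta$, the skew shape $\delta/\!\!/\gamma$ is the set of boxes of $\delta$ not in the inner shape, where the inner shape $\gamma$ sits in the bottom $\ell(\gamma)$ rows of $\delta$, i.e. consists of the boxes $(\ell(\delta)-\ell(\gamma)+i,j)$, $1\le i\le\ell(\gamma)$, $1\le j\le\gamma_i$. For $\alpha<_c\beta$: $\mathrm{supp}(\beta/\!\!/\alpha)$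 is the set of columns containing a box of $\beta/\!\!/\alpha$; $\beta/\!\!/\alpha$ is an interval shape if this set consists of consecutive integers. An interval shape is an nc border strip if (1) whenever $(i,1),(i,2)\in\beta/\!\!/\alpha$, the box $(i,1)$ is the bottommost box of column 1 of $\beta/\!\!/\alpha$, and (2) whenever $(i,j),(i,j+1)\in\beta/\!\!/\alpha$ with $j\ge2$, the box $(i,j)$ is the topmost box of column $j$ of $\beta/\!\!/\alpha$. Its height $ht(\beta/\!\!/\alpha)$ is one less than the number of rows containing boxes of $\beta/\!\!/\alpha$. $NE(\beta/\!\!/\alpha)$ is the set of $j\in\mathrm{supp}(\beta/\!\!/\alpha)$ such that column $j+1$ of $\beta/\!\!/\alpha$ contains at least one box and $i_1<i_2$ for all boxes $(i_1,j+1),(i_2,j)\in\beta/\!\!/\alpha$. $\mathbf{NSym}=\mathbb Q\langle\mathbf h_1,\mathbf h_2,\dots\rangle$ is the free associative algebra; $\mathbf h_\alpha=\mathbf h_{\alpha_1}\cdots\mathbf h_{\alpha_k}$. Write $\alpha\succcurlyeq\beta$ if the parts of $\alpha$ are obtained by adding together consecutive parts of $\beta$. The ribbon functions are $\mathbf r_\beta=\sum_{\alpha\succcurlyeq\beta}(-1)^{\ell(\beta)-\ell(\alpha)}\mathbf h_\alpha$ and $\Psi_n=\sum_{k=0}^{n-1}(-1)^k\mathbf r_{(1^k,n-k)}$. A standard reverse composition tableau (SRCT) of shape $\alpha\vDash N$ is a bijective filling $\tau$ of the diagram of $\alpha$ by $1,\dots,N$ such that rows decrease left to right, the first column increases top to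 bottom, and for all $i<j$, $k\ge1$ with $(j,k+1)\in\alpha$, $(i,k)\in\alpha$ and $\tau(i,k)>\tau(j,k+1)$, one has $(i,k+1)\in\alpha$ and $\tau(i,k+1)>\tau(j,k+1)$. Its descent set is the set of $i\in[N-1]$ such that $i+1$ lies in a column weakly right of the column of $i$; its descent composition is $(s_1,s_2-s_1,\dots,N-s_j)$ where $s_1<\dots<s_j$ are the descents. Let $d_{\alpha,\beta}$ be the number of SRCTs of shape $\alpha$ with descent composition $\beta$. The noncommutative Schur functions $\mathbf s_\alpha$ are the (unique) elements of $\mathbf{NSym}$ with $\mathbf r_\beta=\sum_{\alpha\vDash|\beta|}d_{\alpha,\beta}\mathbf s_\alpha$ for every composition $\beta$. *)

theory Defs
  imports Complex_Main
begin

type_synonym comp = "nat list"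

definition is_comp :: "nat list \<Rightarrow> bool" where
  "is_comp \<alpha> \<longleftrightarrow> (\<forall>x\<in>set \<alpha>. 0 < x)"

definition comps_of :: "nat \<Rightarrow> nat list set" where
  "comps_of N = {\<alpha>. is_comp \<alpha> \<and> sum_list \<alpha> = N}"

text \<open>Diagram, boxes (i,j) 1-indexed: row i, column j.\<close>
definition diag :: "nat list \<Rightarrow> (nat \<times> nat) set" where
  "diag \<alpha> = {(i, j). 1 \<le> i \<and> i \<le> length \<alpha> \<and> 1 \<le> j \<and> j \<le> \<alpha> ! (i - 1)}"

definition cover_c :: "nat list \<Rightarrow> nat list \<Rightarrow> bool" where
  "cover_c \<gamma> \<delta> \<longleftrightarrow> \<delta> = 1 # \<gamma> \<or>
     (\<exists>k < length \<gamma>. \<delta> = \<gamma>[k := \<gamma> ! k + 1] \<and> (\<forall>i < k. \<gamma> ! i \<noteq> \<gamma> ! k))"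

definition less_c :: "nat list \<Rightarrow> nat list \<Rightarrow> bool" where
  "less_c = tranclp cover_c"

text \<open>Skew shape: inner shape sits in the bottom rows of the outer one.\<close>
definition inner_shape :: "nat list \<Rightarrow> nat list \<Rightarrow> (nat \<times> nat) set" where
  "inner_shape \<beta> \<alpha> = {(length \<beta> - length \<alpha> + i, j) | i j.
      1 \<le> i \<and> i \<le> length \<alpha> \<and> 1 \<le> j \<and> j \<le> \<alpha> ! (i - 1)}"

definition skew :: "nat list \<Rightarrow> nat list \<Rightarrow> (nat \<times> nat) set" where
  "skew \<beta> \<alpha> = diag \<beta> - inner_shape \<beta> \<alpha>"

definition supp :: "nat list \<Rightarrow> nat list \<Rightarrow> nat set" where
  "supp \<beta> \<alpha> = snd ` skew \<beta> \<alpha>"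

definition interval_shape :: "nat list \<Rightarrow> nat list \<Rightarrow> bool" where
  "interval_shape \<beta> \<alpha> \<longleftrightarrow>
     (\<forall>a b c. a \<in> supp \<beta> \<alpha> \<longrightarrow> c \<in> supp \<beta> \<alpha> \<longrightarrow> a \<le> b \<longrightarrow> b \<le> c \<longrightarrow> b \<in> supp \<beta> \<alpha>)"

definition nc_border_strip :: "nat list \<Rightarrow> nat list \<Rightarrow> bool" where
  "nc_border_strip \<beta> \<alpha> \<longleftrightarrow> interval_shape \<beta> \<alpha> \<and>
     (\<forall>i. (i, 1) \<in> skew \<beta> \<alpha> \<longrightarrow> (i, 2) \<in> skew \<beta> \<alpha> \<longrightarrow>
          (\<forall>i'. (i', 1) \<in> skew \<beta> \<alpha> \<longrightarrow> i' \<le> i)) \<and>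
     (\<forall>i j. 2 \<le> j \<longrightarrow> (i, j) \<in> skew \<beta> \<alpha> \<longrightarrow> (i, j + 1) \<in> skew \<beta> \<alpha> \<longrightarrow>
          (\<forall>i'. (i', j) \<in> skew \<beta> \<alpha> \<longrightarrow> i \<le> i'))"

definition ht :: "nat list \<Rightarrow> nat list \<Rightarrow> nat" where
  "ht \<beta> \<alpha> = card (fst ` skew \<beta> \<alpha>) - 1"

definition NE :: "nat list \<Rightarrow> nat list \<Rightarrow> nat set" where
  "NE \<beta> \<alpha> = {j \<in> supp \<beta> \<alpha>. (\<exists>i. (i, j + 1) \<in> skew \<beta> \<alpha>) \<and>
      (\<forall>i1 i2. (i1, j + 1) \<in> skew \<beta> \<alpha> \<longrightarrow> (i2, j) \<in> skew \<beta> \<alpha> \<longrightarrow> i1 < i2)}"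

definition P_set :: "nat list \<Rightarrow> nat \<Rightarrow> nat list set" where
  "P_set \<alpha> n = {\<beta>. less_c \<alpha> \<beta> \<and> nc_border_strip \<beta> \<alpha> \<and> card (skew \<beta> \<alpha>) = n \<and> NE \<beta> \<alpha> = {}}"

text \<open>An element of NSym = Q<h_1,h_2,...> is encoded by its coefficient function in the
  basis (h_\<gamma>) indexed by compositions \<gamma> (coefficients at non-compositions are 0 for all
  elements we consider). Multiplication: h_\<alpha> h_\<beta> = h_(\<alpha>@\<beta>).\<close>
type_synonym nsym = "nat list \<Rightarrow> rat"

definition nsym_mult :: "nsym \<Rightarrow> nsym \<Rightarrow> nsym" where
  "nsym_mult f g = (\<lambda>\<gamma>. \<Sum>k\<le>length \<gamma>. f (take k \<gamma>) * g (drop k \<gamma>))"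

definition coarsens :: "nat list \<Rightarrow> nat list \<Rightarrow> bool" where
  "coarsens \<alpha> \<beta> \<longleftrightarrow> (\<exists>Bs. concat Bs = \<beta> \<and> (\<forall>B\<in>set Bs. B \<noteq> []) \<and> \<alpha> = map sum_list Bs)"

definition ribbon :: "nat list \<Rightarrow> nsym" where
  "ribbon \<beta> = (\<lambda>\<alpha>. if coarsens \<alpha> \<beta> then (-1) ^ (length \<beta> - length \<alpha>) else 0)"

definition Psi :: "nat \<Rightarrow> nsym" where
  "Psi n = (\<lambda>\<gamma>. \<Sum>k<n. (-1) ^ k * ribbon (replicate k 1 @ [n - k]) \<gamma>)"

definition srct :: "nat list \<Rightarrow> (nat \<times> nat \<Rightarrow> nat) \<Rightarrow> bool" where
  "srct \<alpha> \<tau> \<longleftrightarrow>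
     bij_betw \<tau> (diag \<alpha>) {1..sum_list \<alpha>} \<and> (\<forall>b. b \<notin> diag \<alpha> \<longrightarrow> \<tau> b = 0) \<and>
     (\<forall>i j. (i, j) \<in> diag \<alpha> \<longrightarrow> (i, j + 1) \<in> diag \<alpha> \<longrightarrow> \<tau> (i, j) > \<tau> (i, j + 1)) \<and>
     (\<forall>i i'. (i, 1) \<in> diag \<alpha> \<longrightarrow> (i', 1) \<in> diag \<alpha> \<longrightarrow> i < i' \<longrightarrow> \<tau> (i, 1) < \<tau> (i', 1)) \<and>
     (\<forall>i j k. i < j \<longrightarrow> 1 \<le> k \<longrightarrow> (j, k + 1) \<in> diag \<alpha> \<longrightarrow> (i, k) \<in> diag \<alpha> \<longrightarrow>
          \<tau> (i, k) > \<tau> (j, k + 1) \<longrightarrow>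
          (i, k + 1) \<in> diag \<alpha> \<and> \<tau> (i, k + 1) > \<tau> (j, k + 1))"

definition col_of :: "nat list \<Rightarrow> (nat \<times> nat \<Rightarrow> nat) \<Rightarrow> nat \<Rightarrow> nat" where
  "col_of \<alpha> \<tau> v = snd (THE b. b \<in> diag \<alpha> \<and> \<tau> b = v)"

definition descents :: "nat list \<Rightarrow> (nat \<times> nat \<Rightarrow> nat) \<Rightarrow> nat set" where
  "descents \<alpha> \<tau> = {i. 1 \<le> i \<and> i < sum_list \<alpha> \<and> col_of \<alpha> \<tau> i \<le> col_of \<alpha> \<tau> (i + 1)}"

definition comp_of_set :: "nat \<Rightarrow> nat set \<Rightarrow> nat list" where
  "comp_of_set N D = (if N = 0 then [] else
     (let L = sorted_list_of_set D in map (\<lambda>(a, b). a - b) (zip (L @ [N]) (0 # L))))"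

definition d_coeff :: "nat list \<Rightarrow> nat list \<Rightarrow> nat" where
  "d_coeff \<alpha> \<beta> = card {\<tau>. srct \<alpha> \<tau> \<and> comp_of_set (sum_list \<alpha>) (descents \<alpha> \<tau>) = \<beta>}"

text \<open>Noncommutative Schur functions: the unique family with
  r_\<beta> = \<Sum>_{\<alpha> \<Turnstile> |\<beta>|} d_{\<alpha>,\<beta>} s_\<alpha> for all compositions \<beta>
  (normalised to 0 on non-compositions).\<close>
definition ncs_family :: "nat list \<Rightarrow> nsym" where
  "ncs_family = (THE S.
     (\<forall>\<beta>. is_comp \<beta> \<longrightarrow>
        ribbon \<beta> = (\<lambda>\<gamma>. \<Sum>\<alpha>\<in>comps_of (sum_list \<beta>). of_nat (d_coeff \<alpha> \<beta>) * S \<alpha> \<gamma>)) \<and>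
     (\<forall>\<alpha>. \<not> is_comp \<alpha> \<longrightarrow> S \<alpha> = (\<lambda>_. 0)))"

definition ncs :: "nat list \<Rightarrow> nsym" where
  "ncs \<alpha> = ncs_family \<alpha>"

end

theory Submission
  imports Defs
begin

text \<open>
  Adding a box in column \<open>c\<close> is a partial operator \<open>t\<^sub>c\<close> on compositions, and the SRCTs of shape \<open>\<delta>\<close>
  are the words \<open>c\<^sub>1 \<dots> c\<^sub>N\<close> with \<open>t\<^bsub>c\<^sub>1\<^esub> \<dots> t\<^bsub>c\<^sub>N\<^esub> \<emptyset> = \<delta>\<close>, where \<open>c\<^sub>i\<close> is the column of the entry \<open>i\<close> and
  \<open>i\<close> is a descent iff \<open>c\<^sub>i \<le> c\<^bsub>i+1\<^esub>\<close>. Letting \<open>h\<^sub>n\<close> act as the sum of \<open>t\<^sub>w\<close> over strictly decreasing words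
  \<open>w\<close> of length \<open>n\<close> makes the span of the compositions a module over the free algebra, in which
  \<open>r\<^sub>\<beta> \<emptyset> = \<Sum>\<^sub>\<alpha> d\<^bsub>\<alpha>,\<beta>\<^esub> \<alpha>\<close>. The matrix of \<open>h\<^sub>\<gamma> \<mapsto> h\<^sub>\<gamma> \<emptyset>\<close> is unitriangular, so \<open>f \<mapsto> f \<emptyset>\<close> is an isomorphism of
  modules taking \<open>s\<^sub>\<alpha>\<close> to \<open>\<alpha>\<close>, and it remains to compute \<open>\<Psi>\<^sub>n \<alpha>\<close>: a signed sum over hook words
  (weakly increasing, then strictly decreasing) \<open>w\<close> of \<open>t\<^sub>w \<alpha>\<close>.

  A hook word with given content is determined by the set of letters \<open>j\<close> (other than the largest)
  that occur in its decreasing part. As \<open>t\<^sub>c\<close> only involves columns \<open>c - 1\<close> and \<open>c\<close>, whether \<open>w\<close> leads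
  from \<open>\<alpha>\<close> to \<open>\<beta>\<close> is a conjunction of conditions on pairs of adjacent columns \<open>j\<close>, \<open>j + 1\<close>, each of which
  only depends on whether \<open>j\<close> occurs in the decreasing part. So the coefficient of \<open>\<beta>\<close> is a product over
  \<open>j\<close> of differences of two truth values. The factor vanishes if both choices are possible, which means
  that column \<open>j + 1\<close> of \<open>\<beta>/\<alpha>\<close> is empty or \<open>j \<in> NE\<close>, or if none is, which means that the border strip
  condition fails at \<open>j\<close>.
\<close>

section \<open>Box-adding operators and words\<close>

text \<open>Parts are listed from the top, so the first part equal to \<open>v\<close> is the
  topmost row of length \<open>v\<close>, as the side condition of \<open>cover_c\<close>
  demands.\<close>

fun bump :: "nat \<Rightarrow> nat list \<Rightarrow> nat list option" where
  "bump v [] = None"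
| "bump v (x # xs) = (if x = v then Some (Suc v # xs) else map_option ((#) x) (bump v xs))"

definition add_box :: "nat \<Rightarrow> nat list \<Rightarrow> nat list option" where
  "add_box c \<gamma> = (if c = 0 then None else if c = 1 then Some (1 # \<gamma>) else bump (c - 1) \<gamma>)"

text \<open>The last letter acts first. In a tableau the entry 1 sits in the box added last, so the
  first letter of a word is the column of the entry 1.\<close>

fun act :: "nat list \<Rightarrow> nat list \<Rightarrow> nat list option" where
  "act [] \<gamma> = Some \<gamma>"
| "act (c # w) \<gamma> = Option.bind (act w \<gamma>) (add_box c)"

lemma act_append: "act (u @ v) \<gamma> = Option.bind (act v \<gamma>) (act u)"
  by (induction u) (auto simp: Option.bind_assoc)

lemma bump_Some_iff:
  "bump v \<gamma> = Some \<delta> \<longleftrightarrow>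
     (\<exists>k < length \<gamma>. \<gamma> ! k = v \<and> \<delta> = \<gamma>[k := Suc v] \<and> (\<forall>i < k. \<gamma> ! i \<noteq> v))"
proof (induction \<gamma> arbitrary: \<delta>)
  case (Cons x xs)
  show ?case
  proof (cases "x = v")
    case True
    have "(\<exists>k < length (x # xs). (x # xs) ! k = v \<and> \<delta> = (x # xs)[k := Suc v] \<and> (\<forall>i < k. (x # xs) ! i \<noteq> v))
      \<longleftrightarrow> \<delta> = Suc v # xs" (is "?L \<longleftrightarrow> ?R")
    proof
      assume ?L
      then obtain k where k: "\<delta> = (x # xs)[k := Suc v]" "\<forall>i < k. (x # xs) ! i \<noteq> v" by blast
      then have "k = 0" using True by (metis gr0I nth_Cons_0)
      then show ?R using k by simp
    next
      assume ?R
      then show ?L using True by (intro exI[of _ 0]) simp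
    qed
    then show ?thesis using True by auto
  next
    case False
    have "bump v (x # xs) = Some \<delta> \<longleftrightarrow> (\<exists>\<delta>'. bump v xs = Some \<delta>' \<and> \<delta> = x # \<delta>')"
      using False by auto
    also have "\<dots> \<longleftrightarrow> (\<exists>k < length xs. xs ! k = v \<and> \<delta> = x # xs[k := Suc v] \<and> (\<forall>i < k. xs ! i \<noteq> v))"
      using Cons by auto
    also have "\<dots> \<longleftrightarrow> (\<exists>k < length (x # xs). (x # xs) ! k = v \<and> \<delta> = (x # xs)[k := Suc v] \<and>
        (\<forall>i < k. (x # xs) ! i \<noteq> v))" (is "?L \<longleftrightarrow> ?R")
    proof
      assume ?L
      then obtain k where "k < length xs" "xs ! k = v" "\<delta> = x # xs[k := Suc v]" "\<forall>i < k. xs ! i \<noteq> v"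
        by blast
      then show ?R using False by (intro exI[of _ "Suc k"]) (auto simp: nth_Cons split: nat.splits)
    next
      assume ?R
      then obtain k where k: "k < length (x # xs)" "(x # xs) ! k = v" "\<delta> = (x # xs)[k := Suc v]"
        "\<forall>i < k. (x # xs) ! i \<noteq> v" by blast
      then obtain k' where "k = Suc k'" using False by (cases k) auto
      moreover have "xs ! i \<noteq> v" if "i < k'" for i using k(4)[rule_format, of "Suc i"] that \<open>k = Suc k'\<close> by simp
      ultimately show ?L using k by (intro exI[of _ k']) auto
    qed
    finally show ?thesis .
  qed
qed simp

lemma bump_is_comp: "bump v \<gamma> = Some \<delta> \<Longrightarrow> is_comp \<gamma> \<Longrightarrow> is_comp \<delta>"
  by (induction \<gamma> arbitrary: \<delta>) (auto simp: is_comp_def split: if_splits)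

lemma bump_length: "bump v \<gamma> = Some \<delta> \<Longrightarrow> length \<delta> = length \<gamma>"
  by (induction \<gamma> arbitrary: \<delta>) (auto split: if_splits)

lemma bump_sum: "bump v \<gamma> = Some \<delta> \<Longrightarrow> sum_list \<delta> = Suc (sum_list \<gamma>)"
  by (induction \<gamma> arbitrary: \<delta>) (auto split: if_splits)

lemma add_box_is_comp: "add_box c \<gamma> = Some \<delta> \<Longrightarrow> is_comp \<gamma> \<Longrightarrow> is_comp \<delta>"
  by (auto simp: add_box_def bump_is_comp is_comp_def split: if_splits) (metis bump_is_comp is_comp_def)

lemma add_box_sum: "add_box c \<gamma> = Some \<delta> \<Longrightarrow> sum_list \<delta> = Suc (sum_list \<gamma>)"
  by (auto simp: add_box_def bump_sum split: if_splits)

lemma act_is_comp: "act w \<gamma> = Some \<delta> \<Longrightarrow> is_comp \<gamma> \<Longrightarrow> is_comp \<delta>"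
  by (induction w arbitrary: \<delta>) (auto simp: bind_eq_Some_conv add_box_is_comp)

lemma act_sum: "act w \<gamma> = Some \<delta> \<Longrightarrow> sum_list \<delta> = sum_list \<gamma> + length w"
  by (induction w arbitrary: \<delta>) (auto simp: bind_eq_Some_conv add_box_sum)

lemma cover_c_iff_add_box:
  assumes "is_comp \<gamma>"
  shows "cover_c \<gamma> \<delta> \<longleftrightarrow> (\<exists>c. add_box c \<gamma> = Some \<delta>)"
proof
  assume "cover_c \<gamma> \<delta>"
  then consider "\<delta> = 1 # \<gamma>" | k where "k < length \<gamma>" "\<delta> = \<gamma>[k := \<gamma> ! k + 1]" "\<forall>i < k. \<gamma> ! i \<noteq> \<gamma> ! k"
    by (auto simp: cover_c_def)
  then show "\<exists>c. add_box c \<gamma> = Some \<delta>"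
  proof cases
    case 1
    then show ?thesis by (intro exI[of _ 1]) (auto simp: add_box_def)
  next
    case 2
    then have "0 < \<gamma> ! k" using assms by (auto simp: is_comp_def)
    moreover have "bump (\<gamma> ! k) \<gamma> = Some \<delta>" using 2 by (auto simp: bump_Some_iff)
    ultimately show ?thesis by (intro exI[of _ "Suc (\<gamma> ! k)"]) (auto simp: add_box_def)
  qed
next
  assume "\<exists>c. add_box c \<gamma> = Some \<delta>"
  then show "cover_c \<gamma> \<delta>"
    by (auto simp: add_box_def cover_c_def bump_Some_iff split: if_splits)
qed

lemma less_c_iff_act:
  assumes "is_comp \<gamma>"
  shows "less_c \<gamma> \<delta> \<longleftrightarrow> (\<exists>w. w \<noteq> [] \<and> act w \<gamma> = Some \<delta>)"
proof
  assume "less_c \<gamma> \<delta>"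
  then have "cover_c\<^sup>+\<^sup>+ \<gamma> \<delta>" by (simp add: less_c_def)
  then show "\<exists>w. w \<noteq> [] \<and> act w \<gamma> = Some \<delta>"
  proof (induction rule: tranclp_induct)
    case (base \<delta>)
    then obtain c where "add_box c \<gamma> = Some \<delta>" using assms cover_c_iff_add_box by blast
    then show ?case by (intro exI[of _ "[c]"]) auto
  next
    case (step \<delta> \<epsilon>)
    then obtain w where w: "w \<noteq> []" "act w \<gamma> = Some \<delta>" by blast
    then obtain c where "add_box c \<delta> = Some \<epsilon>"
      using step assms act_is_comp cover_c_iff_add_box by blast
    then show ?case using w by (intro exI[of _ "c # w"]) auto
  qed
next
  assume "\<exists>w. w \<noteq> [] \<and> act w \<gamma> = Some \<delta>"
  then obtain w where "w \<noteq> []" "act w \<gamma> = Some \<delta>" by blast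
  then show "less_c \<gamma> \<delta>"
  proof (induction w arbitrary: \<delta>)
    case (Cons c w)
    then obtain \<epsilon> where \<epsilon>: "act w \<gamma> = Some \<epsilon>" "add_box c \<epsilon> = Some \<delta>"
      by (auto simp: bind_eq_Some_conv)
    then have cov: "cover_c \<epsilon> \<delta>" using assms act_is_comp cover_c_iff_add_box by blast
    show ?case
    proof (cases "w = []")
      case True
      then show ?thesis using \<epsilon> cov by (auto simp: less_c_def)
    next
      case False
      then show ?thesis using Cons.IH[OF False \<epsilon>(1)] cov by (auto simp: less_c_def)
    qed
  qed simp
qed

section \<open>Descent compositions of words\<close>

fun dcomp :: "nat list \<Rightarrow> nat list" where
  "dcomp [] = []"
| "dcomp [x] = [1]"
| "dcomp (x # y # w) = (if x \<le> y then 1 # dcomp (y # w)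
     else (case dcomp (y # w) of [] \<Rightarrow> [] | c # cs \<Rightarrow> Suc c # cs))"

lemma dcomp_Nil_iff [simp]: "dcomp w = [] \<longleftrightarrow> w = []"
  by (induction w rule: dcomp.induct) (auto split: list.splits)

lemma is_comp_dcomp: "is_comp (dcomp w)"
proof (induction w rule: dcomp.induct)
  case (3 x y w)
  then show ?case by (cases "dcomp (y # w)") (auto simp: is_comp_def)
qed (auto simp: is_comp_def)

lemma sum_dcomp: "sum_list (dcomp w) = length w"
  by (induction w rule: dcomp.induct) (auto split: list.splits)

text \<open>The parts of \<open>dcomp w\<close> are the lengths of the maximal strictly decreasing
  runs. A hook with \<open>k\<close> leading ones means \<open>k\<close> weak ascents followed by
  strict drops only; the letter at index \<open>k\<close> is the peak and belongs to both
  halves.\<close>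

lemma dcomp_hook_iff:
  assumes "k < length w"
  shows "dcomp w = replicate k 1 @ [length w - k] \<longleftrightarrow>
     sorted (take (Suc k) w) \<and> sorted_wrt (>) (drop k w)"
  using assms
proof (induction w arbitrary: k rule: dcomp.induct)
  case (3 x y w)
  obtain c cs where c: "dcomp (y # w) = c # cs" by (cases "dcomp (y # w)") auto
  have c0: "0 < c" using is_comp_dcomp[of "y # w"] c by (auto simp: is_comp_def)
  show ?case
  proof (cases k)
    case 0
    have "dcomp (y # w) = [length (y # w)] \<longleftrightarrow> sorted_wrt (>) (y # w)"
    proof (cases "x \<le> y")
      case True then show ?thesis using "3.IH"(1)[of 0] by simp
    next
      case False then show ?thesis using "3.IH"(2)[of 0] by simp
    qed
    then show ?thesis using 0 c by (auto simp: not_le dest: less_trans)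
  next
    case (Suc k')
    show ?thesis
    proof (cases "x \<le> y")
      case True
      have "dcomp (y # w) = replicate k' 1 @ [length (y # w) - k'] \<longleftrightarrow>
        sorted (take (Suc k') (y # w)) \<and> sorted_wrt (>) (drop k' (y # w))"
        using "3.IH"(1)[OF True, of k'] "3.prems" Suc by simp
      then show ?thesis using Suc True by (auto dest: order_trans)
    next
      case False
      then show ?thesis using c c0 Suc by auto
    qed
  qed
qed auto

section \<open>Columns of a composition\<close>

fun cols :: "nat list \<Rightarrow> nat \<Rightarrow> nat set" where
  "cols [] j = {}"
| "cols (x # \<gamma>) j = (if 1 \<le> j \<and> j \<le> x then insert (length \<gamma>) (cols \<gamma> j) else cols \<gamma> j)"

lemma cols_bound: "cols \<gamma> j \<subseteq> {..<length \<gamma>}"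
  by (induction \<gamma>) auto

lemma finite_cols [simp]: "finite (cols \<gamma> j)"
  using cols_bound finite_subset by blast

lemma cols_zero [simp]: "cols \<gamma> 0 = {}"
  by (induction \<gamma>) auto

lemma cols_antimono: "1 \<le> i \<Longrightarrow> i \<le> j \<Longrightarrow> cols \<gamma> j \<subseteq> cols \<gamma> i"
  by (induction \<gamma>) auto

lemma cols_one: "is_comp \<gamma> \<Longrightarrow> cols \<gamma> 1 = {..<length \<gamma>}"
  by (induction \<gamma>) (auto simp: is_comp_def)

lemma in_cols_iff: "i \<in> cols \<gamma> j \<longleftrightarrow> i < length \<gamma> \<and> 1 \<le> j \<and> j \<le> \<gamma> ! (length \<gamma> - Suc i)"
proof (induction \<gamma>)
  case (Cons x \<gamma>)
  show ?case
  proof (cases "i < length \<gamma>")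
    case True
    then have "length \<gamma> - i = Suc (length \<gamma> - Suc i)" by simp
    then show ?thesis using Cons True by auto
  next
    case False
    then show ?thesis using Cons by (cases "i = length \<gamma>") auto
  qed
qed simp

text \<open>Column 1 gives the number of parts because all parts are positive, and a part is
  determined by the columns that contain its row.\<close>

lemma cols_inject:
  assumes "is_comp \<gamma>" "is_comp \<delta>" "cols \<gamma> = cols \<delta>"
  shows "\<gamma> = \<delta>"
proof -
  have len: "length \<gamma> = length \<delta>"
    using cols_one[OF assms(1)] cols_one[OF assms(2)] assms(3) by simp
  show ?thesis
  proof (rule nth_equalityI[OF len])
    fix k assume k: "k < length \<gamma>"
    define i where "i = length \<gamma> - Suc k"
    have "1 \<le> j \<and> j \<le> \<gamma> ! k \<longleftrightarrow> 1 \<le> j \<and> j \<le> \<delta> ! k" for j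
    proof -
      have "i < length \<gamma>" "length \<gamma> - Suc i = k" "length \<delta> - Suc i = k" using k len by (auto simp: i_def)
      then show ?thesis using in_cols_iff[of i \<gamma> j] in_cols_iff[of i \<delta> j] len assms(3) by simp
    qed
    then show "\<gamma> ! k = \<delta> ! k" by (metis One_nat_def Suc_leI le_antisym le_refl not_gr_zero)
  qed
qed

text \<open>The rows of the boxes of column \<open>c\<close> are numbered from the bottom, starting with 0, so that
  prepending a part does not renumber them. The new box of column \<open>c\<close> depends only on
  columns \<open>c - 1\<close> and \<open>c\<close>.\<close>

definition grow1 :: "nat \<Rightarrow> nat set \<Rightarrow> nat set \<Rightarrow> nat set option" where
  "grow1 c B C = (if c = 0 then None else if c = 1 then Some (insert (card C) C)
     else if B - C = {} then None else Some (insert (Max (B - C)) C))"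

definition step :: "nat \<Rightarrow> (nat \<Rightarrow> nat set) \<Rightarrow> (nat \<Rightarrow> nat set) option" where
  "step c X = map_option (\<lambda>C. X(c := C)) (grow1 c (X (c - 1)) (X c))"

fun run :: "nat list \<Rightarrow> (nat \<Rightarrow> nat set) \<Rightarrow> (nat \<Rightarrow> nat set) option" where
  "run [] X = Some X"
| "run (c # w) X = Option.bind (run w X) (step c)"

lemma run_append: "run (u @ v) X = Option.bind (run v X) (run u)"
  by (induction u) (auto simp: Option.bind_assoc)

text \<open>A row has length exactly \<open>v\<close> iff it lies in column \<open>v\<close> but not
  in column \<open>Suc v\<close>. Row numbers increase upwards, so the topmost such row is the
  maximum of the difference, and \<open>bump\<close> fails iff the difference is empty.\<close>

lemma bump_cols:
  assumes "0 < v"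
  shows "map_option cols (bump v \<gamma>) =
    (if cols \<gamma> v - cols \<gamma> (Suc v) = {} then None
     else Some ((cols \<gamma>)(Suc v := insert (Max (cols \<gamma> v - cols \<gamma> (Suc v))) (cols \<gamma> (Suc v)))))"
proof (induction \<gamma>)
  case (Cons x \<gamma>)
  let ?D = "cols \<gamma> v - cols \<gamma> (Suc v)"
  have b: "y < length \<gamma>" if "y \<in> cols \<gamma> j" for y j using that cols_bound by blast
  show ?case
  proof (cases "x = v")
    case True
    have D: "cols (x # \<gamma>) v - cols (x # \<gamma>) (Suc v) = insert (length \<gamma>) ?D"
      using True b assms by auto
    have M: "Max (insert (length \<gamma>) ?D) = length \<gamma>"
      by (rule Max_eqI) (auto dest: b)
    show ?thesis unfolding D M using True by (auto simp: fun_eq_iff)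
  next
    case False
    then have D: "cols (x # \<gamma>) v - cols (x # \<gamma>) (Suc v) = ?D"
      using b by auto
    show ?thesis
    proof (cases "bump v \<gamma>")
      case None
      then show ?thesis unfolding D using False Cons by (auto split: if_splits)
    next
      case (Some \<delta>)
      then have *: "?D \<noteq> {}" "cols \<delta> = (cols \<gamma>)(Suc v := insert (Max ?D) (cols \<gamma> (Suc v)))"
        using Cons by (auto split: if_splits)
      have "length \<delta> = length \<gamma>" using Some bump_length by blast
      then have "cols (x # \<delta>) = (cols (x # \<gamma>))(Suc v := insert (Max ?D) (cols (x # \<gamma>) (Suc v)))"
        using *(2) by (auto simp: fun_eq_iff)
      then show ?thesis unfolding D using False Some *(1) by auto
    qed
  qed
qed simp


lemma add_box_cols: "map_option cols (add_box c \<gamma>) = step c (cols \<gamma>)" if "is_comp \<gamma>"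
proof -
  consider "c = 0" | "c = 1" | v where "c = Suc v" "0 < v" by (metis One_nat_def not0_implies_Suc not_gr_zero)
  then show ?thesis
  proof cases
    case 2
    have "card (cols \<gamma> 1) = length \<gamma>" using cols_one[OF that] by simp
    then have "cols (1 # \<gamma>) = (cols \<gamma>)(1 := insert (card (cols \<gamma> 1)) (cols \<gamma> 1))"
      by (auto simp: fun_eq_iff)
    then show ?thesis using 2 by (simp add: add_box_def step_def grow1_def)
  qed (auto simp: add_box_def step_def grow1_def bump_cols)
qed

lemma act_cols: "map_option cols (act w \<gamma>) = run w (cols \<gamma>)" if "is_comp \<gamma>"
proof (induction w)
  case (Cons c w)
  show ?case
  proof (cases "act w \<gamma>")
    case (Some \<delta>)
    then have "run w (cols \<gamma>) = Some (cols \<delta>)" using Cons by simp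
    then show ?thesis using Some add_box_cols[OF act_is_comp[OF Some that], of c] by simp
  qed (use Cons in simp)
qed simp

lemma act_eq_Some_iff_run:
  assumes "is_comp \<gamma>" "is_comp \<delta>"
  shows "act w \<gamma> = Some \<delta> \<longleftrightarrow> run w (cols \<gamma>) = Some (cols \<delta>)"
  using act_cols[OF assms(1), of w] act_is_comp[OF _ assms(1), of w] cols_inject assms
  by (cases "act w \<gamma>") auto

section \<open>Repeated growth of a single column\<close>

fun grow :: "nat \<Rightarrow> nat \<Rightarrow> nat set \<Rightarrow> nat set \<Rightarrow> nat set option" where
  "grow c 0 B C = Some C"
| "grow c (Suc e) B C = Option.bind (grow1 c B C) (grow c e B)"

lemma grow_add: "grow c (x + y) B C = Option.bind (grow c y B C) (grow c x B)"
proof (induction y arbitrary: C)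
  case (Suc y)
  then show ?case by (cases "grow1 c B C") auto
qed simp

lemma grow_Suc_0: "grow c (Suc 0) B C = grow1 c B C"
  by (cases "grow1 c B C") auto

lemma run_replicate:
  "0 < c \<Longrightarrow> run (replicate e c) X = map_option (\<lambda>C. X(c := C)) (grow c e (X (c - 1)) (X c))"
proof (induction e)
  case (Suc e)
  \<comment> \<open>\<open>grow\<close> unfolds its first move but \<open>run\<close> its last one,
    so the block of moves is split at the other end.\<close>
  have "grow c (Suc e) (X (c - 1)) (X c) = Option.bind (grow c e (X (c - 1)) (X c)) (grow1 c (X (c - 1)))"
    using grow_add[of c 1 e "X (c - 1)" "X c"] by (cases "grow c e (X (c - 1)) (X c)") (auto simp del: grow.simps(2) simp: grow_Suc_0)
  then show ?case using Suc
    by (cases "grow c e (X (c - 1)) (X c)") (auto simp: step_def fun_eq_iff intro!: arg_cong2[of _ _ _ _ map_option] simp del: grow.simps(2))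
qed simp

lemma run_unchanged: "run w X = Some Y \<Longrightarrow> c \<notin> set w \<Longrightarrow> Y c = X c"
  by (induction w arbitrary: Y) (auto simp: bind_eq_Some_conv step_def)

text \<open>In column 1 the added row has number \<open>card C\<close>. It is a new row when
  \<open>C\<close> is an initial segment, so this property is carried along.\<close>

definition col_inv :: "nat \<Rightarrow> nat set \<Rightarrow> bool" where
  "col_inv c C \<longleftrightarrow> finite C \<and> (c = 1 \<longrightarrow> C = {..<card C})"

lemma grow1_col_inv:
  assumes "grow1 c B C = Some C'" "col_inv c C" "finite B"
  shows "col_inv c C'" "C \<subseteq> C'" "card C' = Suc (card C)"
proof -
  consider "c = 1" "C' = insert (card C) C" | "c \<noteq> 1" "B - C \<noteq> {}" "C' = insert (Max (B - C)) C"
    using assms(1) by (auto simp: grow1_def split: if_splits)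
  then have "col_inv c C' \<and> C \<subseteq> C' \<and> card C' = Suc (card C)"
  proof cases
    case 1
    obtain l where l: "C = {..<l}" using assms 1 by (auto simp: col_inv_def)
    then have "C' = {..<Suc l}" using 1 by auto
    then show ?thesis using l by (auto simp: col_inv_def)
  next
    case 2
    have "Max (B - C) \<in> B - C" using 2 assms(3) by (intro Max_in) auto
    then show ?thesis using 2 assms by (auto simp: col_inv_def)
  qed
  then show "col_inv c C'" "C \<subseteq> C'" "card C' = Suc (card C)" by auto
qed

lemma grow_col_inv:
  assumes "grow c e B C = Some C'" "col_inv c C" "finite B"
  shows "col_inv c C' \<and> C \<subseteq> C' \<and> card C' = card C + e"
  using assms
proof (induction e arbitrary: C)
  case (Suc e)
  then obtain C1 where "grow1 c B C = Some C1" "grow c e B C1 = Some C'" by (auto simp: bind_eq_Some_conv)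
  then show ?case using Suc.IH[of C1] grow1_col_inv[of c B C C1] Suc.prems by auto
qed auto

text \<open>Taking the largest available row \<open>e\<close> times collects the \<open>e\<close>
  largest elements of \<open>B - C\<close>, and these form the only upward closed subset of that
  size.\<close>

lemma grow_iff:
  assumes "finite B" "finite C" "2 \<le> c"
  shows "grow c e B C = Some C' \<longleftrightarrow> C \<subseteq> C' \<and> finite C' \<and> C' - C \<subseteq> B \<and> card C' = card C + e \<and>
     (\<forall>x\<in>C' - C. \<forall>y\<in>B - C. x < y \<longrightarrow> y \<in> C')"
  using assms(2)
proof (induction e arbitrary: C)
  case 0
  have "C = C'" if "C \<subseteq> C'" "finite C'" "card C' = card C" using that card_subset_eq[of C' C] by simp
  then show ?case using 0 by auto
next
  case (Suc e)
  show ?case (is "?L \<longleftrightarrow> ?R")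
  proof (cases "B - C = {}")
    case True
    have "\<not> ?R"
    proof
      assume ?R
      then have "C' = C" using True by auto
      then show False using \<open>?R\<close> by simp
    qed
    then show ?thesis using True assms by (auto simp: grow1_def)
  next
    case False
    define m where "m = Max (B - C)"
    have m: "m \<in> B - C" unfolding m_def using False assms by (intro Max_in) auto
    have mm: "y \<le> m" if "y \<in> B - C" for y unfolding m_def using that assms by (intro Max_ge) auto
    have "?L \<longleftrightarrow> grow c e B (insert m C) = Some C'"
      using False assms by (auto simp: grow1_def m_def)
    also have "\<dots> \<longleftrightarrow> insert m C \<subseteq> C' \<and> finite C' \<and> C' - insert m C \<subseteq> B \<and> card C' = card (insert m C) + e \<and>
     (\<forall>x\<in>C' - insert m C. \<forall>y\<in>B - insert m C. x < y \<longrightarrow> y \<in> C')"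
      using Suc by simp
    also have "\<dots> \<longleftrightarrow> ?R" (is "?L' \<longleftrightarrow> _")
    proof
      assume L: ?L'
      have "card C' = card C + Suc e" using L m Suc.prems by simp
      moreover have "y \<in> C'" if "x \<in> C' - C" "y \<in> B - C" "x < y" for x y
      proof -
        have "x \<noteq> m" using mm[OF that(2)] that(3) by auto
        then show ?thesis using L that by (cases "y = m") blast+
      qed
      moreover have "C' - C \<subseteq> B" using L m by blast
      ultimately show ?R using L by blast
    next
      assume R: ?R
      have "C' - C \<noteq> {}" using R by auto
      then obtain x where x: "x \<in> C' - C" by blast
      then have "x \<le> m" using R mm by blast
      \<comment> \<open>Any new row forces the maximum \<open>m\<close> into \<open>C'\<close> by
        upward closure, so the first greedy move is consistent with \<open>C'\<close>.\<close>
      then have mC: "m \<in> C'" using x m R by (cases "x = m") auto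
      moreover have "card C' = card (insert m C) + e" using R m Suc.prems by simp
      ultimately show ?L' using R by blast
    qed
    finally show ?thesis .
  qed
qed

section \<open>Signed sums over hook words\<close>

text \<open>\<open>k\<close> is the position of the peak, counted from 0; its parity is the sign of
  the word in \<Psi>. The lower bound \<open>a\<close> on the letters is what moves in the induction
  on the smallest letter.\<close>

definition hookp :: "nat \<Rightarrow> nat \<Rightarrow> nat list \<Rightarrow> bool" where
  "hookp a k w \<longleftrightarrow> k < length w \<and> sorted (take (Suc k) w) \<and> sorted_wrt (>) (drop k w) \<and> (\<forall>c\<in>set w. a \<le> c)"

lemma hookp_iff:
  "hookp a k w \<longleftrightarrow> (\<exists>u p v. w = u @ p # v \<and> length u = k \<and> sorted (u @ [p]) \<and>
     sorted_wrt (>) (p # v) \<and> (\<forall>c\<in>set w. a \<le> c))" (is "?L \<longleftrightarrow> ?R")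
proof
  assume L: ?L
  then have "w = take k w @ w ! k # drop (Suc k) w" by (simp add: hookp_def id_take_nth_drop)
  moreover have "take (Suc k) w = take k w @ [w ! k]" "drop k w = w ! k # drop (Suc k) w" "length (take k w) = k"
    using L by (auto simp: hookp_def take_Suc_conv_app_nth Cons_nth_drop_Suc)
  ultimately show ?R using L unfolding hookp_def by metis
next
  assume ?R
  then show ?L by (auto simp: hookp_def)
qed

lemma sorted_split_min:
  "sorted u \<Longrightarrow> \<forall>c\<in>set u. a \<le> c \<Longrightarrow> \<exists>x u'. u = replicate x a @ u' \<and> (\<forall>c\<in>set u'. a < c)" for a :: nat
proof (induction u)
  case (Cons b u)
  show ?case
  proof (cases "b = a")
    case True
    then obtain x u' where "u = replicate x a @ u'" "\<forall>c\<in>set u'. a < c" using Cons by auto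
    then show ?thesis using True by (intro exI[of _ "Suc x"]) auto
  next
    case False
    then show ?thesis using Cons by (intro exI[of _ 0] exI[of _ "b # u"]) auto
  qed
qed auto

lemma strict_desc_split_min:
  "sorted_wrt (>) v \<Longrightarrow> \<forall>c\<in>set v. a \<le> c \<Longrightarrow>
    \<exists>y v'. y \<le> 1 \<and> v = v' @ replicate y a \<and> (\<forall>c\<in>set v'. a < c)" for a :: nat
proof (cases v rule: rev_cases)
  case (snoc v' b)
  assume "sorted_wrt (>) v" "\<forall>c\<in>set v. a \<le> c"
  then have *: "\<forall>c\<in>set v'. b < c" "a \<le> b" using snoc by (auto simp: sorted_wrt_append)
  show ?thesis
  proof (cases "b = a")
    case True
    then show ?thesis using * snoc by (intro exI[of _ 1] exI[of _ v']) auto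
  next
    case False
    then show ?thesis using * snoc by (intro exI[of _ 0] exI[of _ v]) auto
  qed
qed auto

text \<open>The smallest letter can only stand at the two ends: any number of times in front, at
  most once at the back, because the second half strictly decreases. If the peak itself is
  \<open>a\<close>, every letter is \<open>a\<close>.\<close>

lemma hookp_cases:
  assumes "hookp a k w"
  shows "hookp (Suc a) k w \<or> w = replicate (Suc k) a \<or>
    (\<exists>x y k' w'. hookp (Suc a) k' w' \<and> k = x + k' \<and> y \<le> 1 \<and> 0 < x + y \<and>
       w = replicate x a @ w' @ replicate y a)"
proof -
  obtain u p v where w: "w = u @ p # v" "length u = k" "sorted (u @ [p])" "sorted_wrt (>) (p # v)"
    "\<forall>c\<in>set w. a \<le> c" using assms hookp_iff by auto
  show ?thesis
  proof (cases "p = a")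
    case True
    then have "v = []" using w(1,4,5) by (cases v) auto
    moreover have "u = replicate k a"
    proof -
      have "c = a" if "c \<in> set u" for c
      proof (rule antisym)
        show "c \<le> a" using w(3) True that by (auto simp: sorted_append)
        show "a \<le> c" using w(1,5) that by auto
      qed
      then show ?thesis using w(2) by (metis replicate_eqI)
    qed
    ultimately show ?thesis using w(1) True by (simp add: replicate_append_same)
  next
    case False
    obtain x u' where u: "u = replicate x a @ u'" "\<forall>c\<in>set u'. a < c"
      using sorted_split_min[of u a] w by (auto simp: sorted_append)
    obtain y v' where v: "y \<le> 1" "v = v' @ replicate y a" "\<forall>c\<in>set v'. a < c"
      using strict_desc_split_min[of v a] w by auto
    define w' where "w' = u' @ p # v'"
    have "sorted (u' @ [p])" using w(3) u(1) by (simp add: sorted_append)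
    moreover have "sorted_wrt (>) (p # v')" using w(4) v(2) by (simp add: sorted_wrt_append)
    moreover have "a < p" using w(1,5) False by simp
    then have "\<forall>c\<in>set w'. Suc a \<le> c" using u(2) v(3) by (auto simp: w'_def Suc_le_eq)
    ultimately have "hookp (Suc a) (length u') w'"
      unfolding hookp_iff w'_def by blast
    moreover have "k = x + length u'" using w u by simp
    moreover have "w = replicate x a @ w' @ replicate y a" using w u v by (simp add: w'_def)
    ultimately show ?thesis using v(1) by (cases "x + y = 0") (simp, blast)
  qed
qed

lemma hookp_extend:
  assumes "hookp (Suc a) k w" "y \<le> 1"
  shows "hookp a (x + k) (replicate x a @ w @ replicate y a)"
proof -
  obtain u p v where w: "w = u @ p # v" "length u = k" "sorted (u @ [p])" "sorted_wrt (>) (p # v)"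
    "\<forall>c\<in>set w. Suc a \<le> c" using assms hookp_iff by auto
  have "sorted_wrt (>) (replicate y a)" using assms(2) by (cases y) auto
  moreover have gt: "\<forall>c\<in>set u. a < c" "a < p" "\<forall>c\<in>set v. a < c"
    using w(1,5) by (auto simp: Suc_le_eq)
  ultimately have "sorted_wrt (>) (p # v @ replicate y a)" using w(4) by (auto simp: sorted_wrt_append)
  moreover have "sorted (replicate x a @ u @ [p])"
    using w(3) gt by (auto simp: sorted_append sorted_replicate intro: less_imp_le)
  moreover have "\<forall>c\<in>set (replicate x a @ w @ replicate y a). a \<le> c" using w(5) by auto
  ultimately show ?thesis
    unfolding hookp_iff using w(1,2)
    by (intro exI[of _ "replicate x a @ u"] exI[of _ p] exI[of _ "v @ replicate y a"]) simp
qed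

lemma hookp_replicate: "hookp a k (replicate (Suc k) a)"
proof -
  have "drop k (replicate (Suc k) a) = [a]" by (induction k) auto
  then show ?thesis by (auto simp: hookp_def sorted_replicate simp del: replicate_Suc)
qed

text \<open>The letters of \<open>w\<close> exceed \<open>a\<close>, so they change neither column
  \<open>a - 1\<close> nor column \<open>a\<close>. Both batches of \<open>a\<close> thus act as a
  single growth by \<open>x + y\<close>, and \<open>w\<close> sees column \<open>a\<close> frozen in
  its state after the first \<open>y\<close> moves.\<close>

lemma run_peel:
  assumes "0 < a" "\<forall>c\<in>set w. a < c"
  shows "run (replicate x a @ w @ replicate y a) X = Some Y \<longleftrightarrow>
    grow a (x + y) (X (a - 1)) (X a) = Some (Y a) \<and>
    (\<exists>C. grow a y (X (a - 1)) (X a) = Some C \<and> run w (X(a := C)) = Some (Y(a := C)))"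
    (is "?L \<longleftrightarrow> ?R")
proof -
  have a: "a \<notin> set w" "a - 1 \<notin> set w" "a - 1 \<noteq> a" using assms by auto
  show ?thesis
  proof
    assume ?L
    then obtain Z Z' where Z: "run (replicate y a) X = Some Z'" "run w Z' = Some Z" "run (replicate x a) Z = Some Y"
      by (auto simp: run_append bind_eq_Some_conv)
    then obtain C where C: "grow a y (X (a - 1)) (X a) = Some C" "Z' = X(a := C)"
      using run_replicate[OF assms(1), of y X] by auto
    have ZZ: "Z a = C" "Z (a - 1) = X (a - 1)" using run_unchanged[OF Z(2)] a C by auto
    obtain C' where C': "grow a x (X (a - 1)) C = Some C'" "Y = Z(a := C')"
      using run_replicate[OF assms(1), of x Z] Z(3) ZZ by (metis map_option_eq_Some)
    have "Z = Y(a := C)" using C' ZZ by auto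
    then show ?R using C C' Z by (auto simp: grow_add)
  next
    assume ?R
    then obtain C where C: "grow a (x + y) (X (a - 1)) (X a) = Some (Y a)"
      "grow a y (X (a - 1)) (X a) = Some C" "run w (X(a := C)) = Some (Y(a := C))" by blast
    have "run (replicate y a) X = Some (X(a := C))" using run_replicate[OF assms(1)] C by simp
    moreover have "Y (a - 1) = X (a - 1)" using run_unchanged[OF C(3) a(2)] a by auto
    then have "run (replicate x a) (Y(a := C)) = Some Y"
      using run_replicate[OF assms(1), of x "Y(a := C)"] C(1,2) a by (simp add: grow_add)
    ultimately show ?L using C(3) by (simp add: run_append)
  qed
qed

section \<open>Hook words between two families of columns\<close>

definition state_inv :: "(nat \<Rightarrow> nat set) \<Rightarrow> bool" where
  "state_inv X \<longleftrightarrow> (\<forall>c. col_inv c (X c))"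

lemma step_inv:
  assumes "step c X = Some Y" "state_inv X"
  shows "state_inv Y \<and> X j \<subseteq> Y j \<and> card (Y j) = card (X j) + of_bool (j = c)"
proof -
  obtain C where C: "grow1 c (X (c - 1)) (X c) = Some C" "Y = X(c := C)"
    using assms(1) by (auto simp: step_def)
  have fin: "finite (X (c - 1))" "col_inv c (X c)" using assms(2) by (auto simp: state_inv_def col_inv_def)
  note g = grow1_col_inv[OF C(1) fin(2,1)]
  show ?thesis
    using g assms(2) C(2) by (auto simp: state_inv_def)
qed

lemma run_inv:
  assumes "run w X = Some Y" "state_inv X"
  shows "state_inv Y \<and> X j \<subseteq> Y j \<and> card (Y j) = card (X j) + count_list w j"
  using assms(1)
proof (induction w arbitrary: Y)
  case (Cons c w)
  then obtain Z where Z: "run w X = Some Z" "step c Z = Some Y" by (auto simp: bind_eq_Some_conv)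
  then show ?case using Cons.IH[OF Z(1)] step_inv[OF Z(2), of j] by auto
qed (use assms in auto)

lemma run_changed:
  assumes "run w X = Some Y" "state_inv X" "c \<in> set w"
  shows "X c \<noteq> Y c"
proof -
  have "count_list w c \<noteq> 0" using assms(3) by (simp add: count_list_0_iff)
  then show ?thesis using run_inv[OF assms(1,2), of c] by auto
qed

definition hook_words :: "nat \<Rightarrow> (nat \<Rightarrow> nat set) \<Rightarrow> (nat \<Rightarrow> nat set) \<Rightarrow> (nat \<times> nat list) set" where
  "hook_words a X Y = {(k, w). hookp a k w \<and> run w X = Some Y}"

definition changed :: "(nat \<Rightarrow> nat set) \<Rightarrow> (nat \<Rightarrow> nat set) \<Rightarrow> nat set" where
  "changed X Y = {j. X j \<noteq> Y j}"

definition newc :: "(nat \<Rightarrow> nat set) \<Rightarrow> (nat \<Rightarrow> nat set) \<Rightarrow> nat \<Rightarrow> nat" where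
  "newc X Y j = card (Y j) - card (X j)"

text \<open>The row of the first new box of column \<open>j\<close> is the bottommost new one if \<open>j = 1\<close>, but the topmost
  one otherwise; this is the asymmetry in the definition of nc border strips.\<close>

definition firstrow :: "(nat \<Rightarrow> nat set) \<Rightarrow> (nat \<Rightarrow> nat set) \<Rightarrow> nat \<Rightarrow> nat" where
  "firstrow X Y j = (if j = 1 then card (X 1) else Max (Y j - X j))"

definition grows :: "(nat \<Rightarrow> nat set) \<Rightarrow> (nat \<Rightarrow> nat set) \<Rightarrow> nat \<Rightarrow> nat set \<Rightarrow> bool" where
  "grows X Y j B \<longleftrightarrow> grow j (newc X Y j) B (X j) = Some (Y j)"

text \<open>The two terms correspond to the hook words with and without the letter \<open>j\<close> in the decreasing
  part: in the first case the first new box of column \<open>j\<close> is present before column \<open>Suc j\<close> grows.\<close>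

definition link :: "(nat \<Rightarrow> nat set) \<Rightarrow> (nat \<Rightarrow> nat set) \<Rightarrow> nat \<Rightarrow> rat" where
  "link X Y j = of_bool (grows X Y (Suc j) (insert (firstrow X Y j) (X j))) - of_bool (grows X Y (Suc j) (X j))"

text \<open>Closed form of the signed sum. A letter \<open>j\<close> below the maximum adds
  \<open>newc X Y j\<close> to the peak position, or one less if it also occurs in the decreasing
  part; the maximum always adds one less, as one copy is the peak. Factoring out
  \<open>(-1) ^ (newc X Y j - 1)\<close> leaves the signs of \<open>link\<close>. The value 0 for no
  change reflects that hook words are nonempty.\<close>

definition hooksum :: "(nat \<Rightarrow> nat set) \<Rightarrow> (nat \<Rightarrow> nat set) \<Rightarrow> rat" where
  "hooksum X Y = (let S = changed X Y in if S = {} then 0 else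
     of_bool (grows X Y (Min S) (X (Min S - 1))) * (\<Prod>j\<in>S. (-1) ^ (newc X Y j - 1)) *
     (\<Prod>j\<in>S - {Max S}. link X Y j))"

lemma hook_words_no_change:
  assumes "state_inv X"
  shows "hook_words a X X = {}"
proof -
  have "False" if "hookp a k w" "run w X = Some X" for k w
  proof -
    have "w \<noteq> []" using that(1) by (auto simp: hookp_def)
    then obtain c where "c \<in> set w" by (cases w) auto
    then show False using run_changed[OF that(2) assms] by auto
  qed
  then show ?thesis by (auto simp: hook_words_def)
qed

text \<open>The first added row can be recovered from the start and the end: greedy growth beyond
  column 1 begins with the largest new row, in column 1 with the next free number.\<close>

lemma grow1_firstrow:
  assumes "grow a (Suc e) B C = Some C'" "finite B" "finite C" 
  shows "grow1 a B C = Some (insert (if a = 1 then card C else Max (C' - C)) C)"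
proof -
  have "a \<noteq> 0" using assms(1) by (cases "a = 0") (auto simp: grow1_def)
  show ?thesis
  proof (cases "a = 1")
    case False
    then have a2: "2 \<le> a" using \<open>a \<noteq> 0\<close> by simp
    have ne: "B - C \<noteq> {}" using assms(1) False by (auto simp: grow1_def split: if_splits)
    have mB: "Max (B - C) \<in> B - C" using ne assms by (intro Max_in) auto
    have s: "C' - C \<subseteq> B - C" "finite C'" using iffD1[OF grow_iff[OF assms(2,3) a2] assms(1)] by auto
    have "grow a e B (insert (Max (B - C)) C) = Some C'" using assms(1) ne False by (auto simp: grow1_def split: if_splits)
    then have "Max (B - C) \<in> C'" using grow_iff[of B "insert (Max (B - C)) C" a e C'] assms a2 by auto
    then have "Max (C' - C) = Max (B - C)"
      using s mB assms(2) by (intro Max_eqI) (auto intro: Max_ge)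
    then show ?thesis using ne False \<open>a \<noteq> 0\<close> by (simp add: grow1_def)
  qed (simp add: grow1_def)
qed

lemma hook_words_min_unchanged:
  assumes "a \<notin> changed X Y" "state_inv X"
  shows "hook_words a X Y = hook_words (Suc a) X Y"
proof -
  have "hookp (Suc a) k w" if "hookp a k w" "run w X = Some Y" for k w
  proof -
    have "a \<notin> set w" using run_changed[OF that(2) assms(2)] assms(1) by (auto simp: changed_def)
    then show ?thesis using that(1) by (auto simp: hookp_def Suc_le_eq order.strict_iff_order)
  qed
  moreover have "hookp a k w" if "hookp (Suc a) k w" for k w using that by (auto simp: hookp_def)
  ultimately show ?thesis by (auto simp: hook_words_def)
qed

text \<open>The number \<open>e\<close> of copies of \<open>a\<close> is forced, so one binary
  choice remains: all copies in front, or one at the back. The copy at the back acts before the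
  larger letters, which then start from \<open>X1\<close>. Overwriting column \<open>a\<close> of
  the target says that the inner word leaves this column alone.\<close>

lemma hook_words_min_changed:
  assumes "0 < a" "a \<in> changed X Y" "state_inv X"
  defines "e \<equiv> newc X Y a" and "X1 \<equiv> X(a := insert (firstrow X Y a) (X a))"
  shows "hook_words a X Y = (if grows X Y a (X (a - 1)) then
      (if changed X Y = {a} then {(e - 1, replicate e a)} else {}) \<union>
      (\<lambda>(k, w). (e + k, replicate e a @ w)) ` hook_words (Suc a) X (Y(a := X a)) \<union>
      (\<lambda>(k, w). (e - 1 + k, replicate (e - 1) a @ w @ [a])) ` hook_words (Suc a) X1 (Y(a := X1 a))
    else {})" and "grows X Y a (X (a - 1)) \<Longrightarrow> 0 < e"
proof -
  have fin: "finite (X (a - 1))" "col_inv a (X a)" "finite (X a)"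
    using assms(3) by (auto simp: state_inv_def col_inv_def)
  have e_eq: "x = e" if "grow a x (X (a - 1)) (X a) = Some (Y a)" for x
    using grow_col_inv[OF that fin(2,1)] by (simp add: e_def newc_def)
  have gr: "grow a x (X (a - 1)) (X a) = Some (Y a) \<longleftrightarrow> x = e \<and> grows X Y a (X (a - 1))" for x
    using e_eq by (auto simp: grows_def e_def)
  show epos: "0 < e" if "grows X Y a (X (a - 1))"
    using that assms(2) by (cases e) (auto simp: grows_def e_def[symmetric] changed_def)
  have g1: "grow a 1 (X (a - 1)) (X a) = Some (X1 a)" if g: "grows X Y a (X (a - 1))"
  proof -
    obtain e' where "e = Suc e'" using epos[OF g] by (cases e) auto
    then have "grow a (Suc e') (X (a - 1)) (X a) = Some (Y a)" using g by (simp add: grows_def e_def)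
    from grow1_firstrow[OF this fin(1,3)] show ?thesis
      by (auto simp: X1_def firstrow_def grow_Suc_0)
  qed
  have rp: "run (replicate x a @ w @ replicate y a) X = Some Y \<longleftrightarrow> grows X Y a (X (a - 1)) \<and> x + y = e \<and>
      (if y = 0 then run w X = Some (Y(a := X a)) else run w X1 = Some (Y(a := X1 a)))"
    if "\<forall>c\<in>set w. a < c" "y \<le> 1" for x y w
  proof -
    have y: "y = 0 \<or> y = 1" using that(2) by auto
    have X1: "X(a := X1 a) = X1" by (simp add: X1_def)
    show ?thesis
    proof (cases "grows X Y a (X (a - 1))")
      case True
      then show ?thesis using y g1[OF True] unfolding run_peel[OF assms(1) that(1)] gr
        by (auto simp: X1 simp del: grow.simps(2))
    qed (use run_peel[OF assms(1) that(1)] gr[of "x + y"] in auto)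
  qed
  have rr: "run (replicate x a) X = Some Y \<longleftrightarrow> grows X Y a (X (a - 1)) \<and> x = e \<and> changed X Y = {a}" for x
  proof -
    have "changed X Y = {a} \<longleftrightarrow> X = Y(a := X a)" using assms(2) by (auto simp: changed_def fun_eq_iff)
    then show ?thesis using rp[of "[]" 0 x] by auto
  qed
  have gt: "\<forall>c\<in>set w. a < c" if "hookp (Suc a) k w" for k w using that by (auto simp: hookp_def)
  show "hook_words a X Y = (if grows X Y a (X (a - 1)) then
      (if changed X Y = {a} then {(e - 1, replicate e a)} else {}) \<union>
      (\<lambda>(k, w). (e + k, replicate e a @ w)) ` hook_words (Suc a) X (Y(a := X a)) \<union>
      (\<lambda>(k, w). (e - 1 + k, replicate (e - 1) a @ w @ [a])) ` hook_words (Suc a) X1 (Y(a := X1 a))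
    else {})" (is "_ = ?R")
  proof (intro set_eqI iffI)
    fix z assume "z \<in> hook_words a X Y"
    then obtain k w where z: "z = (k, w)" "hookp a k w" "run w X = Some Y" by (auto simp: hook_words_def)
    consider "hookp (Suc a) k w" | "w = replicate (Suc k) a"
      | x y k' w' where "hookp (Suc a) k' w'" "k = x + k'" "y \<le> 1" "0 < x + y"
       "w = replicate x a @ w' @ replicate y a" using hookp_cases[OF z(2)] by blast
    then show "z \<in> ?R"
    proof cases
      case 1
      then have "Y a = X a" using run_unchanged[OF z(3), of a] gt[OF 1] by blast
      then show ?thesis using assms(2) by (simp add: changed_def)
    next
      case 2
      then show ?thesis using z rr[of "Suc k"] by auto
    next
      case 3
      have r: "grows X Y a (X (a - 1))" "x + y = e"
        "if y = 0 then run w' X = Some (Y(a := X a)) else run w' X1 = Some (Y(a := X1 a))"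
        using z(3) rp[OF gt[OF 3(1)] 3(3), of x] 3(5) by auto
      show ?thesis
      proof (cases "y = 0")
        case True
        then have "(k', w') \<in> hook_words (Suc a) X (Y(a := X a))" using r 3 by (simp add: hook_words_def)
        then show ?thesis using r 3 z True by (auto intro!: rev_image_eqI)
      next
        case False
        then have "y = 1" using 3 by simp
        then have "(k', w') \<in> hook_words (Suc a) X1 (Y(a := X1 a))" using r 3 by (simp add: hook_words_def)
        moreover have "x = e - 1" using r \<open>y = 1\<close> by simp
        ultimately show ?thesis using r(1) 3 z \<open>y = 1\<close> by (auto intro!: rev_image_eqI)
      qed
    qed
  next
    fix z assume zR: "z \<in> ?R"
    then have g: "grows X Y a (X (a - 1))" by (auto split: if_splits)
    consider "changed X Y = {a}" "z = (e - 1, replicate e a)"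
      | k w where "z = (e + k, replicate e a @ w)" "(k, w) \<in> hook_words (Suc a) X (Y(a := X a))"
      | k w where "z = (e - 1 + k, replicate (e - 1) a @ w @ [a])" "(k, w) \<in> hook_words (Suc a) X1 (Y(a := X1 a))"
      using zR g by (auto split: if_splits)
    then show "z \<in> hook_words a X Y"
    proof cases
      case 1
      then show ?thesis using hookp_replicate[of a "e - 1"] rr[of e] g epos[OF g] by (simp add: hook_words_def)
    next
      case 2
      then show ?thesis using hookp_extend[of a k w 0 e] rp[of w 0 e] gt g by (auto simp: hook_words_def)
    next
      case 3
      then show ?thesis using hookp_extend[of a k w 1 "e - 1"] rp[of w 1 "e - 1"] gt g epos[OF g] by (auto simp: hook_words_def)
    qed
  qed
qed

text \<open>For columns beyond \<open>a\<close> neither the sign nor \<open>link\<close> reads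
  column \<open>a\<close>. So \<open>X'\<close> enters only through the growth of the least
  remaining column, whose left neighbour may be \<open>a\<close>.\<close>

lemma hooksum_peel:
  assumes "0 < a" "a \<in> changed X Y" "changed X Y \<noteq> {a}" "changed X Y \<subseteq> {a..}" "finite (changed X Y)"
    and X': "\<And>j. j \<noteq> a \<Longrightarrow> X' j = X j"
  defines "S \<equiv> changed X Y - {a}"
  shows "hooksum X' (Y(a := X' a)) = of_bool (grows X Y (Min S) (X' (Min S - 1))) *
     ((\<Prod>j\<in>S. (-1) ^ (newc X Y j - 1)) * (\<Prod>j\<in>S - {Max S}. link X Y j))"
proof -
  let ?Y = "Y(a := X' a)"
  have ch: "changed X' ?Y = S" using X' by (auto simp: changed_def S_def)
  have S: "S \<noteq> {}" "finite S" using assms(2,3,5) by (auto simp: S_def)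
  have gt: "a < j" if "j \<in> S" for j using that assms(4) by (force simp: S_def)
  have new: "newc X' ?Y j = newc X Y j" if "a < j" for j using X' that by (simp add: newc_def)
  have gr: "grows X' ?Y j B = grows X Y j B" if "a < j" for j B
    using X'[of j] that new[OF that] by (simp add: grows_def)
  have ln: "link X' ?Y j = link X Y j" if "a < j" for j
    using X'[of j] X'[of "Suc j"] that assms(1) gr[of "Suc j"] by (simp add: link_def firstrow_def)
  have "(\<Prod>j\<in>S. (-1::rat) ^ (newc X' ?Y j - 1)) = (\<Prod>j\<in>S. (-1) ^ (newc X Y j - 1))"
    using new gt by (intro prod.cong) auto
  moreover have "(\<Prod>j\<in>S - {Max S}. link X' ?Y j) = (\<Prod>j\<in>S - {Max S}. link X Y j)"
    using ln gt by (intro prod.cong) auto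
  ultimately show ?thesis
    using S gr[OF gt[OF Min_in[OF S(2,1)]]] by (simp add: hooksum_def ch Let_def)
qed

text \<open>Induction on the width \<open>d\<close> of a window of columns. If the least column
  \<open>a\<close> changes, the words split by whether \<open>a\<close> stands at the back. The two
  partial sums carry opposite signs and share all factors but the growth of the next changed column;
  the difference of those two truth values is \<open>link X Y a\<close>.\<close>

lemma sum_hook_words:
  assumes "0 < a" "state_inv X" "changed X Y \<subseteq> {a..<a + d}"
  shows "finite (hook_words a X Y) \<and> (\<Sum>(k, w)\<in>hook_words a X Y. (-1) ^ k) = hooksum X Y"
  using assms
proof (induction d arbitrary: a X Y)
  case 0
  then have "Y = X" by (auto simp: changed_def)
  then show ?case using hook_words_no_change[OF 0(2)] by (simp add: hooksum_def changed_def)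
next
  case (Suc d)
  let ?S = "changed X Y"
  have finS: "finite ?S" using Suc.prems(3) finite_subset by blast
  show ?case
  proof (cases "a \<in> ?S")
    case False
    have "?S \<subseteq> {Suc a..<Suc a + d}"
    proof
      fix j assume "j \<in> ?S"
      then show "j \<in> {Suc a..<Suc a + d}" using False Suc.prems(3) by (cases "j = a") auto
    qed
    then show ?thesis using Suc.IH[of "Suc a" X Y] hook_words_min_unchanged[OF False Suc.prems(2)] Suc.prems by simp
  next
    case True
    define e where "e = newc X Y a"
    define X1 where "X1 = X(a := insert (firstrow X Y a) (X a))"
    note HWa = hook_words_min_changed[OF Suc.prems(1) True Suc.prems(2), folded e_def X1_def]
    have sub: "?S \<subseteq> {a..}" using Suc.prems(3) by auto
    have MinS: "Min ?S = a" using True sub finS by (intro Min_eqI) auto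
    show ?thesis
    proof (cases "grows X Y a (X (a - 1))")
      case False
      then have "hook_words a X Y = {}" using HWa(1) by simp
      then show ?thesis using False True MinS by (auto simp: hooksum_def Let_def)
    next
      case g: True
      have e0: "0 < e" using HWa(2) g by simp
      have fin: "finite (X (a - 1))" "col_inv a (X a)" "finite (X a)"
        using Suc.prems(2) by (auto simp: state_inv_def col_inv_def)
      obtain e' where e': "e = Suc e'" using e0 by (cases e) auto
      then have "grow a (Suc e') (X (a - 1)) (X a) = Some (Y a)" using g by (simp add: grows_def e_def)
      from grow1_firstrow[OF this fin(1,3)] have "grow1 a (X (a - 1)) (X a) = Some (X1 a)"
        by (auto simp: X1_def firstrow_def)
      from grow1_col_inv(1)[OF this fin(2,1)] have inv1: "state_inv X1"
        using Suc.prems(2) by (auto simp: state_inv_def X1_def)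
      let ?H0 = "hook_words (Suc a) X (Y(a := X a))" and ?H1 = "hook_words (Suc a) X1 (Y(a := X1 a))"
      let ?f0 = "\<lambda>(k, w). (e + k, replicate e a @ w)"
      let ?f1 = "\<lambda>(k, w). (e - 1 + k, replicate (e - 1) a @ w @ [a])"
      show ?thesis
      proof (cases "?S = {a}")
        case S: True
        then have "Y(a := X a) = X" "Y(a := X1 a) = X1" by (auto simp: changed_def X1_def fun_eq_iff)
        then have "?H0 = {}" "?H1 = {}" using hook_words_no_change inv1 Suc.prems(2) by auto
        then have "hook_words a X Y = {(e - 1, replicate e a)}" using HWa(1) g S by simp
        then show ?thesis using S g by (simp add: hooksum_def Let_def e_def)
      next
        case S: False
        define S' where "S' = ?S - {a}"
        have S': "S' \<noteq> {}" "finite S'" using S True finS by (auto simp: S'_def)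
        have S'sub: "S' \<subseteq> {Suc a..<Suc a + d}"
        proof
          fix j assume "j \<in> S'"
          then show "j \<in> {Suc a..<Suc a + d}" using Suc.prems(3) by (cases "j = a") (auto simp: S'_def)
        qed
        have ch: "changed X (Y(a := X a)) = S'" "changed X1 (Y(a := X1 a)) = S'"
          by (auto simp: changed_def S'_def X1_def)
        define G0 where "G0 = hooksum X (Y(a := X a))"
        define G1 where "G1 = hooksum X1 (Y(a := X1 a))"
        have IH0: "finite ?H0" "(\<Sum>(k, w)\<in>?H0. (-1) ^ k) = G0"
          using Suc.IH[OF zero_less_Suc Suc.prems(2), of "Y(a := X a)" a] unfolding ch(1) G0_def using S'sub by blast+
        have IH1: "finite ?H1" "(\<Sum>(k, w)\<in>?H1. (-1) ^ k) = G1"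
          using Suc.IH[OF zero_less_Suc inv1, of "Y(a := X1 a)" a] unfolding ch(2) G1_def using S'sub by blast+
        have hook_words: "hook_words a X Y = ?f0 ` ?H0 \<union> ?f1 ` ?H1" using HWa(1) g S by simp
        have last: "w \<noteq> [] \<and> last w \<noteq> a" if "hookp (Suc a) k w" for k w
        proof -
          have "w \<noteq> []" using that by (auto simp: hookp_def)
          then have "Suc a \<le> last w" using that last_in_set[of w] unfolding hookp_def by blast
          then show ?thesis using \<open>w \<noteq> []\<close> by auto
        qed
        \<comment> \<open>The last letter separates the families: it is \<open>a\<close> only if a
          copy stands at the back.\<close>
        have disj: "?f0 ` ?H0 \<inter> ?f1 ` ?H1 = {}"
        proof -
          have "False" if "replicate e a @ w = replicate (e - 1) a @ w' @ [a]" "hookp (Suc a) k w" for k w w'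
          proof -
            have "last (replicate e a @ w) = a" unfolding that(1) by simp
            then show False using last[OF that(2)] by simp
          qed
          then show ?thesis by (auto simp: hook_words_def)
        qed
        have "(\<Sum>(k, w)\<in>hook_words a X Y. (-1::rat) ^ k) = (\<Sum>(k, w)\<in>?f0 ` ?H0. (-1) ^ k) + (\<Sum>(k, w)\<in>?f1 ` ?H1. (-1) ^ k)"
          unfolding hook_words using IH0(1) IH1(1) disj by (intro sum.union_disjoint) auto
        also have "(\<Sum>(k, w)\<in>?f0 ` ?H0. (-1::rat) ^ k) = (\<Sum>(k, w)\<in>?H0. (-1) ^ e * (-1) ^ k)"
          by (subst sum.reindex) (auto simp: inj_on_def case_prod_beta power_add)
        also have "\<dots> = (-1) ^ e * G0"
          unfolding IH0(2)[symmetric] by (simp add: sum_distrib_left case_prod_beta)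
        also have "(\<Sum>(k, w)\<in>?f1 ` ?H1. (-1::rat) ^ k) = (\<Sum>(k, w)\<in>?H1. (-1) ^ (e - 1) * (-1) ^ k)"
          by (subst sum.reindex) (auto simp: inj_on_def case_prod_beta power_add)
        also have "\<dots> = (-1) ^ (e - 1) * G1"
          unfolding IH1(2)[symmetric] by (simp add: sum_distrib_left case_prod_beta)
        \<comment> \<open>The first family has \<open>e\<close> copies before the peak and the
          second \<open>e - 1\<close>, whence the opposite signs.\<close>
        finally have sum: "(\<Sum>(k, w)\<in>hook_words a X Y. (-1::rat) ^ k) =
          (-1) ^ (e - 1) * (G1 - G0)"
          by (simp add: e' algebra_simps)
        define m where "m = Min S'"
        define T where "T = (\<Prod>j\<in>S'. (-1::rat) ^ (newc X Y j - 1)) * (\<Prod>j\<in>S' - {Max S'}. link X Y j)"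
        have h0: "G0 = of_bool (grows X Y m (X (m - 1))) * T"
          using hooksum_peel[OF Suc.prems(1) True S sub finS, of X] unfolding m_def T_def S'_def G0_def by simp
        have h1: "G1 = of_bool (grows X Y m (X1 (m - 1))) * T"
          using hooksum_peel[OF Suc.prems(1) True S sub finS, of X1] unfolding m_def T_def S'_def G1_def by (simp add: X1_def)
        have m: "m \<in> S'" "a < m" using Min_in[OF S'(2,1)] S'sub by (auto simp: m_def)
        \<comment> \<open>If the next changed column is not adjacent to \<open>a\<close>, both
          starting states look alike to it, and \<open>link X Y a\<close> is 0 because column
          \<open>Suc a\<close> does not change.\<close>
        have lk: "of_bool (grows X Y m (X1 (m - 1))) - of_bool (grows X Y m (X (m - 1))) = link X Y a"
        proof (cases "m = Suc a")
          case True
          then show ?thesis by (simp add: link_def X1_def)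
        next
          case False
          then have "Suc a \<notin> S'" using Min_le[OF S'(2), of "Suc a"] m by (auto simp: m_def)
          then have "Y (Suc a) = X (Suc a)" by (auto simp: S'_def changed_def)
          then have "link X Y a = 0" by (simp add: link_def grows_def newc_def)
          moreover have "X1 (m - 1) = X (m - 1)" using False m by (auto simp: X1_def)
          ultimately show ?thesis by simp
        qed
        have SS: "?S = insert a S'" "a \<notin> S'" using True by (auto simp: S'_def)
        have Max: "Max ?S = Max S'" 
        proof -
          have "a \<le> Max S'" using Max_ge[OF S'(2) m(1)] m(2) by linarith
          then show ?thesis unfolding SS(1) using S' by (simp add: max_def)
        qed
        have "a \<noteq> Max S'" using Max_in[OF S'(2,1)] SS(2) by auto
        then have "?S - {Max ?S} = insert a (S' - {Max S'})" unfolding Max using SS by auto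
        then have "hooksum X Y = (-1) ^ (e - 1) * link X Y a * T"
          using g S' SS MinS True unfolding hooksum_def Let_def T_def by (simp add: e_def)
        also have "\<dots> = (\<Sum>(k, w)\<in>hook_words a X Y. (-1::rat) ^ k)"
          unfolding sum h0 h1 lk[symmetric] by (simp add: algebra_simps)
        finally show ?thesis using IH0(1) IH1(1) hook_words by simp
      qed
    qed
  qed
qed

section \<open>Border strips\<close>

lemma state_inv_cols: "is_comp \<gamma> \<Longrightarrow> state_inv (cols \<gamma>)"
  unfolding state_inv_def col_inv_def
proof (intro allI conjI impI)
  fix c :: nat
  assume "is_comp \<gamma>" "c = 1"
  then have "cols \<gamma> c = {..<length \<gamma>}" using cols_one by simp
  then show "cols \<gamma> c = {..<card (cols \<gamma> c)}" by (metis card_lessThan)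
qed simp

text \<open>When \<open>x\<close> enters column \<open>Suc j\<close> it is the largest available
  row. The larger row \<open>y\<close> was in column \<open>j\<close> from the start, so it must
  have entered earlier.\<close>

lemma run_top:
  assumes "run w X = Some Y" "state_inv X" "0 < j"
    and "x \<in> Y (Suc j) - X (Suc j)" "y \<in> X j - X (Suc j)" "x < y"
  shows "y \<in> Y (Suc j)"
  using assms(1,4)
proof (induction w arbitrary: Y)
  case (Cons c w)
  then obtain Z where Z: "run w X = Some Z" "step c Z = Some Y" by (auto simp: bind_eq_Some_conv)
  have iZ: "state_inv Z" "X j \<subseteq> Z j" using run_inv[OF Z(1) assms(2), of j] by simp_all
  obtain C where C: "grow1 c (Z (c - 1)) (Z c) = Some C" "Y = Z(c := C)" using Z(2) by (auto simp: step_def)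
  show ?case
  proof (cases "x \<in> Z (Suc j)")
    case True
    then have "y \<in> Z (Suc j)" using Cons.IH[OF Z(1)] Cons.prems(2) by simp
    moreover have "Z (Suc j) \<subseteq> Y (Suc j)" using step_inv[OF Z(2) iZ(1), of "Suc j"] by simp
    ultimately show ?thesis by blast
  next
    case False
    then have c: "c = Suc j" using C(2) Cons.prems(2) by (cases "c = Suc j") auto
    then have "C = insert (Max (Z j - Z (Suc j))) (Z (Suc j))"
      using C(1) assms(3) by (auto simp: grow1_def split: if_splits)
    then have x: "C = insert x (Z (Suc j))" "x = Max (Z j - Z (Suc j))"
      using C(2) c Cons.prems(2) False by auto
    have fin: "finite (Z j)" using iZ(1) by (simp add: state_inv_def col_inv_def)
    have "y \<notin> Z j - Z (Suc j)"
    proof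
      assume "y \<in> Z j - Z (Suc j)"
      then have "y \<le> Max (Z j - Z (Suc j))" using fin by (intro Max_ge) auto
      then show False using assms(6) x(2) by simp
    qed
    then show ?thesis using assms(5) iZ(2) x C(2) c by auto
  qed
qed simp

lemma grow_one: "grow 1 e B {..<l} = Some {..<l + e}"
proof (induction e arbitrary: l)
  case (Suc e)
  have "insert l {..<l} = {..<Suc l}" by auto
  then show ?case using Suc[of "Suc l"] by (simp add: grow1_def)
qed simp

lemma convex_nat_set_iff:
  fixes S :: "nat set"
  assumes "finite S" "S \<noteq> {}"
  shows "(\<forall>a b c. a \<in> S \<longrightarrow> c \<in> S \<longrightarrow> a \<le> b \<longrightarrow> b \<le> c \<longrightarrow> b \<in> S) \<longleftrightarrow>
    (\<forall>j\<in>S - {Max S}. Suc j \<in> S)"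
proof
  assume L: "\<forall>a b c. a \<in> S \<longrightarrow> c \<in> S \<longrightarrow> a \<le> b \<longrightarrow> b \<le> c \<longrightarrow> b \<in> S"
  show "\<forall>j\<in>S - {Max S}. Suc j \<in> S"
  proof
    fix j assume j: "j \<in> S - {Max S}"
    then have "j < Max S" using Max_ge[OF assms(1), of j] by auto
    then show "Suc j \<in> S" using L[rule_format, of j "Max S" "Suc j"] j Max_in[OF assms] by auto
  qed
next
  assume R: "\<forall>j\<in>S - {Max S}. Suc j \<in> S"
  show "\<forall>a b c. a \<in> S \<longrightarrow> c \<in> S \<longrightarrow> a \<le> b \<longrightarrow> b \<le> c \<longrightarrow> b \<in> S"
  proof (intro allI impI)
    fix a b c assume *: "a \<in> S" "c \<in> S" "a \<le> b" "b \<le> c"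
    from *(3,4) show "b \<in> S"
    proof (induction b rule: dec_induct)
      case base then show ?case using * by simp
    next
      case (step b)
      then have "b < Max S" using Max_ge[OF assms(1) *(2)] by simp
      then show ?case using R step by auto
    qed
  qed
qed

section \<open>The new boxes of a composition reached by a word\<close>

locale reachable =
  fixes \<alpha> \<delta> w :: "nat list"
  assumes comp: "is_comp \<alpha>" and act: "act w \<alpha> = Some \<delta>" and nonempty: "w \<noteq> []"
begin

abbreviation X where "X \<equiv> cols \<alpha>"
abbreviation Y where "Y \<equiv> cols \<delta>"
definition D where "D j = Y j - X j"
abbreviation r where "r \<equiv> firstrow X Y"
abbreviation S where "S \<equiv> changed X Y"

lemma comp': "is_comp \<delta>" using act_is_comp[OF act comp] .

lemma run: "run w X = Some Y" using act_eq_Some_iff_run[OF comp comp'] act by simp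

lemma XY: "X j \<subseteq> Y j" using run_inv[OF run state_inv_cols[OF comp]] by blast

lemma cardD: "card (D j) = count_list w j" "newc X Y j = card (D j)"
  using run_inv[OF run state_inv_cols[OF comp], of j] by (auto simp: D_def newc_def card_Diff_subset)

lemma finD [simp]: "finite (D j)" by (simp add: D_def)

lemma D_empty_iff: "D j = {} \<longleftrightarrow> j \<notin> S" using XY by (auto simp: D_def changed_def)

lemma S_eq: "S = set w"
  using run_changed[OF run state_inv_cols[OF comp]] run_unchanged[OF run] by (auto simp: changed_def)

lemma S_fin: "finite S" "S \<noteq> {}" using S_eq nonempty by auto

lemma S_pos: "j \<in> S \<Longrightarrow> 0 < j" by (cases j) (auto simp: changed_def)

lemma nested: "0 < j \<Longrightarrow> X (Suc j) \<subseteq> X j" "0 < j \<Longrightarrow> Y (Suc j) \<subseteq> Y j"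
  by (simp_all add: cols_antimono)

lemma nested_le: "0 < i \<Longrightarrow> i \<le> j \<Longrightarrow> X j \<subseteq> X i" "0 < i \<Longrightarrow> i \<le> j \<Longrightarrow> Y j \<subseteq> Y i"
  by (simp_all add: cols_antimono)

lemma top: "0 < j \<Longrightarrow> x \<in> D (Suc j) \<Longrightarrow> y \<in> X j - X (Suc j) \<Longrightarrow> x < y \<Longrightarrow> y \<in> D (Suc j)"
  using run_top[OF run state_inv_cols[OF comp], of j x y] by (auto simp: D_def)

lemma D_one: "D 1 = {length \<alpha>..<length \<delta>}" 
  using cols_one[OF comp] cols_one[OF comp'] by (auto simp: D_def)

lemma length_le: "length \<alpha> \<le> length \<delta>"
  using XY[of 1] cols_one[OF comp] cols_one[OF comp'] by auto

lemma grows_Suc_iff: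
  assumes "0 < j" "finite B"
  shows "grows X Y (Suc j) B \<longleftrightarrow> D (Suc j) \<subseteq> B \<and> (\<forall>x\<in>D (Suc j). \<forall>y\<in>B - X (Suc j). x < y \<longrightarrow> y \<in> Y (Suc j))"
proof -
  have "card (Y (Suc j)) = card (X (Suc j)) + newc X Y (Suc j)"
    using card_mono[OF _ XY[of "Suc j"]] by (simp add: newc_def)
  then show ?thesis using grow_iff[of B "X (Suc j)" "Suc j" "newc X Y (Suc j)" "Y (Suc j)"] assms XY[of "Suc j"]
    by (simp add: grows_def D_def)
qed

lemma r_one: "r 1 = length \<alpha>" using cols_one[OF comp] by (simp add: firstrow_def)

lemma r_in: "j \<in> S \<Longrightarrow> r j \<in> D j"
proof (cases "j = 1")
  case True
  assume "j \<in> S"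
  then show ?thesis using True D_one D_empty_iff[of 1] r_one by auto
next
  case False
  assume "j \<in> S"
  then have "D j \<noteq> {}" using D_empty_iff by simp
  then show ?thesis using False Max_in[OF finD, of j] by (auto simp: firstrow_def D_def)
qed

lemma r_extreme: "x \<in> D j \<Longrightarrow> j \<noteq> 1 \<Longrightarrow> x \<le> r j" "x \<in> D 1 \<Longrightarrow> r 1 \<le> x"
  using Max_ge[OF finD, of x j] D_one r_one by (auto simp: firstrow_def D_def)

text \<open>The first factor of \<open>hooksum\<close> is 1: the left neighbour of the least changed
  column is unchanged, so the new boxes extend old rows, and by \<open>top\<close> these are the
  largest available ones. Column 1 always grows as an initial segment.\<close>

lemma grows_init: "grows X Y (Min S) (X (Min S - 1))"
proof -
  have m: "Min S \<in> S" using Min_in[OF S_fin] .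
  then have "0 < Min S" by (rule S_pos)
  show ?thesis
  proof (cases "Min S = 1")
    case True
    then show ?thesis using grow_one[of "newc X Y 1" "X 0" "length \<alpha>"] length_le
        cols_one[OF comp] cols_one[OF comp'] by (simp add: grows_def newc_def)
  next
    case False
    then obtain j where j: "Min S = Suc j" "0 < j" using \<open>0 < Min S\<close> by (cases "Min S") auto
    have "j \<notin> S" using Min_le[OF S_fin(1), of j] j by auto
    then have "X j = Y j" by (auto simp: changed_def)
    then have "D (Suc j) \<subseteq> X j" using nested[OF j(2)] by (auto simp: D_def)
    then show ?thesis unfolding j using grows_Suc_iff[OF j(2), of "X j"] top[OF j(2)] by (auto simp: D_def)
  qed
qed

text \<open>Without \<open>j\<close> in the decreasing part, the new boxes of column
  \<open>Suc j\<close> extend old rows, so no row may be new in both columns. With it, the row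
  \<open>r j\<close> is available too, but must then be used before any lower row. If
  \<open>r j\<close> is used, only the latter option can be open. If not, the latter requires in
  addition that no new row of column \<open>Suc j\<close> lies below \<open>r j\<close>, and then
  the two options cancel.\<close>

lemma link_eq:
  assumes "j \<in> S"
  shows "link X Y j = (if D (Suc j) \<noteq> {} \<and> D j \<inter> D (Suc j) \<subseteq> {r j} \<and> \<not> (\<forall>x\<in>D (Suc j). \<forall>y\<in>D j. y < x)
     then if r j \<in> D (Suc j) then 1 else -1 else 0)"
proof -
  have j: "0 < j" using S_pos assms .
  have rj: "r j \<in> D j" "r j \<notin> X j" "r j \<notin> X (Suc j)"
    using r_in[OF assms] nested[OF j] by (auto simp: D_def)
  have DD: "D (Suc j) \<subseteq> X j \<union> D j" using nested[OF j] by (auto simp: D_def)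
  have DX: "D (Suc j) \<subseteq> X j \<longleftrightarrow> D j \<inter> D (Suc j) = {}" using DD by (auto simp: D_def)
  have DX': "D (Suc j) \<subseteq> insert (r j) (X j) \<longleftrightarrow> D j \<inter> D (Suc j) \<subseteq> {r j}" using DD by (auto simp: D_def)
  have out: "grows X Y (Suc j) (X j) \<longleftrightarrow> D j \<inter> D (Suc j) = {}"
    using grows_Suc_iff[OF j, of "X j"] DX top[OF j] by (auto simp: D_def)
  have into: "grows X Y (Suc j) (insert (r j) (X j)) \<longleftrightarrow> D j \<inter> D (Suc j) \<subseteq> {r j} \<and>
      (\<forall>x\<in>D (Suc j). x < r j \<longrightarrow> r j \<in> D (Suc j))"
  proof -
    have "(\<forall>x\<in>D (Suc j). \<forall>y\<in>insert (r j) (X j) - X (Suc j). x < y \<longrightarrow> y \<in> Y (Suc j)) \<longleftrightarrow>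
      (\<forall>x\<in>D (Suc j). x < r j \<longrightarrow> r j \<in> D (Suc j))"
      using top[OF j] rj by (auto simp: D_def)
    then show ?thesis using grows_Suc_iff[OF j, of "insert (r j) (X j)"] DX' by simp
  qed
  show ?thesis
  proof (cases "r j \<in> D (Suc j)")
    case True
    then have "\<not> D j \<inter> D (Suc j) = {}" "D (Suc j) \<noteq> {}" "\<not> (\<forall>x\<in>D (Suc j). \<forall>y\<in>D j. y < x)" using rj(1) by auto
    then show ?thesis using True unfolding link_def out into by auto
  next
    case False
    have sub: "D j \<inter> D (Suc j) \<subseteq> {r j} \<longleftrightarrow> D j \<inter> D (Suc j) = {}" using False by auto
    \<comment> \<open>Comparing with \<open>r j\<close> amounts to comparing with all of
      \<open>D j\<close>. Beyond column 1, \<open>r j\<close> is the maximum; for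
      \<open>j = 1\<close> the new boxes of column 2 lie in old rows, all below
      \<open>r 1 = length \<alpha>\<close>, so both sides say that there are none.\<close>
    have "(\<forall>x\<in>D (Suc j). \<not> x < r j) \<longleftrightarrow> (\<forall>x\<in>D (Suc j). \<forall>y\<in>D j. y < x)"
      if "D j \<inter> D (Suc j) = {}"
    proof (cases "j = 1")
      case True
      have "x < r j" if "x \<in> D (Suc j)" for x
      proof -
        have "x \<in> X 1" using that \<open>D j \<inter> D (Suc j) = {}\<close> DX True by auto
        then show ?thesis using cols_one[OF comp] r_one True by simp
      qed
      then show ?thesis using rj(1) by (meson less_asym)
    next
      case jn: False
      have "r j < x" if "x \<in> D (Suc j)" "\<not> x < r j" for x
        using that False by (metis linorder_neqE_nat)
      then show ?thesis using r_extreme(1)[OF _ jn] rj(1) by (meson le_less_trans less_asym)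
    qed
    then show ?thesis using False unfolding link_def out into sub by auto
  qed
qed


section \<open>Translation into the boxes of the skew shape\<close>

lemma D_bound: "x \<in> D j \<Longrightarrow> x < length \<delta>"
  using cols_bound[of \<delta> j] by (auto simp: D_def)

text \<open>Row \<open>i\<close>, counted from 1 at the top, is row
  \<open>length \<delta> - i\<close>, counted from 0 at the bottom. The inner shape is aligned at
  the bottom, so the same renumbering serves \<alpha>.\<close>

lemma skew_iff: "(i, j) \<in> skew \<delta> \<alpha> \<longleftrightarrow> 1 \<le> i \<and> i \<le> length \<delta> \<and> length \<delta> - i \<in> D j"
proof (cases "1 \<le> i \<and> i \<le> length \<delta>")
  case True
  have d: "(i, j) \<in> diag \<delta> \<longleftrightarrow> length \<delta> - i \<in> Y j"
  proof -
    have "length \<delta> - Suc (length \<delta> - i) = i - 1" using True by simp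
    then show ?thesis using True unfolding in_cols_iff by (auto simp: diag_def)
  qed
  have "(i, j) \<in> inner_shape \<delta> \<alpha> \<longleftrightarrow> length \<delta> - i \<in> X j" (is "?L \<longleftrightarrow> ?R")
  proof
    assume ?L
    then obtain i' where i': "i = length \<delta> - length \<alpha> + i'" "1 \<le> i'" "i' \<le> length \<alpha>" "1 \<le> j" "j \<le> \<alpha> ! (i' - 1)"
      by (auto simp: inner_shape_def)
    have "length \<delta> - i = length \<alpha> - i'" "length \<alpha> - Suc (length \<alpha> - i') = i' - 1"
      using i' length_le by auto
    then show ?R using i' unfolding in_cols_iff by simp
  next
    assume R: ?R
    define i' where "i' = length \<alpha> - (length \<delta> - i)"
    have "length \<delta> - i < length \<alpha>" "1 \<le> j" "j \<le> \<alpha> ! (length \<alpha> - Suc (length \<delta> - i))"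
      using R unfolding in_cols_iff by auto
    moreover have "length \<alpha> - Suc (length \<delta> - i) = i' - 1" by (simp add: i'_def)
    ultimately have "i = length \<delta> - length \<alpha> + i'" "1 \<le> i'" "i' \<le> length \<alpha>" "1 \<le> j" "j \<le> \<alpha> ! (i' - 1)"
      using length_le True by (auto simp: i'_def)
    then show ?L by (auto simp: inner_shape_def)
  qed
  then show ?thesis using d True by (simp add: skew_def D_def)
qed (auto simp: skew_def diag_def)

lemma skew_eq: "skew \<delta> \<alpha> = (\<lambda>(j, x). (length \<delta> - x, j)) ` (SIGMA j:S. D j)"
proof (intro set_eqI iffI)
  fix z assume z: "z \<in> skew \<delta> \<alpha>"
  obtain i j where ij: "z = (i, j)" by (cases z)
  then have "1 \<le> i" "i \<le> length \<delta>" "length \<delta> - i \<in> D j" using z skew_iff by auto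
  then show "z \<in> (\<lambda>(j, x). (length \<delta> - x, j)) ` (SIGMA j:S. D j)"
    using ij D_empty_iff by (intro image_eqI[of _ _ "(j, length \<delta> - i)"]) auto
next
  fix z assume "z \<in> (\<lambda>(j, x). (length \<delta> - x, j)) ` (SIGMA j:S. D j)"
  then obtain j x where "z = (length \<delta> - x, j)" "x \<in> D j" by auto
  then show "z \<in> skew \<delta> \<alpha>" using skew_iff D_bound[of x j] by (auto simp: Suc_le_eq)
qed

lemma all_skew: "(\<forall>i. (i, j) \<in> skew \<delta> \<alpha> \<longrightarrow> P i) \<longleftrightarrow> (\<forall>x\<in>D j. P (length \<delta> - x))"
proof
  assume L: "\<forall>i. (i, j) \<in> skew \<delta> \<alpha> \<longrightarrow> P i"
  show "\<forall>x\<in>D j. P (length \<delta> - x)"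
  proof
    fix x assume "x \<in> D j"
    then have "(length \<delta> - x, j) \<in> skew \<delta> \<alpha>" using D_bound[of x j] by (simp add: skew_iff Suc_le_eq)
    then show "P (length \<delta> - x)" using L by blast
  qed
next
  assume R: "\<forall>x\<in>D j. P (length \<delta> - x)"
  show "\<forall>i. (i, j) \<in> skew \<delta> \<alpha> \<longrightarrow> P i"
  proof (intro allI impI)
    fix i assume "(i, j) \<in> skew \<delta> \<alpha>"
    then have "i = length \<delta> - (length \<delta> - i)" "length \<delta> - i \<in> D j" by (auto simp: skew_iff)
    then show "P i" using R by metis
  qed
qed

lemma in_skew: "x \<in> D j \<Longrightarrow> (length \<delta> - x, k) \<in> skew \<delta> \<alpha> \<longleftrightarrow> x \<in> D k"
  using D_bound[of x j] by (auto simp: skew_iff Suc_le_eq)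

lemma supp_eq: "supp \<delta> \<alpha> = S"
  unfolding supp_def skew_eq using D_empty_iff by (force simp: image_iff)

lemma NE_iff: "j \<in> NE \<delta> \<alpha> \<longleftrightarrow> j \<in> S \<and> D (Suc j) \<noteq> {} \<and> (\<forall>x\<in>D (Suc j). \<forall>y\<in>D j. y < x)"
proof -
  have "(\<exists>i. (i, j + 1) \<in> skew \<delta> \<alpha>) \<longleftrightarrow> D (Suc j) \<noteq> {}"
    using all_skew[of "j + 1" "\<lambda>_. False"] by auto
  moreover have "(\<forall>i1 i2. (i1, j + 1) \<in> skew \<delta> \<alpha> \<longrightarrow> (i2, j) \<in> skew \<delta> \<alpha> \<longrightarrow> i1 < i2) \<longleftrightarrow>
      (\<forall>i1. (i1, j + 1) \<in> skew \<delta> \<alpha> \<longrightarrow> (\<forall>i2. (i2, j) \<in> skew \<delta> \<alpha> \<longrightarrow> i1 < i2))" by blast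
  moreover have "\<dots> \<longleftrightarrow> (\<forall>x\<in>D (Suc j). \<forall>y\<in>D j. y < x)"
  proof -
    have "length \<delta> - x < length \<delta> - y \<longleftrightarrow> y < x" if "x \<in> D (Suc j)" for x y
      using D_bound[OF that] by auto
    then show ?thesis unfolding all_skew by auto
  qed
  ultimately show ?thesis unfolding NE_def supp_eq by simp
qed

text \<open>Renumbering turns bottommost into least and topmost into greatest. In either case the
  distinguished row is \<open>r j\<close>, which unifies the conditions on column 1 and on the later
  columns.\<close>

lemma nc_border_strip_iff:
  "nc_border_strip \<delta> \<alpha> \<longleftrightarrow> (\<forall>j\<in>S - {Max S}. Suc j \<in> S) \<and> (\<forall>j>0. D j \<inter> D (Suc j) \<subseteq> {r j})"
proof -
  have 1: "(\<forall>i. (i, 1) \<in> skew \<delta> \<alpha> \<longrightarrow> (i, 2) \<in> skew \<delta> \<alpha> \<longrightarrow>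
          (\<forall>i'. (i', 1) \<in> skew \<delta> \<alpha> \<longrightarrow> i' \<le> i)) \<longleftrightarrow> D 1 \<inter> D 2 \<subseteq> {r 1}" (is "?L \<longleftrightarrow> _")
  proof -
    have "?L \<longleftrightarrow> (\<forall>x\<in>D 1. x \<in> D 2 \<longrightarrow> (\<forall>x'\<in>D 1. length \<delta> - x' \<le> length \<delta> - x))"
      unfolding all_skew using in_skew[of _ 1 2] by auto
    also have "\<dots> \<longleftrightarrow> (\<forall>x\<in>D 1. x \<in> D 2 \<longrightarrow> (\<forall>x'\<in>D 1. x \<le> x'))"
      using D_bound by (metis diff_le_mono2 diff_less_mono2 linorder_not_less)
    also have "\<dots> \<longleftrightarrow> (\<forall>x\<in>D 1. x \<in> D 2 \<longrightarrow> x = r 1)"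
      using r_in[of 1] r_extreme(2) D_empty_iff[of 1] by (metis antisym empty_iff)
    finally show ?thesis by auto
  qed
  have 2: "(\<forall>i. (i, j) \<in> skew \<delta> \<alpha> \<longrightarrow> (i, j + 1) \<in> skew \<delta> \<alpha> \<longrightarrow>
          (\<forall>i'. (i', j) \<in> skew \<delta> \<alpha> \<longrightarrow> i \<le> i')) \<longleftrightarrow> D j \<inter> D (Suc j) \<subseteq> {r j}" (is "?L \<longleftrightarrow> _")
    if "2 \<le> j" for j
  proof -
    have j1: "j \<noteq> 1" using that by simp
    have "?L \<longleftrightarrow> (\<forall>x\<in>D j. x \<in> D (Suc j) \<longrightarrow> (\<forall>x'\<in>D j. length \<delta> - x \<le> length \<delta> - x'))"
      unfolding all_skew using in_skew[of _ j "j + 1"] by auto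
    also have "\<dots> \<longleftrightarrow> (\<forall>x\<in>D j. x \<in> D (Suc j) \<longrightarrow> (\<forall>x'\<in>D j. x' \<le> x))"
      using D_bound by (metis diff_le_mono2 diff_less_mono2 linorder_not_less)
    also have "\<dots> \<longleftrightarrow> (\<forall>x\<in>D j. x \<in> D (Suc j) \<longrightarrow> x = r j)"
      using r_in[of j] r_extreme(1)[OF _ j1] D_empty_iff[of j] by (metis antisym empty_iff)
    finally show ?thesis by auto
  qed
  have "(\<forall>j>0. D j \<inter> D (Suc j) \<subseteq> {r j}) \<longleftrightarrow> D 1 \<inter> D 2 \<subseteq> {r 1} \<and> (\<forall>j\<ge>2. D j \<inter> D (Suc j) \<subseteq> {r j})"
    (is "?A \<longleftrightarrow> ?B")
  proof
    assume ?B
    show ?A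
    proof (intro allI impI)
      fix j :: nat assume "0 < j"
      then show "D j \<inter> D (Suc j) \<subseteq> {r j}" using \<open>?B\<close> by (cases "j = 1") (auto simp: numeral_2_eq_2)
    qed
  next
    assume A: ?A
    then show ?B using A[rule_format, of 1] by (simp add: numeral_2_eq_2)
  qed
  moreover have "(\<forall>i j. 2 \<le> j \<longrightarrow> (i, j) \<in> skew \<delta> \<alpha> \<longrightarrow> (i, j + 1) \<in> skew \<delta> \<alpha> \<longrightarrow>
          (\<forall>i'. (i', j) \<in> skew \<delta> \<alpha> \<longrightarrow> i \<le> i')) \<longleftrightarrow> (\<forall>j\<ge>2. D j \<inter> D (Suc j) \<subseteq> {r j})" (is "?L \<longleftrightarrow> _")
  proof -
    have "?L \<longleftrightarrow> (\<forall>j\<ge>2. \<forall>i. (i, j) \<in> skew \<delta> \<alpha> \<longrightarrow> (i, j + 1) \<in> skew \<delta> \<alpha> \<longrightarrow>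
          (\<forall>i'. (i', j) \<in> skew \<delta> \<alpha> \<longrightarrow> i \<le> i'))" by blast
    then show ?thesis using 2 by simp
  qed
  ultimately show ?thesis
    unfolding nc_border_strip_def interval_shape_def supp_eq convex_nat_set_iff[OF S_fin] 1
    by argo
qed

text \<open>Each row is counted at its last new box.\<close>

lemma rows_eq: "card (fst ` skew \<delta> \<alpha>) = (\<Sum>j\<in>S. card (D j - D (Suc j)))"
proof -
  have "fst ` skew \<delta> \<alpha> = (\<lambda>x. length \<delta> - x) ` (\<Union>j\<in>S. D j)"
    unfolding skew_eq by force
  moreover have "inj_on (\<lambda>x. length \<delta> - x) (\<Union>j\<in>S. D j)"
    using D_bound by (intro inj_onI) (auto, metis D_bound diff_less_mono2 linorder_neqE_nat less_irrefl)
  ultimately have "card (fst ` skew \<delta> \<alpha>) = card (\<Union>j\<in>S. D j)" by (simp add: card_image)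
  also have "(\<Union>j\<in>S. D j) = (\<Union>j\<in>S. D j - D (Suc j))"
  proof (intro equalityI subsetI)
    fix x assume "x \<in> (\<Union>j\<in>S. D j)"
    then obtain j where j: "j \<in> S" "x \<in> D j" by blast
    let ?T = "{j \<in> S. x \<in> D j}"
    have T: "finite ?T" "?T \<noteq> {}" using S_fin j by auto
    have "Max ?T \<in> ?T" by (rule Max_in[OF T])
    moreover have "Suc (Max ?T) \<notin> ?T" using Max_ge[OF T(1), of "Suc (Max ?T)"] by auto
    ultimately show "x \<in> (\<Union>j\<in>S. D j - D (Suc j))" using D_empty_iff by blast
  qed auto
  also have "card \<dots> = (\<Sum>j\<in>S. card (D j - D (Suc j)))"
  proof (rule card_UN_disjoint)
    \<comment> \<open>Nestedness of the columns makes the new boxes of a row contiguous, so a row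
      has only one last new box.\<close>
    have "False" if "i \<in> S" "i < j" "x \<in> D i - D (Suc i)" "x \<in> D j" for i j x
    proof -
      have i: "0 < i" using S_pos that(1) .
      have "x \<in> Y (Suc i)" using nested_le(2)[of "Suc i" j] that by (auto simp: D_def)
      moreover have "x \<notin> X (Suc i)" using nested(1)[OF i] that(3) by (auto simp: D_def)
      ultimately show False using that(3) by (auto simp: D_def)
    qed
    then show "\<forall>i\<in>S. \<forall>j\<in>S. i \<noteq> j \<longrightarrow> (D i - D (Suc i)) \<inter> (D j - D (Suc j)) = {}"
      by (meson DiffD1 disjoint_iff linorder_neqE_nat)
  qed (use S_fin in auto)
  finally show ?thesis .
qed

lemma card_skew: "card (skew \<delta> \<alpha>) = length w"
proof -
  have "inj_on (\<lambda>(j, x). (length \<delta> - x, j)) (SIGMA j:S. D j)"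
    by (rule inj_onI, clarsimp) (metis D_bound diff_less_mono2 linorder_neqE_nat less_irrefl)
  then have "card (skew \<delta> \<alpha>) = card (SIGMA j:S. D j)" unfolding skew_eq by (rule card_image)
  also have "\<dots> = (\<Sum>j\<in>S. card (D j))" using S_fin by (simp add: card_SigmaI)
  also have "\<dots> = sum (count_list w) S" using cardD by simp
  also have "\<dots> = length w" using S_eq by (intro sum_count_set) auto
  finally show ?thesis .
qed

text \<open>The product is nonzero iff every \<open>link\<close> is, which amounts to the border
  strip condition together with an empty NE. In the exponent, a column counts the rows that end in
  it; the largest column counts one less, which is the one subtracted in the height.\<close>

lemma hooksum_eq:
  "hooksum X Y = (if nc_border_strip \<delta> \<alpha> \<and> NE \<delta> \<alpha> = {} then (-1) ^ ht \<delta> \<alpha> else 0)"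
proof -
  let ?C = "\<lambda>j. D (Suc j) \<noteq> {} \<and> D j \<inter> D (Suc j) \<subseteq> {r j} \<and> \<not> (\<forall>x\<in>D (Suc j). \<forall>y\<in>D j. y < x)"
  let ?M = "Max S"
  have M: "?M \<in> S" "D (Suc ?M) = {}"
    using Max_in[OF S_fin] Max_ge[OF S_fin(1), of "Suc ?M"] D_empty_iff[of "Suc ?M"] by auto
  have cond: "(\<forall>j\<in>S - {?M}. ?C j) \<longleftrightarrow> nc_border_strip \<delta> \<alpha> \<and> NE \<delta> \<alpha> = {}" (is "?A \<longleftrightarrow> ?B")
  proof
    assume A: ?A
    have "D j \<inter> D (Suc j) \<subseteq> {r j}" for j
    proof (cases "j \<in> S - {?M}")
      case False
      then have "D j = {} \<or> D (Suc j) = {}" using M(2) D_empty_iff by auto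
      then show ?thesis by auto
    qed (use A in blast)
    moreover have "\<forall>j\<in>S - {?M}. Suc j \<in> S" using A D_empty_iff by blast
    moreover have "j \<notin> NE \<delta> \<alpha>" for j using A M(2) unfolding NE_iff by blast
    ultimately show ?B unfolding nc_border_strip_iff by blast
  next
    assume B: ?B
    show ?A
    proof
      fix j assume j: "j \<in> S - {?M}"
      have "D (Suc j) \<noteq> {}" "D j \<inter> D (Suc j) \<subseteq> {r j}"
        using B j S_pos[of j] D_empty_iff[of "Suc j"] unfolding nc_border_strip_iff by auto
      moreover have "j \<notin> NE \<delta> \<alpha>" using B by simp
      ultimately show "?C j" using NE_iff[of j] j by simp
    qed
  qed
  have hs: "hooksum X Y = (\<Prod>j\<in>S. (-1) ^ (card (D j) - 1)) * (\<Prod>j\<in>S - {?M}. link X Y j)"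
    using grows_init S_fin(2) cardD by (simp add: hooksum_def Let_def)
  show ?thesis
  proof (cases "\<forall>j\<in>S - {?M}. ?C j")
    case False
    then obtain j where j: "j \<in> S - {?M}" "\<not> ?C j" by blast
    then have "link X Y j = 0" using link_eq[of j] by auto
    then have "(\<Prod>j\<in>S - {?M}. link X Y j) = 0" using S_fin j by (intro prod_zero) auto
    moreover have "\<not> (nc_border_strip \<delta> \<alpha> \<and> NE \<delta> \<alpha> = {})" using False cond by blast
    ultimately show ?thesis using hs by simp
  next
    case True
    \<comment> \<open>A link of 1 means that exactly one new row continues into the next column. A
      link of -1 means that none does, and its sign restores the exponent
      \<open>card (D j)\<close>.\<close>
    have fac: "(-1) ^ (card (D j) - 1) * link X Y j = (-1) ^ card (D j - D (Suc j))" if "j \<in> S - {?M}" for j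
    proof -
      have C: "?C j" using True that by blast
      have pos: "card (D j) > 0" using that D_empty_iff[of j] by (simp add: card_gt_0_iff)
      show ?thesis
      proof (cases "r j \<in> D (Suc j)")
        case in1: True
        then have "D j - D (Suc j) = D j - {r j}" using C by auto
        then have "card (D j - D (Suc j)) = card (D j) - 1" using r_in that by simp
        moreover have "link X Y j = 1" using link_eq[of j] that C in1 by auto
        ultimately show ?thesis by simp
      next
        case out: False
        then have "D j - D (Suc j) = D j" using C by auto
        moreover have "link X Y j = -1" using link_eq[of j] that C out by auto
        ultimately show ?thesis using pos by (cases "card (D j)") auto
      qed
    qed
    have posM: "card (D ?M) > 0" using M D_empty_iff[of ?M] by (simp add: card_gt_0_iff)
    have "hooksum X Y = (-1) ^ (card (D ?M) - 1) * (\<Prod>j\<in>S - {?M}. (-1) ^ (card (D j) - 1) * link X Y j)"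
      unfolding hs prod.distrib using prod.remove[OF S_fin(1) M(1), of "\<lambda>j. (-1::rat) ^ (card (D j) - 1)"] by simp
    also have "\<dots> = (-1) ^ (card (D ?M) - 1) * (\<Prod>j\<in>S - {?M}. (-1) ^ card (D j - D (Suc j)))"
      using fac by (intro arg_cong[of _ _ "(*) _"] prod.cong) auto
    also have "\<dots> = (-1) ^ (card (D ?M) - 1 + (\<Sum>j\<in>S - {?M}. card (D j - D (Suc j))))"
      by (simp add: power_add power_sum)
    also have "card (D ?M) - 1 + (\<Sum>j\<in>S - {?M}. card (D j - D (Suc j))) = ht \<delta> \<alpha>"
      unfolding ht_def rows_eq using sum.remove[OF S_fin(1) M(1), of "\<lambda>j. card (D j - D (Suc j))"] M(2) posM by simp
    finally have "hooksum X Y = (-1) ^ ht \<delta> \<alpha>" .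
    moreover have "nc_border_strip \<delta> \<alpha> \<and> NE \<delta> \<alpha> = {}" using True cond by blast
    ultimately show ?thesis by simp
  qed
qed

end

section \<open>Ribbons and words\<close>

lemma bump_le_sum: "bump v \<gamma> = Some \<delta> \<Longrightarrow> Suc v \<le> sum_list \<delta>"
  by (induction \<gamma> arbitrary: \<delta>) (auto split: if_splits intro: trans_le_add2)

lemma add_box_le_sum: "add_box c \<gamma> = Some \<delta> \<Longrightarrow> c \<le> sum_list \<delta>"
  using bump_le_sum[of "c - 1" \<gamma> \<delta>] by (auto simp: add_box_def split: if_splits)

lemma act_letters_le: "act w \<gamma> = Some \<delta> \<Longrightarrow> set w \<subseteq> {..sum_list \<delta>}"
proof (induction w arbitrary: \<delta>)
  case (Cons c w)
  then obtain \<epsilon> where "act w \<gamma> = Some \<epsilon>" "add_box c \<epsilon> = Some \<delta>" by (auto simp: bind_eq_Some_conv)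
  then show ?case using Cons.IH[of \<epsilon>] add_box_le_sum[of c \<epsilon> \<delta>] add_box_sum[of c \<epsilon> \<delta>] by fastforce
qed simp

lemma finite_act_words: "finite {w. act w \<gamma> = Some \<delta>}"
proof (rule finite_subset)
  show "{w. act w \<gamma> = Some \<delta>} \<subseteq> {w. set w \<subseteq> {..sum_list \<delta>} \<and> length w \<le> sum_list \<delta>}"
  proof
    fix w assume "w \<in> {w. act w \<gamma> = Some \<delta>}"
    then show "w \<in> {w. set w \<subseteq> {..sum_list \<delta>} \<and> length w \<le> sum_list \<delta>}"
      using act_letters_le[of w \<gamma> \<delta>] act_sum[of w \<gamma> \<delta>] by simp
  qed
  show "finite {w. set w \<subseteq> {..sum_list \<delta>} \<and> length w \<le> sum_list \<delta>}"
    by (rule finite_lists_length_le) simp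
qed

section \<open>Words with a given descent composition\<close>

definition desc_words :: "nat list \<Rightarrow> nat list \<Rightarrow> nat list \<Rightarrow> nat list set" where
  "desc_words \<beta> \<gamma> \<delta> = {w. dcomp w = \<beta> \<and> act w \<gamma> = Some \<delta>}"

lemma finite_desc_words [simp]: "finite (desc_words \<beta> \<gamma> \<delta>)"
  by (rule finite_subset[OF _ finite_act_words[of \<gamma> \<delta>]]) (auto simp: desc_words_def)

lemma run_pos: "run w X = Some Y \<Longrightarrow> c \<in> set w \<Longrightarrow> 1 \<le> c"
proof (induction w arbitrary: Y)
  case (Cons a w)
  then obtain Z where "run w X = Some Z" "step a Z = Some Y" by (auto simp: bind_eq_Some_conv)
  moreover have "a \<noteq> 0"
  proof
    assume "a = 0"
    then show False using \<open>step a Z = Some Y\<close> by (simp add: step_def grow1_def)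
  qed
  ultimately show ?case using Cons by auto
qed simp

text \<open>The coefficient of \<delta> in \<Psi> applied to \<alpha>. All words from \<alpha> to
  \<delta> have the same length, so either this length is \<open>n\<close> and
  \<open>hooksum\<close> applies, or both sides are 0.\<close>

lemma hook_coefficient:
  assumes "is_comp \<alpha>" "is_comp \<delta>" "0 < n"
  shows "(\<Sum>k<n. (-1) ^ k * of_nat (card (desc_words (replicate k 1 @ [n - k]) \<alpha> \<delta>))) =
    (if \<delta> \<in> P_set \<alpha> n then (-1) ^ ht \<delta> \<alpha> else 0 :: rat)"
proof (cases "\<exists>w. length w = n \<and> act w \<alpha> = Some \<delta>")
  case False
  have "desc_words (replicate k 1 @ [n - k]) \<alpha> \<delta> = {}" if "k < n" for k
  proof -
    have "length w = n" if "dcomp w = replicate k 1 @ [n - k]" for w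
      using sum_dcomp[of w] that \<open>k < n\<close> by (simp add: sum_list_replicate)
    then show ?thesis using False by (auto simp: desc_words_def)
  qed
  moreover have "\<delta> \<notin> P_set \<alpha> n"
  proof
    assume P: "\<delta> \<in> P_set \<alpha> n"
    then obtain w where w: "w \<noteq> []" "act w \<alpha> = Some \<delta>" using less_c_iff_act[OF assms(1)] by (auto simp: P_set_def)
    then interpret reachable \<alpha> \<delta> w using assms by unfold_locales
    show False using card_skew P False w by (auto simp: P_set_def)
  qed
  ultimately show ?thesis by simp
next
  case True
  then obtain w where w: "length w = n" "act w \<alpha> = Some \<delta>" by blast
  then interpret reachable \<alpha> \<delta> w using assms by unfold_locales auto
  have len: "length v = n" if "act v \<alpha> = Some \<delta>" for v using act_sum[OF that] act_sum[OF w(2)] w(1) by simp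
  \<comment> \<open>The bound 1 on the letters holds for every word that acts, since no box can be
    added in column 0.\<close>
  have hook_words: "hook_words 1 X Y = (SIGMA k:{..<n}. desc_words (replicate k 1 @ [n - k]) \<alpha> \<delta>)"
  proof -
    have "hookp 1 k v \<and> run v X = Some Y \<longleftrightarrow> k < n \<and> dcomp v = replicate k 1 @ [n - k] \<and> act v \<alpha> = Some \<delta>" for k v
    proof (cases "act v \<alpha> = Some \<delta>")
      case True
      then have "run v X = Some Y" using act_eq_Some_iff_run assms by simp
      then show ?thesis using True len[OF True] dcomp_hook_iff[of k v] run_pos[of v X Y] by (auto simp: hookp_def)
    next
      case False
      then show ?thesis using act_eq_Some_iff_run assms by simp
    qed
    then show ?thesis by (auto simp: hook_words_def desc_words_def)
  qed
  have "(\<Sum>k<n. (-1) ^ k * of_nat (card (desc_words (replicate k 1 @ [n - k]) \<alpha> \<delta>))) =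
     (\<Sum>k<n. \<Sum>v\<in>desc_words (replicate k 1 @ [n - k]) \<alpha> \<delta>. (-1::rat) ^ k)" by (simp add: mult.commute)
  also have "\<dots> = (\<Sum>(k, v)\<in>hook_words 1 X Y. (-1) ^ k)" unfolding hook_words by (subst sum.Sigma) auto
  also have "\<dots> = hooksum X Y"
  proof -
    have "changed X Y \<subseteq> {1..<1 + Suc (Max S)}"
    proof
      fix j assume "j \<in> S"
      then show "j \<in> {1..<1 + Suc (Max S)}" using S_pos[of j] Max_ge[OF S_fin(1), of j] by simp
    qed
    then show ?thesis using sum_hook_words[of 1 X Y "Suc (Max S)"] state_inv_cols[OF assms(1)] by simp
  qed
  also have "\<dots> = (if \<delta> \<in> P_set \<alpha> n then (-1) ^ ht \<delta> \<alpha> else 0)"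
  proof -
    have "less_c \<alpha> \<delta>" using less_c_iff_act[OF assms(1)] w nonempty by blast
    then show ?thesis unfolding hooksum_eq using card_skew w(1) by (simp add: P_set_def)
  qed
  finally show ?thesis .
qed

lemma dcomp_append:
  "sorted_wrt (>) u \<Longrightarrow> u \<noteq> [] \<Longrightarrow> v \<noteq> [] \<Longrightarrow>
   dcomp (u @ v) = (if last u \<le> hd v then length u # dcomp v else (length u + hd (dcomp v)) # tl (dcomp v))"
proof (induction u rule: dcomp.induct)
  case (2 x)
  then obtain y v' where "v = y # v'" by (cases v) auto
  moreover obtain c cs where "dcomp v = c # cs" using 2 by (cases "dcomp v") auto
  ultimately show ?case by auto
next
  case (3 x y w)
  then show ?case by auto
qed simp

lemma dcomp_first: "dcomp w = g # \<gamma> \<Longrightarrow> sorted_wrt (>) (take g w)"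
proof (induction w arbitrary: g \<gamma> rule: dcomp.induct)
  case (3 x y w)
  show ?case
  proof (cases "x \<le> y")
    case True
    then show ?thesis using 3 by auto
  next
    case False
    obtain c cs where c: "dcomp (y # w) = c # cs" by (cases "dcomp (y # w)") auto
    then have g: "g = Suc c" using 3 False by simp
    have c0: "0 < c" using is_comp_dcomp[of "y # w"] c by (auto simp: is_comp_def)
    have "sorted_wrt (>) (take c (y # w))" using "3.IH"(2)[OF False c] .
    then obtain c' where "c = Suc c'" using c0 by (cases c) auto
    then show ?thesis using \<open>sorted_wrt (>) (take c (y # w))\<close> False g by (auto dest: less_trans)
  qed
qed auto

text \<open>Word counterpart of the product rule by which h_b times r_(c,\<beta>) is r_(b,c,\<beta>)
  plus r_(b+c,\<beta>): where the decreasing block meets the rest there is either a descent or a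
  merging of two runs.\<close>

lemma dcomp_Cons_Cons:
  assumes "0 < b" "0 < c"
  shows "dcomp w = b # c # \<beta> \<or> dcomp w = (b + c) # \<beta> \<longleftrightarrow>
    (\<exists>u v. w = u @ v \<and> length u = b \<and> sorted_wrt (>) u \<and> dcomp v = c # \<beta>)" (is "?L \<longleftrightarrow> ?R")
proof
  assume ?R
  then obtain u v where uv: "w = u @ v" "length u = b" "sorted_wrt (>) u" "dcomp v = c # \<beta>" by blast
  then have "u \<noteq> []" "v \<noteq> []" using assms by auto
  then show ?L using dcomp_append[OF uv(3)] uv by auto
next
  assume L: ?L
  define u where "u = take b w"
  define v where "v = drop b w"
  have len: "length w > b" using L assms sum_dcomp[of w] by auto
  have uv: "w = u @ v" "length u = b" "u \<noteq> []" "v \<noteq> []" using len assms by (auto simp: u_def v_def)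
  have "sorted_wrt (>) u"
  proof -
    \<comment> \<open>In both cases the first run has length at least \<open>b\<close>, so its
      prefix \<open>u\<close> is decreasing.\<close>
    obtain g \<gamma> where g: "dcomp w = g # \<gamma>" "b \<le> g" using L by auto
    have "u = take b (take g w)" using g(2) by (simp add: u_def min_def)
    then show ?thesis using dcomp_first[OF g(1)] by (metis sorted_wrt_take)
  qed
  moreover obtain c' \<beta>' where v: "dcomp v = c' # \<beta>'" using uv by (cases "dcomp v") auto
  moreover have "0 < c'" using is_comp_dcomp[of v] v by (auto simp: is_comp_def)
  ultimately show ?R using dcomp_append[of u v] uv L assms
    by (intro exI[of _ u] exI[of _ v]) (auto split: if_splits)
qed

text \<open>The words in the action of h_\<gamma>. Adjacent blocks may join into a longer decreasing
  run.\<close>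

fun dec_blocks :: "nat list \<Rightarrow> nat list \<Rightarrow> bool" where
  "dec_blocks [] w \<longleftrightarrow> w = []"
| "dec_blocks (g # \<gamma>) w \<longleftrightarrow> (\<exists>u v. w = u @ v \<and> length u = g \<and> sorted_wrt (>) u \<and> dec_blocks \<gamma> v)"

lemma dec_blocks_length: "dec_blocks \<gamma> w \<Longrightarrow> length w = sum_list \<gamma>"
  by (induction \<gamma> arbitrary: w) auto

lemma dec_blocks_append:
  "dec_blocks (\<gamma> @ \<gamma>') w \<longleftrightarrow> (\<exists>u v. w = u @ v \<and> dec_blocks \<gamma> u \<and> dec_blocks \<gamma>' v)"
proof (induction \<gamma> arbitrary: w)
  case (Cons g \<gamma>)
  show ?case
    by (simp add: Cons) (metis append.assoc)
qed simp

lemma finite_comps_of [simp]: "finite (comps_of N)"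
proof (rule finite_subset)
  show "comps_of N \<subseteq> {xs. set xs \<subseteq> {..N} \<and> length xs \<le> N}"
  proof
    fix xs assume xs: "xs \<in> comps_of N"
    have "length ys \<le> sum_list ys" if "is_comp ys" for ys
      using that by (induction ys) (auto simp: is_comp_def)
    then show "xs \<in> {xs. set xs \<subseteq> {..N} \<and> length xs \<le> N}"
      using xs member_le_sum_list[of _ xs] by (auto simp: comps_of_def)
  qed
  show "finite {xs. set xs \<subseteq> {..N} \<and> length xs \<le> N}" by (rule finite_lists_length_le) simp
qed

section \<open>Coarsenings and the ribbon recursion\<close>

lemma coarsens_Nil: "coarsens \<gamma> [] \<longleftrightarrow> \<gamma> = []"
  unfolding coarsens_def by auto

lemma coarsens_single: "coarsens \<gamma> [b] \<longleftrightarrow> \<gamma> = [b]"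
proof
  assume "coarsens \<gamma> [b]"
  then obtain Bs where Bs: "concat Bs = [b]" "\<forall>B\<in>set Bs. B \<noteq> []" "\<gamma> = map sum_list Bs" by (auto simp: coarsens_def)
  then obtain B Bs' where B: "Bs = B # Bs'" by (cases Bs) auto
  then have "B = [b]" "concat Bs' = []" using Bs by (auto simp: append_eq_Cons_conv)
  then have "Bs' = []" using Bs(2) B by (cases Bs') auto
  then show "\<gamma> = [b]" using Bs B \<open>B = [b]\<close> by simp
next
  assume "\<gamma> = [b]"
  then show "coarsens \<gamma> [b]" unfolding coarsens_def by (intro exI[of _ "[[b]]"]) auto
qed

lemma coarsens_Cons_Cons:
  "coarsens \<gamma> (b # c # \<beta>) \<longleftrightarrow> (\<exists>\<gamma>'. \<gamma> = b # \<gamma>' \<and> coarsens \<gamma>' (c # \<beta>)) \<or> coarsens \<gamma> ((b + c) # \<beta>)"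
  (is "?L \<longleftrightarrow> ?R1 \<or> ?R2")
proof (intro iffI, goal_cases)
  case 1
  then obtain Bs where Bs: "concat Bs = b # c # \<beta>" "\<forall>B\<in>set Bs. B \<noteq> []" "\<gamma> = map sum_list Bs" by (auto simp: coarsens_def)
  then obtain B Bs' where B: "Bs = B # Bs'" by (cases Bs) auto
  then obtain B' where B': "B = b # B'" using Bs by (cases B) auto
  show ?case
  proof (cases B')
    case Nil
    then have "coarsens (map sum_list Bs') (c # \<beta>)" unfolding coarsens_def
      using Bs B B' by (intro exI[of _ Bs']) auto
    then show ?thesis using Bs B B' Nil by auto
  next
    case (Cons x B'')
    then have "coarsens \<gamma> ((b + c) # \<beta>)" unfolding coarsens_def
      using Bs B B' by (intro exI[of _ "((b + c) # B'') # Bs'"]) auto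
    then show ?thesis ..
  qed
next
  case 2
  then show ?case
  proof
    assume ?R1
    then obtain \<gamma>' Bs where Bs: "\<gamma> = b # \<gamma>'" "concat Bs = c # \<beta>" "\<forall>B\<in>set Bs. B \<noteq> []" "\<gamma>' = map sum_list Bs"
      by (auto simp: coarsens_def)
    then show ?L unfolding coarsens_def by (intro exI[of _ "[b] # Bs"]) auto
  next
    assume ?R2
    then obtain Bs where Bs: "concat Bs = (b + c) # \<beta>" "\<forall>B\<in>set Bs. B \<noteq> []" "\<gamma> = map sum_list Bs" by (auto simp: coarsens_def)
    then obtain B Bs' where B: "Bs = B # Bs'" by (cases Bs) auto
    then obtain B' where B': "B = (b + c) # B'" using Bs by (cases B) auto
    then show ?L unfolding coarsens_def using Bs B by (intro exI[of _ "(b # c # B') # Bs'"]) auto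
  qed
qed

lemma coarsens_length: "coarsens \<gamma> \<beta> \<Longrightarrow> length \<gamma> \<le> length \<beta>"
proof -
  have "length Bs \<le> length (concat Bs)" if "\<forall>B\<in>set Bs. B \<noteq> []" for Bs :: "nat list list"
    using that by (induction Bs) (auto simp: Suc_le_eq neq_Nil_conv)
  then show "coarsens \<gamma> \<beta> \<Longrightarrow> length \<gamma> \<le> length \<beta>" by (auto simp: coarsens_def)
qed

lemma coarsens_comps_of:
  assumes "coarsens \<gamma> \<beta>" "is_comp \<beta>"
  shows "\<gamma> \<in> comps_of (sum_list \<beta>)"
proof -
  obtain Bs where Bs: "concat Bs = \<beta>" "\<forall>B\<in>set Bs. B \<noteq> []" "\<gamma> = map sum_list Bs"
    using assms by (auto simp: coarsens_def)
  have "0 < sum_list B" if B: "B \<in> set Bs" for B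
  proof -
    obtain x B' where "B = x # B'" using Bs(2) B by (cases B) auto
    then show ?thesis using B Bs(1) assms(2) by (auto simp: is_comp_def)
  qed
  moreover have "sum_list (map sum_list Bs) = sum_list (concat Bs)" by (induction Bs) auto
  ultimately show ?thesis using Bs by (auto simp: comps_of_def is_comp_def)
qed

lemma coarsens_hd:
  assumes "coarsens (g # \<gamma>) (b # \<beta>)"
  shows "b \<le> g"
proof -
  obtain Bs where Bs: "concat Bs = b # \<beta>" "\<forall>B\<in>set Bs. B \<noteq> []" "g # \<gamma> = map sum_list Bs"
    using assms unfolding coarsens_def by (elim exE conjE)
  obtain B Bs' where B: "Bs = B # Bs'" using Bs(1) by (cases Bs) auto
  obtain B' where "B = b # B'" using Bs(1,2) B by (cases B) auto
  then show ?thesis using Bs B by simp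
qed

lemma coarsens_refl: "coarsens \<beta> \<beta>"
proof -
  have "concat (map (\<lambda>x. [x]) \<beta>) = \<beta>" "map sum_list (map (\<lambda>x. [x]) \<beta>) = \<beta>" by (induction \<beta>) auto
  then show ?thesis unfolding coarsens_def by (intro exI[of _ "map (\<lambda>x. [x]) \<beta>"]) auto
qed

text \<open>The product rule for ribbons, solved for the longest one and read coefficientwise: a
  coarsening either keeps \<open>b\<close> as its first part or merges it with
  \<open>c\<close>.\<close>

lemma ribbon_Cons_Cons:
  assumes "0 < c"
  shows "ribbon (b # c # \<beta>) \<gamma> =
    (case \<gamma> of [] \<Rightarrow> 0 | g # \<gamma>' \<Rightarrow> if g = b then ribbon (c # \<beta>) \<gamma>' else 0) - ribbon ((b + c) # \<beta>) \<gamma>"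
proof -
  \<comment> \<open>The two kinds of coarsening exclude each other, as a merged first part is at
    least \<open>b + c\<close>.\<close>
  have excl: "\<not> coarsens (b # \<gamma>') ((b + c) # \<beta>)" for \<gamma>' using coarsens_hd assms by fastforce
  show ?thesis
  proof (cases "coarsens \<gamma> ((b + c) # \<beta>)")
    case True
    then have l: "length \<gamma> \<le> Suc (length \<beta>)" using coarsens_length by fastforce
    have "(-1 :: rat) ^ (Suc (Suc (length \<beta>)) - length \<gamma>) = - ((-1) ^ (Suc (length \<beta>) - length \<gamma>))"
      using l by (simp add: Suc_diff_le)
    then show ?thesis using True excl by (auto simp: ribbon_def coarsens_Cons_Cons split: list.splits)
  next
    case False
    then show ?thesis by (auto simp: ribbon_def coarsens_Cons_Cons split: list.splits)
  qed
qed

text \<open>Inclusion-exclusion: \<open>dec_blocks \<gamma> w\<close> says that all descents of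
  \<open>w\<close> are block boundaries, and the signed sum over coarsenings of \<beta> keeps the
  words whose descents are all boundaries of \<beta>. The induction runs through the ribbon
  recursion and its word counterpart in parallel.\<close>

lemma ribbon_dec_blocks:
  "is_comp \<beta> \<Longrightarrow> (\<Sum>\<gamma>\<in>comps_of (sum_list \<beta>). ribbon \<beta> \<gamma> * of_bool (dec_blocks \<gamma> w)) = of_bool (dcomp w = \<beta>)"
proof (induction "length \<beta>" arbitrary: \<beta> w rule: less_induct)
  case less
  consider "\<beta> = []" | b where "\<beta> = [b]" | b c \<beta>' where "\<beta> = b # c # \<beta>'"
    by (cases \<beta> rule: dcomp.cases) auto
  then show ?case
  proof cases
    case 1
    have "comps_of 0 = {[]}"
    proof -
      have "xs = []" if "is_comp xs" "sum_list xs = 0" for xs using that by (cases xs) (auto simp: is_comp_def)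
      then show ?thesis by (auto simp: comps_of_def is_comp_def)
    qed
    then show ?thesis using 1 by (simp add: ribbon_def coarsens_Nil)
  next
    case 2
    then have b: "0 < b" using less by (simp add: is_comp_def)
    have "[b] \<in> comps_of b" using b by (auto simp: comps_of_def is_comp_def)
    then have "(\<Sum>\<gamma>\<in>comps_of b. ribbon [b] \<gamma> * of_bool (dec_blocks \<gamma> w)) = of_bool (dec_blocks [b] w)"
      by (subst sum.remove[of _ "[b]"]) (auto simp: ribbon_def coarsens_single intro!: sum.neutral)
    moreover have "dec_blocks [b] w \<longleftrightarrow> dcomp w = [b]"
    proof (cases "length w = b")
      case True
      then show ?thesis using dcomp_hook_iff[of 0 w] b by (cases w) auto
    next
      case False
      then show ?thesis using sum_dcomp[of w] by auto
    qed
    ultimately show ?thesis using 2 by simp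
  next
    case 3
    then have bc: "0 < b" "0 < c" "is_comp (c # \<beta>')" "is_comp ((b + c) # \<beta>')" using less by (auto simp: is_comp_def)
    let ?N = "sum_list \<beta>" and ?M = "c + sum_list \<beta>'"
    let ?T = "\<lambda>\<gamma>. case \<gamma> of [] \<Rightarrow> 0 | g # \<gamma>' \<Rightarrow> if g = b then ribbon (c # \<beta>') \<gamma>' else 0"
    have N: "?N = b + ?M" using 3 by simp
    have im: "(#) b ` comps_of ?M \<subseteq> comps_of ?N" using bc N by (auto simp: comps_of_def is_comp_def)
    \<comment> \<open>Only compositions that begin with \<open>b\<close> contribute to this
      summand.\<close>
    have "(\<Sum>\<gamma>\<in>comps_of ?N. ?T \<gamma> * of_bool (dec_blocks \<gamma> w)) = (\<Sum>\<gamma>\<in>(#) b ` comps_of ?M. ?T \<gamma> * of_bool (dec_blocks \<gamma> w))"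
    proof (rule sum.mono_neutral_right)
      show "\<forall>\<gamma>\<in>comps_of ?N - (#) b ` comps_of ?M. ?T \<gamma> * of_bool (dec_blocks \<gamma> w) = 0"
        using N by (auto simp: comps_of_def is_comp_def image_iff split: list.splits)
    qed (use im in auto)
    also have "\<dots> = (\<Sum>\<gamma>\<in>comps_of ?M. ribbon (c # \<beta>') \<gamma> * of_bool (dec_blocks (b # \<gamma>) w))"
      by (subst sum.reindex) auto
    also have "\<dots> = of_bool (\<exists>u v. w = u @ v \<and> length u = b \<and> sorted_wrt (>) u \<and> dcomp v = c # \<beta>')"
    proof (cases "b \<le> length w \<and> sorted_wrt (>) (take b w)")
      case True
      have "(\<exists>u v. w = u @ v \<and> length u = b \<and> sorted_wrt (>) u \<and> P v) \<longleftrightarrow> P (drop b w)" for P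
        using True by (metis append_eq_conv_conj append_take_drop_id length_take min.absorb2)
      then show ?thesis using less.hyps[of "c # \<beta>'" "drop b w"] bc 3 by simp
    next
      case False
      then have no: "\<not> (\<exists>u v. w = u @ v \<and> length u = b \<and> sorted_wrt (>) u \<and> P v)" for P by auto
      then have "\<not> dec_blocks (b # \<gamma>) w" for \<gamma> by simp
      then show ?thesis using no[of "\<lambda>v. dcomp v = c # \<beta>'"] by (simp del: dec_blocks.simps)
    qed
    finally have 1: "(\<Sum>\<gamma>\<in>comps_of ?N. ?T \<gamma> * of_bool (dec_blocks \<gamma> w)) =
      of_bool (dcomp w = b # c # \<beta>' \<or> dcomp w = (b + c) # \<beta>')"
      unfolding dcomp_Cons_Cons[OF bc(1,2)] .
    have 2: "(\<Sum>\<gamma>\<in>comps_of ?N. ribbon ((b + c) # \<beta>') \<gamma> * of_bool (dec_blocks \<gamma> w)) = of_bool (dcomp w = (b + c) # \<beta>')"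
      using less.hyps[of "(b + c) # \<beta>'" w] bc 3 by (simp add: add.assoc)
    have "(\<Sum>\<gamma>\<in>comps_of ?N. ribbon \<beta> \<gamma> * of_bool (dec_blocks \<gamma> w)) =
      (\<Sum>\<gamma>\<in>comps_of ?N. ?T \<gamma> * of_bool (dec_blocks \<gamma> w)) - (\<Sum>\<gamma>\<in>comps_of ?N. ribbon ((b + c) # \<beta>') \<gamma> * of_bool (dec_blocks \<gamma> w))"
      unfolding 3(1) ribbon_Cons_Cons[OF bc(2)] by (simp add: left_diff_distrib sum_subtractf)
    also have "\<dots> = of_bool (dcomp w = \<beta>)" unfolding 1 2 using 3 bc by auto
    finally show ?thesis .
  qed
qed

section \<open>The inverse of the block word matrix\<close>

definition block_words :: "nat list \<Rightarrow> nat list \<Rightarrow> nat list \<Rightarrow> nat list set" where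
  "block_words \<gamma> \<alpha> \<delta> = {w. dec_blocks \<gamma> w \<and> act w \<alpha> = Some \<delta>}"

text \<open>The coefficient of \<delta> in h_\<gamma> applied to \<alpha>. For empty \<alpha> these
  numbers form the matrix to be inverted.\<close>

definition block_count :: "nat list \<Rightarrow> nat list \<Rightarrow> nat list \<Rightarrow> rat" where
  "block_count \<gamma> \<alpha> \<delta> = of_nat (card (block_words \<gamma> \<alpha> \<delta>))"

lemma finite_block_words [simp]: "finite (block_words \<gamma> \<alpha> \<delta>)"
  by (rule finite_subset[OF _ finite_act_words[of \<alpha> \<delta>]]) (auto simp: block_words_def)

text \<open>The coefficient of \<delta> in r_\<beta> applied to \<alpha>: sum
  \<open>ribbon_dec_blocks\<close> over the finitely many words from \<alpha> to \<delta>.\<close>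

lemma card_desc_words:
  assumes "is_comp \<beta>"
  shows "of_nat (card (desc_words \<beta> \<alpha> \<delta>)) = (\<Sum>\<gamma>\<in>comps_of (sum_list \<beta>). ribbon \<beta> \<gamma> * block_count \<gamma> \<alpha> \<delta>)"
proof -
  let ?W = "{w. act w \<alpha> = Some \<delta>}"
  have card: "of_nat (card {w. P w \<and> act w \<alpha> = Some \<delta>}) = (\<Sum>w\<in>?W. of_bool (P w) :: rat)" for P
  proof -
    have "?W \<inter> {w. P w} = {w. P w \<and> act w \<alpha> = Some \<delta>}" by auto
    then show ?thesis using finite_act_words[of \<alpha> \<delta>] by simp
  qed
  have "(\<Sum>\<gamma>\<in>comps_of (sum_list \<beta>). ribbon \<beta> \<gamma> * block_count \<gamma> \<alpha> \<delta>) =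
    (\<Sum>\<gamma>\<in>comps_of (sum_list \<beta>). \<Sum>w\<in>?W. ribbon \<beta> \<gamma> * of_bool (dec_blocks \<gamma> w))"
    unfolding block_count_def block_words_def card by (simp only: sum_distrib_left)
  also have "\<dots> = (\<Sum>w\<in>?W. \<Sum>\<gamma>\<in>comps_of (sum_list \<beta>). ribbon \<beta> \<gamma> * of_bool (dec_blocks \<gamma> w))"
    by (rule sum.swap)
  also have "\<dots> = (\<Sum>w\<in>?W. of_bool (dcomp w = \<beta>))" by (simp only: ribbon_dec_blocks[OF assms])
  finally show ?thesis unfolding desc_words_def card by simp
qed

text \<open>The action respects products: a word is cut after \<open>sum_list \<gamma>\<close>
  letters, and \<epsilon> is the composition reached by its right part, which acts first.\<close>

lemma block_count_append:
  assumes "is_comp \<alpha>"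
  shows "block_count (\<gamma> @ \<gamma>') \<alpha> \<delta> =
    (\<Sum>\<epsilon>\<in>comps_of (sum_list \<alpha> + sum_list \<gamma>'). block_count \<gamma> \<epsilon> \<delta> * block_count \<gamma>' \<alpha> \<epsilon>)"
proof -
  let ?E = "comps_of (sum_list \<alpha> + sum_list \<gamma>')"
  let ?P = "SIGMA \<epsilon>:?E. block_words \<gamma> \<epsilon> \<delta> \<times> block_words \<gamma>' \<alpha> \<epsilon>"
  let ?f = "\<lambda>(\<epsilon> :: nat list, u, v). u @ v"
  have inj: "inj_on ?f ?P"
  proof (rule inj_onI, clarsimp)
    fix \<epsilon> \<epsilon>' u u' v v' :: "nat list"
    assume *: "u \<in> block_words \<gamma> \<epsilon> \<delta>" "v \<in> block_words \<gamma>' \<alpha> \<epsilon>"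
      "u' \<in> block_words \<gamma> \<epsilon>' \<delta>" "v' \<in> block_words \<gamma>' \<alpha> \<epsilon>'" "u @ v = u' @ v'"
    then have "length u = length u'" using dec_blocks_length[of \<gamma> u] dec_blocks_length[of \<gamma> u'] by (auto simp: block_words_def)
    then show "\<epsilon> = \<epsilon>' \<and> u = u' \<and> v = v'" using * by (auto simp: block_words_def)
  qed
  have im: "?f ` ?P = block_words (\<gamma> @ \<gamma>') \<alpha> \<delta>"
  proof (intro equalityI subsetI)
    fix w assume "w \<in> block_words (\<gamma> @ \<gamma>') \<alpha> \<delta>"
    then obtain u v where uv: "w = u @ v" "dec_blocks \<gamma> u" "dec_blocks \<gamma>' v" "act w \<alpha> = Some \<delta>"
      by (auto simp: block_words_def dec_blocks_append)
    then obtain \<epsilon> where \<epsilon>: "act v \<alpha> = Some \<epsilon>" "act u \<epsilon> = Some \<delta>" by (auto simp: act_append bind_eq_Some_conv)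
    have "\<epsilon> \<in> ?E" using act_sum[OF \<epsilon>(1)] act_is_comp[OF \<epsilon>(1) assms] dec_blocks_length[OF uv(3)] by (simp add: comps_of_def)
    then show "w \<in> ?f ` ?P" using uv \<epsilon> by (intro image_eqI[of _ _ "(\<epsilon>, u, v)"]) (auto simp: block_words_def)
  qed (auto simp: block_words_def dec_blocks_append act_append)
  have "card (block_words (\<gamma> @ \<gamma>') \<alpha> \<delta>) = card ?P" unfolding im[symmetric] by (rule card_image[OF inj])
  also have "\<dots> = (\<Sum>\<epsilon>\<in>?E. card (block_words \<gamma> \<epsilon> \<delta>) * card (block_words \<gamma>' \<alpha> \<epsilon>))"
    by (simp add: card_SigmaI card_cartesian_product)
  finally show ?thesis by (simp add: block_count_def)
qed

section \<open>First part and number of rows under a decreasing word\<close>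

lemma act_small_first_part:
  assumes "act u (x # \<epsilon>) = Some \<delta>" "\<forall>c\<in>set u. Suc x < c"
  shows "\<exists>\<epsilon>'. \<delta> = x # \<epsilon>' \<and> length \<epsilon>' = length \<epsilon>"
  using assms
proof (induction u arbitrary: \<delta>)
  case (Cons c u)
  then obtain \<delta>' where \<delta>': "act u (x # \<epsilon>) = Some \<delta>'" "add_box c \<delta>' = Some \<delta>" by (auto simp: bind_eq_Some_conv)
  then obtain \<epsilon>' where "\<delta>' = x # \<epsilon>'" "length \<epsilon>' = length \<epsilon>" using Cons by auto
  moreover have "c \<noteq> 0" "c \<noteq> 1" "x \<noteq> c - 1" using Cons.prems(2) by auto
  ultimately show ?case using \<delta>'(2) by (auto simp: add_box_def dest: bump_length)
qed simp

text \<open>The letters act in increasing order, and the first part grows only by the letter one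
  above its length. Once that letter is skipped, all later ones are too large and the first part
  stays. So it reaches \<open>x + length u\<close> only for consecutive letters, and then every box
  goes into the first row.\<close>

lemma act_first_part:
  assumes "sorted_wrt (>) u" "\<forall>c\<in>set u. x < c" "0 < x" "act u (x # \<epsilon>) = Some \<delta>"
  shows "(\<delta> = (x + length u) # \<epsilon> \<and> u = rev [Suc x..<Suc x + length u]) \<or>
     (\<exists>k \<epsilon>'. \<delta> = k # \<epsilon>' \<and> k < x + length u \<and> length \<epsilon>' = length \<epsilon>)"
  using assms
proof (induction u arbitrary: x rule: rev_induct)
  case (snoc c u)
  have u: "sorted_wrt (>) u" "\<forall>d\<in>set u. c < d" "x < c" using snoc.prems(1,2) by (auto simp: sorted_wrt_append)
  obtain \<delta>' where \<delta>': "add_box c (x # \<epsilon>) = Some \<delta>'" "act u \<delta>' = Some \<delta>"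
    using snoc.prems(4) by (auto simp: act_append bind_eq_Some_conv)
  show ?case
  proof (cases "c = Suc x")
    case True
    then have "\<delta>' = c # \<epsilon>" using \<delta>'(1) snoc.prems(3) by (auto simp: add_box_def)
    then have "(\<delta> = (c + length u) # \<epsilon> \<and> u = rev [Suc c..<Suc c + length u]) \<or>
     (\<exists>k \<epsilon>'. \<delta> = k # \<epsilon>' \<and> k < c + length u \<and> length \<epsilon>' = length \<epsilon>)"
      using snoc.IH[of c] u \<delta>'(2) True by simp
    moreover have "rev [Suc x..<Suc x + length (u @ [c])] = rev [Suc c..<Suc c + length u] @ [c]"
    proof -
      have "Suc x + length (u @ [c]) = Suc c + length u" using True by simp
      moreover have "[Suc x..<Suc c + length u] = Suc x # [Suc (Suc x)..<Suc c + length u]"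
        using True by (subst upt_conv_Cons) auto
      ultimately show ?thesis using True by simp
    qed
    ultimately show ?thesis using True by auto
  next
    case False
    then have c: "Suc x < c" using u by simp
    then obtain \<epsilon>1 where e1: "\<delta>' = x # \<epsilon>1" "length \<epsilon>1 = length \<epsilon>"
      using \<delta>'(1) by (auto simp: add_box_def split: if_splits dest: bump_length)
    have "\<forall>d\<in>set u. Suc x < d" using u(2) c less_trans by blast
    then have "\<exists>\<epsilon>'. \<delta> = x # \<epsilon>' \<and> length \<epsilon>' = length \<epsilon>1"
      using act_small_first_part[of u x \<epsilon>1 \<delta>] \<delta>'(2) e1(1) by blast
    then show ?thesis using e1 by auto
  qed
qed simp

text \<open>Only the letter 1 creates a row, and it can occur only once, at the end. Afterwards
  \<open>act_first_part\<close> bounds the new first row.\<close>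

lemma act_dec_block:
  assumes "sorted_wrt (>) u" "u \<noteq> []" "act u \<epsilon> = Some \<delta>"
  shows "length \<delta> = length \<epsilon> \<or> (\<exists>k \<epsilon>'. \<delta> = k # \<epsilon>' \<and> k < length u \<and> length \<epsilon>' = length \<epsilon>) \<or>
    (\<delta> = length u # \<epsilon> \<and> u = rev [1..<Suc (length u)])"
proof (cases "1 \<in> set u")
  case True
  obtain u' c where u: "u = u' @ [c]" using assms(2) by (cases u rule: rev_cases) auto
  then obtain \<epsilon>' where e: "add_box c \<epsilon> = Some \<epsilon>'" "act u' \<epsilon>' = Some \<delta>"
    using assms(3) by (auto simp: act_append bind_eq_Some_conv)
  have "c \<noteq> 0" using e(1) by (cases "c = 0") (auto simp: add_box_def)
  have gt: "\<forall>d\<in>set u'. c < d" "sorted_wrt (>) u'" using assms(1) u by (auto simp: sorted_wrt_append)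
  have c: "c = 1"
  proof (rule ccontr)
    assume "c \<noteq> 1"
    then have "1 \<in> set u'" using True u by auto
    then show False using gt(1) \<open>c \<noteq> 0\<close> by auto
  qed
  then have "\<epsilon>' = 1 # \<epsilon>" using e(1) by (simp add: add_box_def)
  moreover have "rev [1..<Suc (length u)] = rev [Suc 1..<Suc 1 + length u'] @ [1]"
    using u by (simp add: upt_conv_Cons del: upt_Suc)
  ultimately show ?thesis using act_first_part[of u' 1 \<epsilon> \<delta>] gt e c u by auto
next
  case False
  have "length \<delta> = length \<epsilon>" using assms(3) False
  proof (induction u arbitrary: \<delta>)
    case (Cons c u)
    then obtain \<delta>' where "act u \<epsilon> = Some \<delta>'" "add_box c \<delta>' = Some \<delta>" by (auto simp: bind_eq_Some_conv)
    then show ?case using Cons by (auto simp: add_box_def split: if_splits dest: bump_length)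
  qed simp
  then show ?thesis by simp
qed

abbreviation comp_less :: "nat list \<Rightarrow> nat list \<Rightarrow> bool" where
  "comp_less \<delta> \<gamma> \<equiv> (\<delta>, \<gamma>) \<in> lenlex less_than"

text \<open>The word that builds \<gamma> row by row from the bottom, each row from left to
  right.\<close>

definition row_word :: "nat list \<Rightarrow> nat list" where
  "row_word \<gamma> = concat (map (\<lambda>g. rev [1..<Suc g]) \<gamma>)"

lemma comp_less_Cons:
  "comp_less (x # xs) (y # ys) \<longleftrightarrow> length xs < length ys \<or> length xs = length ys \<and> (x < y \<or> x = y \<and> comp_less xs ys)"
  by (auto simp: lenlex_conv)

lemma comp_less_length: "comp_less xs ys \<Longrightarrow> length xs \<le> length ys"
  by (auto simp: lenlex_conv)

text \<open>Unitriangularity, in the order by length and then lexicographically. A decreasing block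
  adds at most one row, and that row has full length only if the block runs down to 1 without gaps,
  in which case the other rows are untouched.\<close>

lemma block_words_triangular:
  "is_comp \<gamma> \<Longrightarrow> w \<in> block_words \<gamma> [] \<delta> \<Longrightarrow> comp_less \<delta> \<gamma> \<or> (\<delta> = \<gamma> \<and> w = row_word \<gamma>)"
proof (induction \<gamma> arbitrary: w \<delta>)
  case Nil
  then show ?case by (auto simp: block_words_def row_word_def)
next
  case (Cons g \<gamma>)
  then obtain u v where uv: "w = u @ v" "length u = g" "sorted_wrt (>) u" "dec_blocks \<gamma> v" "act w [] = Some \<delta>"
    by (auto simp: block_words_def)
  then obtain \<epsilon> where \<epsilon>: "act v [] = Some \<epsilon>" "act u \<epsilon> = Some \<delta>" by (auto simp: act_append bind_eq_Some_conv)
  have IH: "comp_less \<epsilon> \<gamma> \<or> (\<epsilon> = \<gamma> \<and> v = row_word \<gamma>)"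
    using Cons.IH[of v \<epsilon>] Cons.prems(1) uv \<epsilon> by (auto simp: block_words_def is_comp_def)
  then have le: "length \<epsilon> \<le> length \<gamma>" using comp_less_length by auto
  have "u \<noteq> []" using uv Cons.prems(1) by (auto simp: is_comp_def)
  from act_dec_block[OF uv(3) this \<epsilon>(2)] show ?case
  proof (elim disjE exE conjE)
    assume "length \<delta> = length \<epsilon>"
    then show ?thesis using le by (auto simp: lenlex_conv)
  next
    fix k \<epsilon>' assume "\<delta> = k # \<epsilon>'" "k < length u" "length \<epsilon>' = length \<epsilon>"
    then show ?thesis using le uv(2) by (auto simp: comp_less_Cons)
  next
    assume *: "\<delta> = length u # \<epsilon>" "u = rev [1..<Suc (length u)]"
    from IH show ?thesis
    proof
      assume "comp_less \<epsilon> \<gamma>"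
      then show ?thesis using * uv(2) le by (auto simp: comp_less_Cons)
    next
      assume "\<epsilon> = \<gamma> \<and> v = row_word \<gamma>"
      then have "\<delta> = g # \<gamma>" "w = rev [1..<Suc g] @ row_word \<gamma>" using * uv by auto
      then show ?thesis by (simp add: row_word_def del: upt_Suc)
    qed
  qed
qed

lemma act_row: "0 < g \<Longrightarrow> act (rev [1..<Suc g]) \<gamma> = Some (g # \<gamma>)"
proof (induction g)
  case (Suc g)
  then show ?case by (cases "g = 0") (auto simp: add_box_def)
qed simp

lemma sorted_wrt_rev_upt: "sorted_wrt (>) (rev [a..<b])" for a b :: nat
  by (simp add: sorted_wrt_rev)

lemma row_word_in_block_words: "is_comp \<gamma> \<Longrightarrow> row_word \<gamma> \<in> block_words \<gamma> [] \<gamma>"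
proof (induction \<gamma>)
  case (Cons g \<gamma>)
  then have IH: "dec_blocks \<gamma> (row_word \<gamma>)" "act (row_word \<gamma>) [] = Some \<gamma>" "0 < g"
    by (auto simp: block_words_def is_comp_def)
  have "row_word (g # \<gamma>) = rev [1..<Suc g] @ row_word \<gamma>" by (simp add: row_word_def del: upt_Suc)
  moreover have "act (rev [1..<Suc g] @ row_word \<gamma>) [] = Some (g # \<gamma>)"
    using IH act_row[of g \<gamma>] by (simp add: act_append del: upt_Suc)
  moreover have "dec_blocks (g # \<gamma>) (rev [1..<Suc g] @ row_word \<gamma>)"
    using IH sorted_wrt_rev_upt[of 1 "Suc g"] unfolding dec_blocks.simps
    by (intro exI[of _ "rev [1..<Suc g]"] exI[of _ "row_word \<gamma>"]) (simp del: upt_Suc)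
  ultimately show ?case by (simp add: block_words_def)
qed (simp add: block_words_def row_word_def)

lemma block_count_diag: "is_comp \<gamma> \<Longrightarrow> block_count \<gamma> [] \<gamma> = 1"
proof -
  assume \<gamma>: "is_comp \<gamma>"
  have "\<not> comp_less \<gamma> \<gamma>" using wf_lenlex[OF wf_less_than] by (simp add: wf_not_refl)
  then have "block_words \<gamma> [] \<gamma> = {row_word \<gamma>}"
    using block_words_triangular[OF \<gamma>] row_word_in_block_words[OF \<gamma>] by auto
  then show ?thesis by (simp add: block_count_def)
qed

lemma block_count_triangular: "is_comp \<gamma> \<Longrightarrow> block_count \<gamma> [] \<delta> \<noteq> 0 \<Longrightarrow> \<delta> = \<gamma> \<or> comp_less \<delta> \<gamma>"
  using block_words_triangular by (fastforce simp: block_count_def card_gt_0_iff)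

text \<open>Back substitution: the expansion of h_\<gamma> with coefficients
  \<open>block_count \<gamma> [] \<delta>\<close> is solved for its diagonal term, whose coefficient
  is 1.\<close>

function schur :: "nat list \<Rightarrow> nsym" where
  "schur \<gamma> = (\<lambda>\<zeta>. of_bool (\<gamma> = \<zeta>) -
     (\<Sum>\<delta>\<in>{\<delta> \<in> comps_of (sum_list \<gamma>). comp_less \<delta> \<gamma>}. block_count \<gamma> [] \<delta> * schur \<delta> \<zeta>))"
  by auto
termination by (relation "lenlex less_than") (auto simp: wf_lenlex)

declare schur.simps [simp del]

lemma block_count_schur:
  assumes "is_comp \<gamma>"
  shows "(\<Sum>\<delta>\<in>comps_of (sum_list \<gamma>). block_count \<gamma> [] \<delta> * schur \<delta> \<zeta>) = of_bool (\<gamma> = \<zeta>)"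
proof -
  let ?C = "comps_of (sum_list \<gamma>)" and ?L = "{\<delta> \<in> comps_of (sum_list \<gamma>). comp_less \<delta> \<gamma>}"
  have \<gamma>: "\<gamma> \<in> ?C" "\<gamma> \<notin> ?L" using assms wf_lenlex[OF wf_less_than] by (auto simp: comps_of_def wf_not_refl)
  have "(\<Sum>\<delta>\<in>?C. block_count \<gamma> [] \<delta> * schur \<delta> \<zeta>) = (\<Sum>\<delta>\<in>insert \<gamma> ?L. block_count \<gamma> [] \<delta> * schur \<delta> \<zeta>)"
    using \<gamma> block_count_triangular[OF assms] by (intro sum.mono_neutral_right) auto
  also have "\<dots> = schur \<gamma> \<zeta> + (\<Sum>\<delta>\<in>?L. block_count \<gamma> [] \<delta> * schur \<delta> \<zeta>)"
    using \<gamma> block_count_diag[OF assms] by (subst sum.insert) auto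
  finally show ?thesis by (simp add: schur.simps[of \<gamma>])
qed

lemma schur_support: "is_comp \<gamma> \<Longrightarrow> schur \<gamma> \<zeta> \<noteq> 0 \<Longrightarrow> \<zeta> \<in> comps_of (sum_list \<gamma>)"
proof (induction \<gamma> rule: schur.induct)
  case (1 \<gamma>)
  show ?case
  proof (rule ccontr)
    assume n: "\<zeta> \<notin> comps_of (sum_list \<gamma>)"
    have "schur \<delta> \<zeta> = 0" if "\<delta> \<in> {\<delta> \<in> comps_of (sum_list \<gamma>). comp_less \<delta> \<gamma>}" for \<delta>
      using 1(1)[OF that] that n by (auto simp: comps_of_def)
    moreover have "\<gamma> \<noteq> \<zeta>" using n 1(2) by (auto simp: comps_of_def)
    ultimately show False using 1(3) by (simp add: schur.simps[of \<gamma>])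
  qed
qed

text \<open>The inverse on the other side, by induction along the recursion of \<open>schur\<close>.
  It says that the element \<open>schur \<epsilon>\<close> sends the empty composition to
  \<epsilon>.\<close>

lemma schur_block_count:
  "is_comp \<epsilon> \<Longrightarrow> is_comp \<delta> \<Longrightarrow> (\<Sum>\<gamma>\<in>comps_of (sum_list \<epsilon>). schur \<epsilon> \<gamma> * block_count \<gamma> [] \<delta>) = of_bool (\<epsilon> = \<delta>)"
proof (induction \<epsilon> rule: schur.induct)
  case (1 \<epsilon>)
  let ?C = "comps_of (sum_list \<epsilon>)" and ?L = "{\<delta> \<in> comps_of (sum_list \<epsilon>). comp_less \<delta> \<epsilon>}"
  have \<epsilon>: "\<epsilon> \<in> ?C" using 1 by (auto simp: comps_of_def)
  have "(\<Sum>\<gamma>\<in>?C. schur \<epsilon> \<gamma> * block_count \<gamma> [] \<delta>) =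
    (\<Sum>\<gamma>\<in>?C. of_bool (\<epsilon> = \<gamma>) * block_count \<gamma> [] \<delta>) -
    (\<Sum>\<gamma>\<in>?C. \<Sum>\<epsilon>'\<in>?L. block_count \<epsilon> [] \<epsilon>' * (schur \<epsilon>' \<gamma> * block_count \<gamma> [] \<delta>))"
    by (simp only: schur.simps[of \<epsilon>] left_diff_distrib sum_subtractf sum_distrib_right mult.assoc)
  also have "(\<Sum>\<gamma>\<in>?C. of_bool (\<epsilon> = \<gamma>) * block_count \<gamma> [] \<delta>) = block_count \<epsilon> [] \<delta>"
    using \<epsilon> by (subst sum.remove[of _ \<epsilon>]) (auto intro!: sum.neutral)
  also have "(\<Sum>\<gamma>\<in>?C. \<Sum>\<epsilon>'\<in>?L. block_count \<epsilon> [] \<epsilon>' * (schur \<epsilon>' \<gamma> * block_count \<gamma> [] \<delta>)) =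
    (\<Sum>\<epsilon>'\<in>?L. block_count \<epsilon> [] \<epsilon>' * (\<Sum>\<gamma>\<in>?C. schur \<epsilon>' \<gamma> * block_count \<gamma> [] \<delta>))"
    by (subst sum.swap) (simp only: sum_distrib_left)
  also have "\<dots> = (\<Sum>\<epsilon>'\<in>?L. block_count \<epsilon> [] \<epsilon>' * of_bool (\<epsilon>' = \<delta>))"
  proof (intro sum.cong refl arg_cong2[of _ _ _ _ "(*)"])
    fix \<epsilon>' assume *: "\<epsilon>' \<in> ?L"
    then have "is_comp \<epsilon>'" "sum_list \<epsilon>' = sum_list \<epsilon>" by (auto simp: comps_of_def)
    then show "(\<Sum>\<gamma>\<in>?C. schur \<epsilon>' \<gamma> * block_count \<gamma> [] \<delta>) = of_bool (\<epsilon>' = \<delta>)"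
      using 1(1)[OF *] 1(3) by simp
  qed
  also have "\<dots> = (if \<delta> \<in> ?L then block_count \<epsilon> [] \<delta> else 0)"
    by (auto simp: sum.delta if_distrib of_bool_def cong: if_cong)
  also have "block_count \<epsilon> [] \<delta> - \<dots> = of_bool (\<epsilon> = \<delta>)"
  proof -
    have irr: "\<not> comp_less \<epsilon> \<epsilon>" using wf_lenlex[OF wf_less_than] by (simp add: wf_not_refl)
    have deg: "sum_list \<delta> = sum_list \<epsilon>" if "block_count \<epsilon> [] \<delta> \<noteq> 0"
    proof -
      obtain w where "w \<in> block_words \<epsilon> [] \<delta>" using \<open>block_count \<epsilon> [] \<delta> \<noteq> 0\<close> by (auto simp: block_count_def)
      then show ?thesis using act_sum[of w "[]" \<delta>] dec_blocks_length[of \<epsilon> w] by (simp add: block_words_def)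
    qed
    show ?thesis
    proof (cases "\<epsilon> = \<delta>")
      case True
      then show ?thesis using irr block_count_diag 1(2) by auto
    next
      case False
      then show ?thesis using deg block_count_triangular[OF 1(2), of \<delta>] 1(3) by (auto simp: comps_of_def)
    qed
  qed
  finally show ?case .
qed

section \<open>Standard reverse composition tableaux and words\<close>

text \<open>A new first letter shifts all descents by one and may add the descent 1. Consecutive
  differences ignore the shift, apart from the first one, which is taken against 0.\<close>

lemma descent_set_dcomp:
  "comp_of_set (length w) {i. 1 \<le> i \<and> i < length w \<and> w ! (i - 1) \<le> w ! i} = dcomp w"
proof (induction w rule: dcomp.induct)
  case (2 x)
  have E: "{i. 1 \<le> i \<and> i < length [x] \<and> [x] ! (i - 1) \<le> [x] ! i} = {}" by auto
  show ?case unfolding E by (simp add: comp_of_set_def)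
next
  case (3 x y w)
  let ?D = "\<lambda>w. {i. 1 \<le> i \<and> i < length w \<and> w ! (i - 1) \<le> w ! i}"
  let ?diff = "map (\<lambda>(a, b). a - b)"
  define L where "L = sorted_list_of_set (?D (y # w))"
  have fin: "finite (?D v)" for v :: "nat list" by (rule finite_subset[of _ "{..<length v}"]) auto
  have IH: "dcomp (y # w) = ?diff (zip (L @ [Suc (length w)]) (0 # L))"
    using 3 by (cases "x \<le> y") (auto simp: comp_of_set_def Let_def L_def)
  have D: "?D (x # y # w) = (if x \<le> y then {1} else {}) \<union> Suc ` ?D (y # w)"
  proof (intro set_eqI iffI)
    fix i assume i: "i \<in> ?D (x # y # w)"
    then consider "i = 1" | j where "i = Suc j" "1 \<le> j" by (cases i; cases "i - 1") auto
    then show "i \<in> (if x \<le> y then {1} else {}) \<union> Suc ` ?D (y # w)"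
    proof cases
      case 2
      then have "j \<in> ?D (y # w)" using i by (cases j) auto
      then show ?thesis using 2 by auto
    qed (use i in auto)
  next
    fix i assume "i \<in> (if x \<le> y then {1} else {}) \<union> Suc ` ?D (y # w)"
    then consider "i = 1" "x \<le> y" | j where "i = Suc j" "j \<in> ?D (y # w)" by (auto split: if_splits)
    then show "i \<in> ?D (x # y # w)"
    proof cases
      case 2
      then show ?thesis by (cases j) auto
    qed auto
  qed
  have L: "set L = ?D (y # w)" "sorted L" "distinct L" using fin by (auto simp: L_def)
  have L1: "sorted_list_of_set (?D (x # y # w)) = (if x \<le> y then [1] else []) @ map Suc L"
  proof -
    let ?xs = "(if x \<le> y then [1] else []) @ map Suc L"
    have "set ?xs = ?D (x # y # w)" unfolding D using L(1) by simp
    moreover have "sorted ?xs" using L(2) by (auto simp: sorted_append sorted_map)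
    moreover have "distinct ?xs" using L(1,3) by (auto simp: distinct_map)
    ultimately show ?thesis by (metis sorted_list_of_set.idem_if_sorted_distinct)
  qed
  have S: "?diff (zip (map Suc a) (map Suc b)) = ?diff (zip a b)" for a b :: "nat list"
    by (simp add: zip_map_map comp_def case_prod_beta)
  have C: "comp_of_set (length (x # y # w)) (?D (x # y # w)) =
    ?diff (zip (((if x \<le> y then [1] else []) @ map Suc L) @ [Suc (Suc (length w))]) (0 # (if x \<le> y then [1] else []) @ map Suc L))"
    unfolding comp_of_set_def Let_def L1 by simp
  show ?case
  proof (cases "x \<le> y")
    case True
    have "?diff (zip ((1 # map Suc L) @ [Suc (Suc (length w))]) (0 # 1 # map Suc L)) =
      1 # ?diff (zip (map Suc (L @ [Suc (length w)])) (map Suc (0 # L)))" by simp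
    then show ?thesis unfolding C S using True IH S[of "L @ [Suc (length w)]" "0 # L"] by simp
  next
    case False
    obtain h t where h: "L @ [Suc (length w)] = h # t" by (cases "L @ [Suc (length w)]") auto
    have "?diff (zip (map Suc L @ [Suc (Suc (length w))]) (0 # map Suc L)) =
      ?diff (zip (map Suc (L @ [Suc (length w)])) (0 # map Suc L))" by simp
    also have "\<dots> = Suc h # ?diff (zip t L)" unfolding h using S[of t L] by simp
    finally show ?thesis unfolding C using False IH h by simp
  qed
qed (simp add: comp_of_set_def)

section \<open>Column words of tableaux\<close>

definition col_word :: "nat list \<Rightarrow> (nat \<times> nat \<Rightarrow> nat) \<Rightarrow> nat list" where
  "col_word \<delta> \<tau> = map (col_of \<delta> \<tau>) [1..<Suc (sum_list \<delta>)]"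

lemma descents_col_word:
  "comp_of_set (sum_list \<delta>) (descents \<delta> \<tau>) = dcomp (col_word \<delta> \<tau>)"
proof -
  have "descents \<delta> \<tau> = {i. 1 \<le> i \<and> i < length (col_word \<delta> \<tau>) \<and> col_word \<delta> \<tau> ! (i - 1) \<le> col_word \<delta> \<tau> ! i}"
    unfolding descents_def col_word_def by (auto simp: nth_append simp del: upt_Suc)
  then show ?thesis using descent_set_dcomp[of "col_word \<delta> \<tau>"] by (simp add: col_word_def del: upt_Suc)
qed

lemma col_of_eq:
  assumes "srct \<delta> \<tau>" "b \<in> diag \<delta>"
  shows "col_of \<delta> \<tau> (\<tau> b) = snd b"
proof -
  have "inj_on \<tau> (diag \<delta>)" using assms(1) by (auto simp: srct_def bij_betw_def)
  then have "(THE b'. b' \<in> diag \<delta> \<and> \<tau> b' = \<tau> b) = b" using assms(2) by (auto simp: inj_on_def)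
  then show ?thesis by (simp add: col_of_def)
qed

text \<open>Rows of length 0 at the top are allowed, so that removing the box of a first row of length 1
  does not renumber the other rows.\<close>

definition can_bump :: "nat list \<Rightarrow> nat \<Rightarrow> bool" where
  "can_bump \<gamma> k \<longleftrightarrow> k < length \<gamma> \<and> (if \<gamma> ! k = 0 then \<forall>i<k. \<gamma> ! i = 0 else \<forall>i<k. \<gamma> ! i \<noteq> \<gamma> ! k)"

abbreviation bumped :: "nat list \<Rightarrow> nat \<Rightarrow> nat list" where
  "bumped \<gamma> k \<equiv> \<gamma>[k := Suc (\<gamma> ! k)]"

text \<open>Adding a box means inserting a new smallest entry; the value 0 off the diagram is the
  normalisation in \<open>srct\<close>.\<close>

definition lift_tab :: "nat list \<Rightarrow> nat \<Rightarrow> (nat \<times> nat \<Rightarrow> nat) \<Rightarrow> nat \<times> nat \<Rightarrow> nat" where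
  "lift_tab \<gamma> k \<tau> x = (if x \<in> diag \<gamma> then Suc (\<tau> x) else if x = (Suc k, Suc (\<gamma> ! k)) then 1 else 0)"

lemma diag_bumped:
  assumes "k < length \<gamma>"
  shows "diag (bumped \<gamma> k) = insert (Suc k, Suc (\<gamma> ! k)) (diag \<gamma>)" "(Suc k, Suc (\<gamma> ! k)) \<notin> diag \<gamma>"
proof -
  have "(i, j) \<in> diag (bumped \<gamma> k) \<longleftrightarrow> (i, j) \<in> insert (Suc k, Suc (\<gamma> ! k)) (diag \<gamma>)" for i j
    using assms by (cases "i = Suc k") (auto simp: diag_def nth_list_update)
  then show "diag (bumped \<gamma> k) = insert (Suc k, Suc (\<gamma> ! k)) (diag \<gamma>)" by auto
qed (auto simp: diag_def)

lemma sum_bumped: "k < length \<gamma> \<Longrightarrow> sum_list (bumped \<gamma> k) = Suc (sum_list \<gamma>)"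
  by (simp add: sum_list_update)

text \<open>The new entry 1 is minimal and ends its row. In column 1, \<open>can_bump\<close> leaves
  no nonempty row above it. In the triple rule, only a row above of length exactly
  \<open>\<gamma> ! k\<close> could violate the condition, and \<open>can_bump\<close> excludes
  it.\<close>

lemma srct_lift:
  assumes "srct \<gamma> \<tau>" "can_bump \<gamma> k"
  shows "srct (bumped \<gamma> k) (lift_tab \<gamma> k \<tau>)"
proof -
  let ?b = "(Suc k, Suc (\<gamma> ! k))" and ?\<delta> = "bumped \<gamma> k" and ?\<sigma> = "lift_tab \<gamma> k \<tau>"
  have k: "k < length \<gamma>" using assms(2) by (simp add: can_bump_def)
  note db = diag_bumped[OF k]
  have bij: "bij_betw \<tau> (diag \<gamma>) {1..sum_list \<gamma>}" and
    rows: "\<And>i j. (i, j) \<in> diag \<gamma> \<Longrightarrow> (i, j + 1) \<in> diag \<gamma> \<Longrightarrow> \<tau> (i, j) > \<tau> (i, j + 1)" and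
    col1: "\<And>i i'. (i, 1) \<in> diag \<gamma> \<Longrightarrow> (i', 1) \<in> diag \<gamma> \<Longrightarrow> i < i' \<Longrightarrow> \<tau> (i, 1) < \<tau> (i', 1)" and
    trip: "\<And>i j k. i < j \<Longrightarrow> 1 \<le> k \<Longrightarrow> (j, k + 1) \<in> diag \<gamma> \<Longrightarrow> (i, k) \<in> diag \<gamma> \<Longrightarrow>
          \<tau> (i, k) > \<tau> (j, k + 1) \<Longrightarrow> (i, k + 1) \<in> diag \<gamma> \<and> \<tau> (i, k + 1) > \<tau> (j, k + 1)"
    using assms(1) unfolding srct_def by blast+
  have pos: "1 \<le> \<tau> x" if "x \<in> diag \<gamma>" for x using bij that by (auto simp: bij_betw_def)
  have in\<gamma>: "?\<sigma> x = Suc (\<tau> x)" if "x \<in> diag \<gamma>" for x using that by (simp add: lift_tab_def)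
  have b1: "?\<sigma> ?b = 1" using db(2) by (simp add: lift_tab_def)
  have "bij_betw ?\<sigma> (diag ?\<delta>) {1..sum_list ?\<delta>}"
  proof -
    have "bij_betw ?\<sigma> (diag \<gamma>) (Suc ` {1..sum_list \<gamma>})"
    proof -
      have "bij_betw (Suc \<circ> \<tau>) (diag \<gamma>) (Suc ` {1..sum_list \<gamma>})"
        using bij by (intro bij_betw_trans[OF bij]) (auto simp: bij_betw_def)
      then show ?thesis using in\<gamma> by (simp add: bij_betw_cong[of "diag \<gamma>" "Suc \<circ> \<tau>" ?\<sigma>])
    qed
    moreover have "bij_betw ?\<sigma> {?b} {1}" using b1 by (simp add: bij_betw_def)
    ultimately have "bij_betw ?\<sigma> (diag \<gamma> \<union> {?b}) (Suc ` {1..sum_list \<gamma>} \<union> {1})"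
      by (rule bij_betw_combine) auto
    moreover have "Suc ` {1..sum_list \<gamma>} \<union> {1} = {1..sum_list ?\<delta>}"
      unfolding sum_bumped[OF k] by (auto simp: image_Suc_atLeastAtMost)
    ultimately show ?thesis using db by simp
  qed
  moreover have "\<forall>b. b \<notin> diag ?\<delta> \<longrightarrow> ?\<sigma> b = 0" using db by (auto simp: lift_tab_def)
  moreover have "?\<sigma> (i, j) > ?\<sigma> (i, j + 1)" if ij: "(i, j) \<in> diag ?\<delta>" "(i, j + 1) \<in> diag ?\<delta>" for i j
  proof -
    have "(i, j) \<noteq> ?b" using ij(2) k by (auto simp: diag_def)
    then have 1: "(i, j) \<in> diag \<gamma>" using ij unfolding db(1) by blast
    show ?thesis
    proof (cases "(i, j + 1) = ?b")
      case True
      then show ?thesis using b1 in\<gamma>[OF 1] pos[OF 1] by simp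
    next
      case False
      then have "(i, j + 1) \<in> diag \<gamma>" using ij unfolding db(1) by blast
      then show ?thesis using in\<gamma> 1 rows by simp
    qed
  qed
  moreover have "?\<sigma> (i, 1) < ?\<sigma> (i', 1)" if ij: "(i, 1) \<in> diag ?\<delta>" "(i', 1) \<in> diag ?\<delta>" "i < i'" for i i'
  proof -
    have "(i', 1) \<noteq> ?b"
    proof
      assume b: "(i', 1) = ?b"
      then have "\<gamma> ! k = 0" "i - 1 < k" "1 \<le> i" using ij by (auto simp: diag_def)
      then have "\<gamma> ! (i - 1) = 0" using assms(2) by (auto simp: can_bump_def)
      then show False using ij(1) \<open>i - 1 < k\<close> by (auto simp: diag_def)
    qed
    then have 1: "(i', 1) \<in> diag \<gamma>" using ij unfolding db(1) by blast
    show ?thesis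
    proof (cases "(i, 1) = ?b")
      case True
      then show ?thesis using b1 in\<gamma>[OF 1] pos[OF 1] by simp
    next
      case False
      then have "(i, 1) \<in> diag \<gamma>" using ij unfolding db(1) by blast
      then show ?thesis using in\<gamma> 1 col1 ij(3) by simp
    qed
  qed
  moreover have "(i, l + 1) \<in> diag ?\<delta> \<and> ?\<sigma> (i, l + 1) > ?\<sigma> (j, l + 1)"
    if ij: "i < j" "1 \<le> l" "(j, l + 1) \<in> diag ?\<delta>" "(i, l) \<in> diag ?\<delta>" "?\<sigma> (i, l) > ?\<sigma> (j, l + 1)" for i j l
  proof -
    have "?\<sigma> (j, l + 1) \<ge> 1" using ij(3) db in\<gamma> b1 by auto
    then have "(i, l) \<noteq> ?b" using ij(5) b1 by auto
    then have 1: "(i, l) \<in> diag \<gamma>" using ij unfolding db(1) by blast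
    show ?thesis
    proof (cases "(j, l + 1) = ?b")
      case True
      then have j: "j = Suc k" "l = \<gamma> ! k" by auto
      have "1 \<le> i" "l \<le> \<gamma> ! (i - 1)" using 1 by (auto simp: diag_def)
      moreover have "\<gamma> ! (i - 1) \<noteq> l" using assms(2) j ij(1,2) \<open>1 \<le> i\<close> by (auto simp: can_bump_def)
      ultimately have 2: "(i, l + 1) \<in> diag \<gamma>" using 1 by (auto simp: diag_def)
      then show ?thesis using db True b1 in\<gamma>[OF 2] pos[OF 2] by simp
    next
      case False
      then have 2: "(j, l + 1) \<in> diag \<gamma>" using ij unfolding db(1) by blast
      then have "\<tau> (i, l) > \<tau> (j, l + 1)" using ij(5) in\<gamma> 1 by simp
      then show ?thesis using trip[OF ij(1,2) 2 1] in\<gamma> 2 db by simp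
    qed
  qed
  ultimately show ?thesis unfolding srct_def by blast
qed

lemma srct_unlift:
  assumes "srct (bumped \<gamma> k) \<sigma>" "k < length \<gamma>" "\<sigma> (Suc k, Suc (\<gamma> ! k)) = 1"
  shows "\<exists>\<tau>. srct \<gamma> \<tau> \<and> \<sigma> = lift_tab \<gamma> k \<tau>"
proof -
  let ?b = "(Suc k, Suc (\<gamma> ! k))" and ?\<delta> = "bumped \<gamma> k"
  note db = diag_bumped[OF assms(2)]
  define \<tau> where "\<tau> x = (if x \<in> diag \<gamma> then \<sigma> x - 1 else 0)" for x
  have bij: "bij_betw \<sigma> (diag ?\<delta>) {1..Suc (sum_list \<gamma>)}" and out: "\<And>b. b \<notin> diag ?\<delta> \<Longrightarrow> \<sigma> b = 0" and
    rows: "\<And>i j. (i, j) \<in> diag ?\<delta> \<Longrightarrow> (i, j + 1) \<in> diag ?\<delta> \<Longrightarrow> \<sigma> (i, j) > \<sigma> (i, j + 1)" and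
    col1: "\<And>i i'. (i, 1) \<in> diag ?\<delta> \<Longrightarrow> (i', 1) \<in> diag ?\<delta> \<Longrightarrow> i < i' \<Longrightarrow> \<sigma> (i, 1) < \<sigma> (i', 1)" and
    trip: "\<And>i j k. i < j \<Longrightarrow> 1 \<le> k \<Longrightarrow> (j, k + 1) \<in> diag ?\<delta> \<Longrightarrow> (i, k) \<in> diag ?\<delta> \<Longrightarrow>
          \<sigma> (i, k) > \<sigma> (j, k + 1) \<Longrightarrow> (i, k + 1) \<in> diag ?\<delta> \<and> \<sigma> (i, k + 1) > \<sigma> (j, k + 1)"
    using assms(1) unfolding srct_def sum_bumped[OF assms(2)] by blast+
  have in\<delta>: "x \<in> diag ?\<delta>" if "x \<in> diag \<gamma>" for x using that db by simp
  have Suc\<tau>: "\<sigma> x = Suc (\<tau> x)" "1 \<le> \<tau> x" if x: "x \<in> diag \<gamma>" for x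
  proof -
    have "\<sigma> x \<ge> 1" using bij in\<delta>[OF x] by (auto simp: bij_betw_def)
    moreover have "\<sigma> x \<noteq> 1"
    proof
      assume "\<sigma> x = 1"
      then have "\<sigma> x = \<sigma> ?b" using assms(3) by simp
      then have "x = ?b" using bij in\<delta>[OF x] db by (auto simp: bij_betw_def inj_on_def)
      then show False using x db by simp
    qed
    ultimately show "\<sigma> x = Suc (\<tau> x)" "1 \<le> \<tau> x" using x by (auto simp: \<tau>_def)
  qed
  have "bij_betw \<tau> (diag \<gamma>) {1..sum_list \<gamma>}"
  proof -
    have "bij_betw \<sigma> (diag ?\<delta> - {?b}) ({1..Suc (sum_list \<gamma>)} - {1})"
      using bij_betw_DiffI[OF bij, of "{?b}" "{1}"] assms(3) db by (auto simp: bij_betw_def)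
    moreover have "diag ?\<delta> - {?b} = diag \<gamma>" using db by auto
    ultimately have 1: "bij_betw \<sigma> (diag \<gamma>) ({1..Suc (sum_list \<gamma>)} - {1})" by simp
    have inj: "inj_on \<tau> (diag \<gamma>)"
      using 1 Suc\<tau>(1) by (auto simp: bij_betw_def inj_on_def)
    moreover have "\<tau> ` diag \<gamma> = {1..sum_list \<gamma>}"
    proof -
      have "Suc ` \<tau> ` diag \<gamma> = \<sigma> ` diag \<gamma>" using Suc\<tau>(1) by force
      also have "\<dots> = {1..Suc (sum_list \<gamma>)} - {1}" using 1 by (simp add: bij_betw_def)
      also have "\<dots> = Suc ` {1..sum_list \<gamma>}" by (auto simp: image_Suc_atLeastAtMost)
      finally show ?thesis using inj_image_eq_iff[OF inj_Suc] by blast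
    qed
    ultimately show ?thesis by (simp add: bij_betw_def)
  qed
  moreover have "\<forall>b. b \<notin> diag \<gamma> \<longrightarrow> \<tau> b = 0" by (simp add: \<tau>_def)
  moreover have "\<tau> (i, j) > \<tau> (i, j + 1)" if "(i, j) \<in> diag \<gamma>" "(i, j + 1) \<in> diag \<gamma>" for i j
    using rows[OF in\<delta>[OF that(1)] in\<delta>[OF that(2)]] Suc\<tau>(1)[OF that(1)] Suc\<tau>(1)[OF that(2)] by simp
  moreover have "\<tau> (i, 1) < \<tau> (i', 1)" if "(i, 1) \<in> diag \<gamma>" "(i', 1) \<in> diag \<gamma>" "i < i'" for i i'
    using col1[OF in\<delta>[OF that(1)] in\<delta>[OF that(2)] that(3)] Suc\<tau>(1)[OF that(1)] Suc\<tau>(1)[OF that(2)] by simp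
  moreover have "(i, l + 1) \<in> diag \<gamma> \<and> \<tau> (i, l + 1) > \<tau> (j, l + 1)"
    if ij: "i < j" "1 \<le> l" "(j, l + 1) \<in> diag \<gamma>" "(i, l) \<in> diag \<gamma>" "\<tau> (i, l) > \<tau> (j, l + 1)" for i j l
  proof -
    have *: "(i, l + 1) \<in> diag ?\<delta>" "\<sigma> (i, l + 1) > \<sigma> (j, l + 1)"
      using trip[OF ij(1,2) in\<delta>[OF ij(3)] in\<delta>[OF ij(4)]] Suc\<tau>(1)[OF ij(3)] Suc\<tau>(1)[OF ij(4)] ij(5) by auto
    then have "(i, l + 1) \<noteq> ?b" using assms(3) Suc\<tau>(1)[OF ij(3)] by auto
    then have "(i, l + 1) \<in> diag \<gamma>" using *(1) unfolding db(1) by blast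
    then show ?thesis using * Suc\<tau>(1)[OF ij(3)] Suc\<tau>(1)[of "(i, l + 1)"] by simp
  qed
  ultimately have "srct \<gamma> \<tau>" unfolding srct_def by blast
  moreover have "\<sigma> = lift_tab \<gamma> k \<tau>"
  proof
    fix x show "\<sigma> x = lift_tab \<gamma> k \<tau> x"
      using Suc\<tau>(1)[of x] out[of x] db assms(3) by (auto simp: lift_tab_def)
  qed
  ultimately show ?thesis by blast
qed

lemma col_word_lift:
  assumes "srct \<gamma> \<tau>" "can_bump \<gamma> k"
  shows "col_word (bumped \<gamma> k) (lift_tab \<gamma> k \<tau>) = Suc (\<gamma> ! k) # col_word \<gamma> \<tau>"
proof -
  let ?b = "(Suc k, Suc (\<gamma> ! k))" and ?\<delta> = "bumped \<gamma> k" and ?\<sigma> = "lift_tab \<gamma> k \<tau>"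
  have k: "k < length \<gamma>" using assms(2) by (simp add: can_bump_def)
  note db = diag_bumped[OF k]
  have s: "srct ?\<delta> ?\<sigma>" using srct_lift[OF assms] .
  have "col_of ?\<delta> ?\<sigma> 1 = Suc (\<gamma> ! k)"
    using col_of_eq[OF s, of ?b] db by (simp add: lift_tab_def)
  moreover have "col_of ?\<delta> ?\<sigma> (Suc v) = col_of \<gamma> \<tau> v" if "v \<in> {1..sum_list \<gamma>}" for v
  proof -
    have "v \<in> \<tau> ` diag \<gamma>" using assms(1) that unfolding srct_def bij_betw_def by simp
    then obtain x where x: "x \<in> diag \<gamma>" "\<tau> x = v" by blast
    then have "?\<sigma> x = Suc v" "x \<in> diag ?\<delta>" using db by (auto simp: lift_tab_def)
    then show ?thesis using col_of_eq[OF s, of x] col_of_eq[OF assms(1) x(1)] x by simp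
  qed
  moreover have "[1..<Suc (sum_list ?\<delta>)] = 1 # map Suc [1..<Suc (sum_list \<gamma>)]"
    unfolding sum_bumped[OF k] by (simp add: map_Suc_upt upt_conv_Cons del: upt_Suc)
  ultimately show ?thesis unfolding col_word_def by (simp del: upt_Suc)
qed

lemma can_bump_new_row:
  "can_bump (replicate (Suc z) 0 @ \<gamma>) z" "(replicate (Suc z) 0 @ \<gamma>) ! z = 0"
  "bumped (replicate (Suc z) 0 @ \<gamma>) z = replicate z 0 @ 1 # \<gamma>"
proof -
  have r: "replicate (Suc z) 0 @ \<gamma> = replicate z 0 @ 0 # \<gamma>"
    using replicate_append_same[of z "0 :: nat"] by simp
  show "can_bump (replicate (Suc z) 0 @ \<gamma>) z" "(replicate (Suc z) 0 @ \<gamma>) ! z = 0"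
    "bumped (replicate (Suc z) 0 @ \<gamma>) z = replicate z 0 @ 1 # \<gamma>"
    unfolding r by (auto simp: can_bump_def nth_append list_update_append)
qed

lemma can_bump_old_row:
  assumes "m < length \<gamma>" "\<gamma> ! m = v" "0 < v" "\<forall>i<m. \<gamma> ! i \<noteq> v"
  shows "can_bump (replicate z 0 @ \<gamma>) (z + m)" "(replicate z 0 @ \<gamma>) ! (z + m) = v"
    "bumped (replicate z 0 @ \<gamma>) (z + m) = replicate z 0 @ \<gamma>[m := Suc v]"
  using assms by (auto simp: can_bump_def nth_append list_update_append)

text \<open>The padding has an extra empty row exactly when a row is created, so the padded lists
  before and after have equal length and both kinds of moves become a bump.\<close>

lemma add_box_can_bump:
  fixes z :: nat
  assumes "add_box c \<gamma> = Some \<delta>"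
  defines "\<gamma>' \<equiv> replicate (if c = 1 then Suc z else z) 0 @ \<gamma>"
  obtains k where "can_bump \<gamma>' k" "Suc (\<gamma>' ! k) = c" "replicate z 0 @ \<delta> = bumped \<gamma>' k"
proof (cases "c = 1")
  case True
  then have "\<delta> = 1 # \<gamma>" using assms by (simp add: add_box_def)
  then show ?thesis using that[of z] True can_bump_new_row[of z \<gamma>] by (simp add: \<gamma>'_def)
next
  case False
  then have c: "2 \<le> c" "bump (c - 1) \<gamma> = Some \<delta>" using assms by (auto simp: add_box_def split: if_splits)
  then obtain m where "m < length \<gamma>" "\<gamma> ! m = c - 1" "\<delta> = \<gamma>[m := Suc (c - 1)]" "\<forall>i<m. \<gamma> ! i \<noteq> c - 1"
    unfolding bump_Some_iff by blast
  then show ?thesis using that[of "z + m"] False c(1) can_bump_old_row[of m \<gamma> "c - 1" z] by (simp add: \<gamma>'_def)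
qed

text \<open>The box of the entry 1 ends its row, as rows decrease. If it is in column 1, it is in
  the first nonempty row, as that column increases downwards; otherwise the triple rule forbids a
  higher row that ends just one column earlier. So removing the box undoes an
  \<open>add_box\<close>.\<close>

lemma srct_remove_box:
  assumes "srct (replicate z 0 @ \<delta>) \<sigma>" "is_comp \<delta>" "\<delta> \<noteq> []"
  obtains c \<gamma> k \<tau> where "add_box c \<gamma> = Some \<delta>" "is_comp \<gamma>"
    "can_bump (replicate (if c = 1 then Suc z else z) 0 @ \<gamma>) k"
    "Suc ((replicate (if c = 1 then Suc z else z) 0 @ \<gamma>) ! k) = c"
    "replicate z 0 @ \<delta> = bumped (replicate (if c = 1 then Suc z else z) 0 @ \<gamma>) k"
    "srct (replicate (if c = 1 then Suc z else z) 0 @ \<gamma>) \<tau>"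
    "\<sigma> = lift_tab (replicate (if c = 1 then Suc z else z) 0 @ \<gamma>) k \<tau>"
proof -
  let ?\<delta> = "replicate z 0 @ \<delta>"
  have sum: "sum_list ?\<delta> = sum_list \<delta>" by (simp add: sum_list_replicate)
  have bij: "bij_betw \<sigma> (diag ?\<delta>) {1..sum_list \<delta>}" and
    rows: "\<And>i j. (i, j) \<in> diag ?\<delta> \<Longrightarrow> (i, j + 1) \<in> diag ?\<delta> \<Longrightarrow> \<sigma> (i, j) > \<sigma> (i, j + 1)" and
    col1: "\<And>i i'. (i, 1) \<in> diag ?\<delta> \<Longrightarrow> (i', 1) \<in> diag ?\<delta> \<Longrightarrow> i < i' \<Longrightarrow> \<sigma> (i, 1) < \<sigma> (i', 1)" and
    trip: "\<And>i j k. i < j \<Longrightarrow> 1 \<le> k \<Longrightarrow> (j, k + 1) \<in> diag ?\<delta> \<Longrightarrow> (i, k) \<in> diag ?\<delta> \<Longrightarrow>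
          \<sigma> (i, k) > \<sigma> (j, k + 1) \<Longrightarrow> (i, k + 1) \<in> diag ?\<delta> \<and> \<sigma> (i, k + 1) > \<sigma> (j, k + 1)"
    using assms(1) unfolding srct_def sum by blast+
  have diag: "(Suc (z + m), j) \<in> diag ?\<delta> \<longleftrightarrow> m < length \<delta> \<and> 1 \<le> j \<and> j \<le> \<delta> ! m" for m j
    by (auto simp: diag_def nth_append)
  have pos: "1 \<le> \<sigma> x" if "x \<in> diag ?\<delta>" for x using bij that by (auto simp: bij_betw_def)
  have "1 \<le> sum_list \<delta>" using assms(2,3) by (cases \<delta>) (auto simp: is_comp_def)
  then have "1 \<in> \<sigma> ` diag ?\<delta>" using bij by (simp add: bij_betw_def)
  then obtain i j where b: "(i, j) \<in> diag ?\<delta>" "\<sigma> (i, j) = 1" by (metis imageE surj_pair)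
  have "z < i"
  proof (rule ccontr)
    assume "\<not> z < i"
    then show False using b(1) by (auto simp: diag_def nth_append split: if_splits)
  qed
  then obtain m where i: "i = Suc (z + m)" using less_imp_Suc_add by blast
  have m: "m < length \<delta>" "1 \<le> j" "j \<le> \<delta> ! m" using b(1) diag i by auto
  have j: "j = \<delta> ! m"
  proof (rule ccontr)
    assume "j \<noteq> \<delta> ! m"
    then have "(i, j + 1) \<in> diag ?\<delta>" using m i diag by auto
    then show False using rows[OF b(1)] b(2) pos by fastforce
  qed
  show ?thesis
  proof (cases "j = 1")
    case True
    have "m = 0"
    proof (rule ccontr)
      assume "m \<noteq> 0"
      moreover have "(Suc (z + 0), 1) \<in> diag ?\<delta>" unfolding diag using assms(2,3) by (cases \<delta>) (auto simp: is_comp_def)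
      ultimately show False using col1[of "Suc (z + 0)" i] b True i pos by fastforce
    qed
    then obtain \<gamma> where \<gamma>: "\<delta> = 1 # \<gamma>" using m(1) j True by (cases \<delta>) auto
    let ?\<gamma> = "replicate (Suc z) 0 @ \<gamma>"
    have 1: "?\<delta> = bumped ?\<gamma> z" using can_bump_new_row(3)[of z \<gamma>] \<gamma> by simp
    have "\<sigma> (Suc z, Suc (?\<gamma> ! z)) = 1" using b(2) i \<open>m = 0\<close> True can_bump_new_row(2)[of z \<gamma>] by simp
    then obtain \<tau> where \<tau>: "srct ?\<gamma> \<tau>" "\<sigma> = lift_tab ?\<gamma> z \<tau>"
      using srct_unlift[of ?\<gamma> z \<sigma>] assms(1) 1 by auto
    show ?thesis
    proof (rule that[of 1 \<gamma> z \<tau>], unfold if_P[OF refl])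
      show "add_box 1 \<gamma> = Some \<delta>" using \<gamma> by (simp add: add_box_def)
      show "is_comp \<gamma>" using assms(2) \<gamma> by (simp add: is_comp_def)
      show "Suc (?\<gamma> ! z) = 1" using can_bump_new_row(2)[of z \<gamma>] by simp
    qed (use 1 \<tau> can_bump_new_row(1) in auto)
  next
    case False
    then have j2: "2 \<le> j" using m by simp
    define \<gamma> where "\<gamma> = \<delta>[m := j - 1]"
    have m': "m < length \<gamma>" "\<gamma> ! m = j - 1" "0 < j - 1" using m j2 by (auto simp: \<gamma>_def)
    have \<delta>: "\<delta> = \<gamma>[m := Suc (j - 1)]" using j j2 by (simp add: \<gamma>_def)
    have ne: "\<forall>i'<m. \<gamma> ! i' \<noteq> j - 1"
    proof (intro allI impI)
      fix i' assume i': "i' < m"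
      show "\<gamma> ! i' \<noteq> j - 1"
      proof
        assume "\<gamma> ! i' = j - 1"
        then have r: "\<delta> ! i' = j - 1" using i' by (simp add: \<gamma>_def)
        have d: "(Suc (z + i'), j - 1) \<in> diag ?\<delta>" using r i' m(1) j2 diag by auto
        \<comment> \<open>The last box of a higher row of length \<open>j - 1\<close> holds an entry
          above 1, so the triple rule would extend that row to column \<open>j\<close>.\<close>
        have "\<sigma> (Suc (z + i'), j - 1) \<noteq> \<sigma> (i, j)"
        proof
          assume "\<sigma> (Suc (z + i'), j - 1) = \<sigma> (i, j)"
          from inj_onD[OF bij_betw_imp_inj_on[OF bij] this d b(1)]
          have "(Suc (z + i'), j - 1) = (i, j)" .
          then show False using i i' by simp
        qed
        then have "\<sigma> (Suc (z + i'), j - 1) > \<sigma> (i, j - 1 + 1)" using pos[OF d] b(2) j2 by simp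
        then have "(Suc (z + i'), j - 1 + 1) \<in> diag ?\<delta>"
          using trip[of "Suc (z + i')" i "j - 1"] i i' j2 b(1) d by simp
        then have "j - 1 + 1 \<le> \<delta> ! i'" using diag by blast
        then show False using r by simp
      qed
    qed
    note cb = can_bump_old_row[OF m' ne, of z]
    let ?\<gamma> = "replicate z 0 @ \<gamma>"
    have 1: "?\<delta> = bumped ?\<gamma> (z + m)" using cb(3) \<delta> by simp
    have jj: "Suc (?\<gamma> ! (z + m)) = j" using cb(2) j2 by simp
    then have "\<sigma> (Suc (z + m), Suc (?\<gamma> ! (z + m))) = 1" using b(2) i by simp
    then obtain \<tau> where \<tau>: "srct ?\<gamma> \<tau>" "\<sigma> = lift_tab ?\<gamma> (z + m) \<tau>"
      using srct_unlift[of ?\<gamma> "z + m" \<sigma>] assms(1) m' unfolding 1 by auto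
    show ?thesis
    proof (rule that[of j \<gamma> "z + m" \<tau>], unfold if_not_P[OF False])
      show "add_box j \<gamma> = Some \<delta>" using j2 \<delta> m' ne bump_Some_iff[of "j - 1" \<gamma> \<delta>] by (auto simp: add_box_def)
      show "is_comp \<gamma>" using assms(2) m'(3) set_update_subset_insert[of \<delta> m "j - 1"] by (auto simp: is_comp_def \<gamma>_def)
    qed (use 1 \<tau> cb(1) jj in auto)
  qed
qed

text \<open>Induction on the size: deleting the box of the entry 1 deletes the first letter. The
  padding is arbitrary because a deleted row of length 1 becomes one more empty row.\<close>

lemma col_word_bij:
  "is_comp \<delta> \<Longrightarrow> bij_betw (col_word (replicate z 0 @ \<delta>)) {\<tau>. srct (replicate z 0 @ \<delta>) \<tau>} {w. act w [] = Some \<delta>}"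
proof (induction "sum_list \<delta>" arbitrary: \<delta> z)
  case 0
  then have \<delta>: "\<delta> = []" by (cases \<delta>) (auto simp: is_comp_def)
  have d: "diag (replicate z 0) = {}" by (auto simp: diag_def)
  have "{\<tau>. srct (replicate z 0) \<tau>} = {\<lambda>_. 0}" by (auto simp: srct_def d bij_betw_def)
  moreover have "{w. act w [] = Some []} = {[]}"
  proof -
    have "w = []" if "act w [] = Some []" for w using act_sum[OF that] by simp
    then show ?thesis by auto
  qed
  ultimately show ?case unfolding \<delta> by (simp add: bij_betw_def col_word_def sum_list_replicate)
next
  case (Suc N)
  let ?\<delta> = "replicate z 0 @ \<delta>" and ?pad = "\<lambda>c \<gamma>. replicate (if c = 1 then Suc z else z) 0 @ \<gamma>"
  have ne: "\<delta> \<noteq> []" using Suc.hyps(2) by auto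
  have IH: "bij_betw (col_word (?pad c \<gamma>)) {\<tau>. srct (?pad c \<gamma>) \<tau>} {w. act w [] = Some \<gamma>}"
    if "add_box c \<gamma> = Some \<delta>" "is_comp \<gamma>" for c \<gamma>
    using Suc.hyps(1)[of \<gamma>] add_box_sum[OF that(1)] Suc.hyps(2) that(2) by simp
  have rem: "\<exists>c \<gamma> k \<tau>. add_box c \<gamma> = Some \<delta> \<and> is_comp \<gamma> \<and> k < length (?pad c \<gamma>) \<and> ?\<delta> = bumped (?pad c \<gamma>) k \<and>
    srct (?pad c \<gamma>) \<tau> \<and> \<sigma> = lift_tab (?pad c \<gamma>) k \<tau> \<and> col_word ?\<delta> \<sigma> = c # col_word (?pad c \<gamma>) \<tau> \<and>
    act (col_word (?pad c \<gamma>) \<tau>) [] = Some \<gamma>" if \<sigma>: "srct ?\<delta> \<sigma>" for \<sigma>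
  proof -
    obtain c \<gamma> k \<tau> where *: "add_box c \<gamma> = Some \<delta>" "is_comp \<gamma>" "can_bump (?pad c \<gamma>) k"
      "Suc (?pad c \<gamma> ! k) = c" "?\<delta> = bumped (?pad c \<gamma>) k" "srct (?pad c \<gamma>) \<tau>" "\<sigma> = lift_tab (?pad c \<gamma>) k \<tau>"
      using srct_remove_box[OF \<sigma> Suc.prems ne] .
    have "col_word ?\<delta> \<sigma> = c # col_word (?pad c \<gamma>) \<tau>"
      unfolding *(5,7) by (subst col_word_lift[OF *(6,3)]) (simp only: *(4))
    moreover have "act (col_word (?pad c \<gamma>) \<tau>) [] = Some \<gamma>" using IH[OF *(1,2)] *(6) by (auto simp: bij_betw_def)
    moreover have "k < length (?pad c \<gamma>)" using *(3) by (simp add: can_bump_def)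
    ultimately show ?thesis using * by blast
  qed
  show ?case unfolding bij_betw_def
  proof
    show "inj_on (col_word ?\<delta>) {\<tau>. srct ?\<delta> \<tau>}"
    proof (rule inj_onI, unfold mem_Collect_eq)
      fix \<sigma>1 \<sigma>2 assume s: "srct ?\<delta> \<sigma>1" "srct ?\<delta> \<sigma>2" "col_word ?\<delta> \<sigma>1 = col_word ?\<delta> \<sigma>2"
      from rem[OF s(1)] obtain c \<gamma> k \<tau> where 1: "add_box c \<gamma> = Some \<delta>" "is_comp \<gamma>" "k < length (?pad c \<gamma>)"
        "?\<delta> = bumped (?pad c \<gamma>) k" "srct (?pad c \<gamma>) \<tau>" "\<sigma>1 = lift_tab (?pad c \<gamma>) k \<tau>"
        "col_word ?\<delta> \<sigma>1 = c # col_word (?pad c \<gamma>) \<tau>" "act (col_word (?pad c \<gamma>) \<tau>) [] = Some \<gamma>" by blast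
      from rem[OF s(2)] obtain c' \<gamma>' k' \<tau>' where 2: "k' < length (?pad c' \<gamma>')"
        "?\<delta> = bumped (?pad c' \<gamma>') k'" "srct (?pad c' \<gamma>') \<tau>'" "\<sigma>2 = lift_tab (?pad c' \<gamma>') k' \<tau>'"
        "col_word ?\<delta> \<sigma>2 = c' # col_word (?pad c' \<gamma>') \<tau>'" "act (col_word (?pad c' \<gamma>') \<tau>') [] = Some \<gamma>'" by blast
      have eq: "c' = c" "col_word (?pad c \<gamma>) \<tau> = col_word (?pad c' \<gamma>') \<tau>'" using s(3) 1(7) 2(5) by auto
      then have "\<gamma>' = \<gamma>" using 1(8) 2(6) by simp
      \<comment> \<open>Bumping one list at two different positions gives different lists.\<close>
      have "k' = k"
      proof (rule ccontr)
        assume "k' \<noteq> k"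
        have "bumped (?pad c \<gamma>) k ! k = bumped (?pad c \<gamma>) k' ! k" using 1(4) 2(2) eq \<open>\<gamma>' = \<gamma>\<close> by metis
        then show False using 1(3) \<open>k' \<noteq> k\<close> by simp
      qed
      have "\<tau>' = \<tau>" using IH[OF 1(1,2)] 1(5) 2(3) eq \<open>\<gamma>' = \<gamma>\<close> by (auto simp: bij_betw_def inj_on_def)
      then show "\<sigma>1 = \<sigma>2" using 1(6) 2(4) eq(1) \<open>\<gamma>' = \<gamma>\<close> \<open>k' = k\<close> by simp
    qed
    show "col_word ?\<delta> ` {\<tau>. srct ?\<delta> \<tau>} = {w. act w [] = Some \<delta>}"
    proof (intro equalityI subsetI)
      fix w assume "w \<in> col_word ?\<delta> ` {\<tau>. srct ?\<delta> \<tau>}"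
      then obtain \<sigma> where \<sigma>: "srct ?\<delta> \<sigma>" "w = col_word ?\<delta> \<sigma>" by blast
      from rem[OF \<sigma>(1)] obtain c \<gamma> v where "add_box c \<gamma> = Some \<delta>" "w = c # v" "act v [] = Some \<gamma>"
        unfolding \<sigma>(2) by blast
      then show "w \<in> {w. act w [] = Some \<delta>}" by simp
    next
      fix w assume "w \<in> {w. act w [] = Some \<delta>}"
      then have w: "act w [] = Some \<delta>" by simp
      then have "w \<noteq> []" using ne by auto
      then obtain c v where cv: "w = c # v" by (cases w) auto
      then obtain \<gamma> where \<gamma>: "act v [] = Some \<gamma>" "add_box c \<gamma> = Some \<delta>" using w by (auto simp: bind_eq_Some_conv)
      have "is_comp \<gamma>" using act_is_comp[OF \<gamma>(1)] by (simp add: is_comp_def)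
      from IH[OF \<gamma>(2) this] have "v \<in> col_word (?pad c \<gamma>) ` {\<tau>. srct (?pad c \<gamma>) \<tau>}"
        using \<gamma>(1) by (simp add: bij_betw_def)
      then obtain \<tau> where \<tau>: "srct (?pad c \<gamma>) \<tau>" "col_word (?pad c \<gamma>) \<tau> = v" by blast
      obtain k where k: "can_bump (?pad c \<gamma>) k" "Suc (?pad c \<gamma> ! k) = c" "?\<delta> = bumped (?pad c \<gamma>) k"
        using add_box_can_bump[OF \<gamma>(2), of z] .
      have "srct ?\<delta> (lift_tab (?pad c \<gamma>) k \<tau>)" unfolding k(3) by (rule srct_lift[OF \<tau>(1) k(1)])
      moreover have "col_word ?\<delta> (lift_tab (?pad c \<gamma>) k \<tau>) = w"
        unfolding k(3) by (subst col_word_lift[OF \<tau>(1) k(1)]) (simp only: \<tau>(2) k(2) cv)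
      ultimately show "w \<in> col_word ?\<delta> ` {\<tau>. srct ?\<delta> \<tau>}" by blast
    qed
  qed
qed

lemma d_coeff_eq:
  assumes "is_comp \<delta>"
  shows "d_coeff \<delta> \<beta> = card (desc_words \<beta> [] \<delta>)"
proof -
  have bij: "bij_betw (col_word \<delta>) {\<tau>. srct \<delta> \<tau>} {w. act w [] = Some \<delta>}"
    using col_word_bij[OF assms, of 0] by simp
  let ?T = "{\<tau>. srct \<delta> \<tau> \<and> dcomp (col_word \<delta> \<tau>) = \<beta>}"
  have inj: "inj_on (col_word \<delta>) ?T" using bij by (auto simp: bij_betw_def inj_on_def)
  have im: "col_word \<delta> ` ?T = desc_words \<beta> [] \<delta>"
  proof -
    have "col_word \<delta> ` ?T = {w \<in> col_word \<delta> ` {\<tau>. srct \<delta> \<tau>}. dcomp w = \<beta>}" by auto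
    also have "\<dots> = desc_words \<beta> [] \<delta>" using bij by (auto simp: bij_betw_def desc_words_def)
    finally show ?thesis .
  qed
  show ?thesis unfolding d_coeff_def descents_col_word im[symmetric] by (rule card_image[OF inj, symmetric])
qed

section \<open>The Murnaghan--Nakayama rule\<close>

lemma ribbon_expansion:
  assumes "is_comp \<beta>"
  shows "ribbon \<beta> \<zeta> = (\<Sum>\<delta>\<in>comps_of (sum_list \<beta>). of_nat (d_coeff \<delta> \<beta>) * schur \<delta> \<zeta>)"
proof -
  let ?C = "comps_of (sum_list \<beta>)"
  \<comment> \<open>The matrix of \<open>d_coeff\<close> is the product of the ribbon matrix and the
    block matrix, and \<open>schur\<close> cancels the latter.\<close>
  have "(\<Sum>\<delta>\<in>?C. of_nat (d_coeff \<delta> \<beta>) * schur \<delta> \<zeta>) =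
    (\<Sum>\<delta>\<in>?C. \<Sum>\<gamma>\<in>?C. ribbon \<beta> \<gamma> * (block_count \<gamma> [] \<delta> * schur \<delta> \<zeta>))"
    by (intro sum.cong refl)
      (simp add: d_coeff_eq comps_of_def[of "sum_list \<beta>"] card_desc_words[OF assms] sum_distrib_right mult.assoc)
  also have "\<dots> = (\<Sum>\<gamma>\<in>?C. ribbon \<beta> \<gamma> * (\<Sum>\<delta>\<in>?C. block_count \<gamma> [] \<delta> * schur \<delta> \<zeta>))"
    by (subst sum.swap) (simp only: sum_distrib_left)
  also have "\<dots> = (\<Sum>\<gamma>\<in>?C. ribbon \<beta> \<gamma> * of_bool (\<gamma> = \<zeta>))"
  proof (intro sum.cong refl arg_cong2[of _ _ _ _ "(*)"])
    fix \<gamma> assume "\<gamma> \<in> ?C"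
    then have "is_comp \<gamma>" "sum_list \<gamma> = sum_list \<beta>" by (auto simp: comps_of_def)
    then show "(\<Sum>\<delta>\<in>?C. block_count \<gamma> [] \<delta> * schur \<delta> \<zeta>) = of_bool (\<gamma> = \<zeta>)"
      using block_count_schur[of \<gamma> \<zeta>] by simp
  qed
  also have "\<dots> = (if \<zeta> \<in> ?C then ribbon \<beta> \<zeta> else 0)"
    by (auto simp: of_bool_def if_distrib sum.delta cong: if_cong)
  also have "\<dots> = ribbon \<beta> \<zeta>"
    using coarsens_comps_of[OF _ assms, of \<zeta>] by (auto simp: ribbon_def)
  finally show ?thesis by simp
qed

lemma ribbon_triangular: "ribbon \<beta> \<gamma> \<noteq> 0 \<Longrightarrow> \<gamma> = \<beta> \<or> length \<gamma> < length \<beta>"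
proof -
  assume "ribbon \<beta> \<gamma> \<noteq> 0"
  then obtain Bs where Bs: "concat Bs = \<beta>" "\<forall>B\<in>set Bs. B \<noteq> []" "\<gamma> = map sum_list Bs"
    by (auto simp: ribbon_def coarsens_def split: if_splits)
  have "map sum_list Bs = concat Bs \<or> length Bs < length (concat Bs)"
    using Bs(2)
  proof (induction Bs)
    case (Cons B Bs)
    then obtain x B' where B: "B = x # B'" by (cases B) auto
    have IH: "map sum_list Bs = concat Bs \<or> length Bs < length (concat Bs)" using Cons by simp
    then have "length Bs \<le> length (concat Bs)" by (metis length_map less_imp_le order_refl)
    then show ?case using IH B by (cases B') auto
  qed simp
  then show ?thesis using Bs by auto
qed

text \<open>\<open>T\<close> is the difference of two solutions and \<open>U\<close> its image under
  the block matrix. The ribbon matrix annihilates \<open>U\<close> and is unitriangular with respect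
  to the number of parts, so \<open>U\<close> is 0; applying the inverse \<open>schur\<close> gives
  that \<open>T\<close> is 0.\<close>

lemma ncs_family_unique:
  assumes S: "\<And>\<beta> \<zeta>. is_comp \<beta> \<Longrightarrow>
      ribbon \<beta> \<zeta> = (\<Sum>\<alpha>\<in>comps_of (sum_list \<beta>). of_nat (d_coeff \<alpha> \<beta>) * S \<alpha> \<zeta>)"
    and \<alpha>: "is_comp \<alpha>"
  shows "S \<alpha> \<zeta> = schur \<alpha> \<zeta>"
proof -
  define T where "T \<delta> = S \<delta> \<zeta> - schur \<delta> \<zeta>" for \<delta>
  define U where "U \<gamma> = (\<Sum>\<delta>\<in>comps_of (sum_list \<gamma>). block_count \<gamma> [] \<delta> * T \<delta>)" for \<gamma>
  have U0: "U \<beta> = 0" if "is_comp \<beta>" for \<beta>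
    using that
  proof (induction "length \<beta>" arbitrary: \<beta> rule: less_induct)
    case less
    let ?C = "comps_of (sum_list \<beta>)"
    have "0 = (\<Sum>\<delta>\<in>?C. of_nat (d_coeff \<delta> \<beta>) * T \<delta>)"
      using S[OF less.prems, of \<zeta>] ribbon_expansion[OF less.prems, of \<zeta>]
      by (simp add: T_def right_diff_distrib sum_subtractf)
    also have "\<dots> = (\<Sum>\<delta>\<in>?C. \<Sum>\<gamma>\<in>?C. ribbon \<beta> \<gamma> * (block_count \<gamma> [] \<delta> * T \<delta>))"
      by (intro sum.cong refl)
        (simp add: d_coeff_eq comps_of_def[of "sum_list \<beta>"] card_desc_words[OF less.prems] sum_distrib_right mult.assoc)
    also have "\<dots> = (\<Sum>\<gamma>\<in>?C. ribbon \<beta> \<gamma> * (\<Sum>\<delta>\<in>?C. block_count \<gamma> [] \<delta> * T \<delta>))"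
      by (subst sum.swap) (simp only: sum_distrib_left)
    also have "\<dots> = (\<Sum>\<gamma>\<in>?C. ribbon \<beta> \<gamma> * U \<gamma>)"
      by (intro sum.cong refl) (auto simp: U_def comps_of_def)
    also have "\<dots> = ribbon \<beta> \<beta> * U \<beta>"
    proof -
      have "\<beta> \<in> ?C" using less.prems by (simp add: comps_of_def)
      moreover have "ribbon \<beta> \<gamma> * U \<gamma> = 0" if "\<gamma> \<in> ?C - {\<beta>}" for \<gamma>
        using ribbon_triangular[of \<beta> \<gamma>] less.hyps[of \<gamma>] that by (auto simp: comps_of_def)
      then have "(\<Sum>\<gamma>\<in>?C - {\<beta>}. ribbon \<beta> \<gamma> * U \<gamma>) = 0" by (intro sum.neutral) blast
      ultimately show ?thesis using sum.remove[of ?C \<beta> "\<lambda>\<gamma>. ribbon \<beta> \<gamma> * U \<gamma>"] by simp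
    qed
    finally show ?case by (simp add: ribbon_def coarsens_refl)
  qed
  let ?C = "comps_of (sum_list \<alpha>)"
  have "0 = (\<Sum>\<gamma>\<in>?C. schur \<alpha> \<gamma> * (\<Sum>\<delta>\<in>?C. block_count \<gamma> [] \<delta> * T \<delta>))"
  proof -
    have "(\<Sum>\<delta>\<in>?C. block_count \<gamma> [] \<delta> * T \<delta>) = 0" if "\<gamma> \<in> ?C" for \<gamma>
      using U0[of \<gamma>] that by (simp add: U_def comps_of_def)
    then show ?thesis by simp
  qed
  also have "\<dots> = (\<Sum>\<delta>\<in>?C. (\<Sum>\<gamma>\<in>?C. schur \<alpha> \<gamma> * block_count \<gamma> [] \<delta>) * T \<delta>)"
    by (subst sum_distrib_left, subst sum.swap) (simp only: sum_distrib_right mult.assoc)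
  also have "\<dots> = (\<Sum>\<delta>\<in>?C. of_bool (\<alpha> = \<delta>) * T \<delta>)"
    by (intro sum.cong refl arg_cong2[of _ _ _ _ "(*)"] schur_block_count[OF \<alpha>]) (simp add: comps_of_def)
  also have "\<dots> = T \<alpha>"
  proof -
    have "\<alpha> \<in> ?C" using \<alpha> by (simp add: comps_of_def)
    then show ?thesis by (subst sum.remove[of _ \<alpha>]) (auto intro!: sum.neutral)
  qed
  finally show ?thesis by (simp add: T_def)
qed

lemma ncs_eq_schur: "ncs \<alpha> = (if is_comp \<alpha> then schur \<alpha> else (\<lambda>_. 0))"
proof -
  let ?P = "\<lambda>S. (\<forall>\<beta>. is_comp \<beta> \<longrightarrow>
        ribbon \<beta> = (\<lambda>\<gamma>. \<Sum>\<alpha>\<in>comps_of (sum_list \<beta>). of_nat (d_coeff \<alpha> \<beta>) * S \<alpha> \<gamma>)) \<and>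
     (\<forall>\<alpha>. \<not> is_comp \<alpha> \<longrightarrow> S \<alpha> = (\<lambda>_. 0))"
  let ?S = "\<lambda>\<alpha>. if is_comp \<alpha> then schur \<alpha> else (\<lambda>_. 0)"
  have "ncs_family = ?S"
    unfolding ncs_family_def
  proof (rule the_equality)
    have "(\<Sum>\<alpha>\<in>comps_of N. of_nat (d_coeff \<alpha> \<beta>) * ?S \<alpha> \<gamma>) =
      (\<Sum>\<alpha>\<in>comps_of N. of_nat (d_coeff \<alpha> \<beta>) * schur \<alpha> \<gamma>)" for N \<beta> \<gamma>
      by (intro sum.cong) (auto simp: comps_of_def)
    then show "?P ?S" using ribbon_expansion by (auto simp: fun_eq_iff)
  next
    fix S assume P: "?P S"
    have "S \<alpha> \<zeta> = schur \<alpha> \<zeta>" if "is_comp \<alpha>" for \<alpha> \<zeta>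
    proof (rule ncs_family_unique[OF _ that])
      fix \<beta> \<zeta> assume "is_comp \<beta>"
      then have "ribbon \<beta> = (\<lambda>\<gamma>. \<Sum>\<alpha>\<in>comps_of (sum_list \<beta>). of_nat (d_coeff \<alpha> \<beta>) * S \<alpha> \<gamma>)" using P by blast
      from fun_cong[OF this, of \<zeta>]
      show "ribbon \<beta> \<zeta> = (\<Sum>\<alpha>\<in>comps_of (sum_list \<beta>). of_nat (d_coeff \<alpha> \<beta>) * S \<alpha> \<zeta>)" .
    qed
    then show "S = ?S" using P by (auto simp: fun_eq_iff)
  qed
  then show ?thesis unfolding ncs_def by (rule fun_cong)
qed

section \<open>Products and degrees\<close>

lemma is_comp_append: "is_comp (\<alpha> @ \<beta>) \<longleftrightarrow> is_comp \<alpha> \<and> is_comp \<beta>"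
  by (auto simp: is_comp_def)

lemma nsym_mult_support:
  assumes "\<And>\<gamma>. f \<gamma> \<noteq> 0 \<Longrightarrow> \<gamma> \<in> comps_of a" "\<And>\<gamma>. g \<gamma> \<noteq> 0 \<Longrightarrow> \<gamma> \<in> comps_of b" "nsym_mult f g \<gamma> \<noteq> 0"
  shows "\<gamma> \<in> comps_of (a + b)"
proof -
  obtain k where "f (take k \<gamma>) * g (drop k \<gamma>) \<noteq> 0"
    using assms(3) unfolding nsym_mult_def by (meson sum.neutral)
  then have "take k \<gamma> \<in> comps_of a" "drop k \<gamma> \<in> comps_of b" using assms(1,2) by auto
  moreover have "sum_list \<gamma> = sum_list (take k \<gamma>) + sum_list (drop k \<gamma>)"
    by (metis append_take_drop_id sum_list_append)
  moreover have "is_comp \<gamma> \<longleftrightarrow> is_comp (take k \<gamma>) \<and> is_comp (drop k \<gamma>)"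
    by (metis append_take_drop_id is_comp_append)
  ultimately show ?thesis by (simp add: comps_of_def)
qed

text \<open>A linear functional \<open>c\<close> on a product of homogeneous elements: letting
  \<gamma> vary turns the cuts of \<gamma> into independent pairs.\<close>

lemma sum_nsym_mult:
  assumes "\<And>\<gamma>. f \<gamma> \<noteq> 0 \<Longrightarrow> \<gamma> \<in> comps_of a" "\<And>\<gamma>. g \<gamma> \<noteq> 0 \<Longrightarrow> \<gamma> \<in> comps_of b"
  shows "(\<Sum>\<gamma>\<in>comps_of (a + b). nsym_mult f g \<gamma> * c \<gamma>) =
    (\<Sum>\<gamma>1\<in>comps_of a. \<Sum>\<gamma>2\<in>comps_of b. f \<gamma>1 * g \<gamma>2 * c (\<gamma>1 @ \<gamma>2))"
proof -
  let ?A = "SIGMA \<gamma>:comps_of (a + b). {..length \<gamma>}"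
  have "(\<Sum>\<gamma>\<in>comps_of (a + b). nsym_mult f g \<gamma> * c \<gamma>) =
    (\<Sum>\<gamma>\<in>comps_of (a + b). \<Sum>k\<le>length \<gamma>. f (take k \<gamma>) * g (drop k \<gamma>) * c \<gamma>)"
    by (simp add: nsym_mult_def sum_distrib_right)
  also have "\<dots> = (\<Sum>(\<gamma>, k)\<in>?A. f (take k \<gamma>) * g (drop k \<gamma>) * c \<gamma>)" by (subst sum.Sigma) auto
  also have "\<dots> = (\<Sum>(\<gamma>1, \<gamma>2)\<in>comps_of a \<times> comps_of b. f \<gamma>1 * g \<gamma>2 * c (\<gamma>1 @ \<gamma>2))"
  \<comment> \<open>\<open>S'\<close> collects the cuts with a piece of the wrong degree; these
    contribute 0 and correspond to no pair.\<close>
  proof (rule sum.reindex_bij_witness_not_neutral[where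
      S' = "{(\<gamma>, k) \<in> ?A. \<not> (take k \<gamma> \<in> comps_of a \<and> drop k \<gamma> \<in> comps_of b)}" and T' = "{}" and
      i = "\<lambda>(\<gamma>1, \<gamma>2). (\<gamma>1 @ \<gamma>2, length \<gamma>1)" and j = "\<lambda>(\<gamma>, k). (take k \<gamma>, drop k \<gamma>)"])
    show "finite {(\<gamma>, k) \<in> ?A. \<not> (take k \<gamma> \<in> comps_of a \<and> drop k \<gamma> \<in> comps_of b)}"
      by (rule finite_subset[of _ ?A]) auto
  next
    fix x assume "x \<in> {(\<gamma>, k) \<in> ?A. \<not> (take k \<gamma> \<in> comps_of a \<and> drop k \<gamma> \<in> comps_of b)}"
    then obtain \<gamma> k where "x = (\<gamma>, k)" "take k \<gamma> \<notin> comps_of a \<or> drop k \<gamma> \<notin> comps_of b" by blast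
    then have "x = (\<gamma>, k)" "f (take k \<gamma>) = 0 \<or> g (drop k \<gamma>) = 0" using assms by blast+
    then show "(case x of (\<gamma>, k) \<Rightarrow> f (take k \<gamma>) * g (drop k \<gamma>) * c \<gamma>) = 0" by auto
  qed (auto simp: comps_of_def is_comp_append)
  finally show ?thesis by (simp add: sum.cartesian_product)
qed

lemma is_comp_hook: "k < n \<Longrightarrow> is_comp (replicate k 1 @ [n - k])" "k < n \<Longrightarrow> sum_list (replicate k 1 @ [n - k]) = n"
  by (auto simp: is_comp_def sum_list_replicate)

lemma Psi_support: "Psi n \<gamma> \<noteq> 0 \<Longrightarrow> \<gamma> \<in> comps_of n"
proof -
  assume "Psi n \<gamma> \<noteq> 0"
  then obtain k where "k < n" "ribbon (replicate k 1 @ [n - k]) \<gamma> \<noteq> 0"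
    unfolding Psi_def by (metis (no_types, lifting) lessThan_iff mult_zero_right sum.neutral)
  then have "coarsens \<gamma> (replicate k 1 @ [n - k])" by (auto simp: ribbon_def split: if_splits)
  then show ?thesis using coarsens_comps_of is_comp_hook \<open>k < n\<close> by metis
qed

lemma P_set_comps_of:
  assumes "is_comp \<alpha>" "\<beta> \<in> P_set \<alpha> n"
  shows "\<beta> \<in> comps_of (n + sum_list \<alpha>)"
proof -
  obtain w where w: "w \<noteq> []" "act w \<alpha> = Some \<beta>" using less_c_iff_act[OF assms(1)] assms(2) by (auto simp: P_set_def)
  then interpret reachable \<alpha> \<beta> w using assms by unfold_locales
  have "length w = n" using card_skew assms(2) by (simp add: P_set_def)
  then show ?thesis using comp' act_sum[OF w(2)] by (simp add: comps_of_def)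
qed

theorem mainTheorem1:
  fixes \<alpha> :: "nat list" and n :: nat
  assumes "is_comp \<alpha>" and "0 < n"
  shows "nsym_mult (Psi n) (ncs \<alpha>) =
         (\<lambda>\<gamma>. \<Sum>\<beta>\<in>P_set \<alpha> n. (-1) ^ ht \<beta> \<alpha> * ncs \<beta> \<gamma>)"
proof
  fix \<zeta>
  let ?m = "sum_list \<alpha>"
  let ?C = "comps_of (n + ?m)"
  have \<alpha>: "\<alpha> \<in> comps_of ?m" using assms(1) by (simp add: comps_of_def)
  define f where "f = nsym_mult (Psi n) (schur \<alpha>)"
  have supp: "f \<gamma> \<noteq> 0 \<Longrightarrow> \<gamma> \<in> ?C" for \<gamma>
    unfolding f_def using nsym_mult_support[of "Psi n" n "schur \<alpha>" ?m] Psi_support schur_support[OF assms(1)] by blast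
  \<comment> \<open>Pairing with \<open>block_count\<close> applies \<open>f\<close> to the empty
    composition and reads off the coefficient of \<delta>. Since s_\<alpha> sends the empty
    composition to \<alpha>, this is the coefficient in \<Psi> applied to \<alpha>.\<close>
  have coeff: "(\<Sum>\<gamma>\<in>?C. f \<gamma> * block_count \<gamma> [] \<delta>) = (if \<delta> \<in> P_set \<alpha> n then (-1) ^ ht \<delta> \<alpha> else 0)"
    if "\<delta> \<in> ?C" for \<delta>
  proof -
    have \<delta>: "is_comp \<delta>" using that by (simp add: comps_of_def)
    have "(\<Sum>\<gamma>\<in>?C. f \<gamma> * block_count \<gamma> [] \<delta>) =
      (\<Sum>\<gamma>1\<in>comps_of n. \<Sum>\<gamma>2\<in>comps_of ?m. Psi n \<gamma>1 * schur \<alpha> \<gamma>2 * block_count (\<gamma>1 @ \<gamma>2) [] \<delta>)"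
      unfolding f_def using Psi_support schur_support[OF assms(1)] by (intro sum_nsym_mult) auto
    also have "\<dots> = (\<Sum>\<gamma>1\<in>comps_of n. Psi n \<gamma>1 * block_count \<gamma>1 \<alpha> \<delta>)"
    proof (rule sum.cong[OF refl])
      fix \<gamma>1
      \<comment> \<open>The words are cut between the two factors; the inner sum over
        \<open>\<gamma>2\<close> then leaves only the intermediate composition \<alpha>.\<close>
      have "(\<Sum>\<gamma>2\<in>comps_of ?m. Psi n \<gamma>1 * schur \<alpha> \<gamma>2 * block_count (\<gamma>1 @ \<gamma>2) [] \<delta>) =
        (\<Sum>\<gamma>2\<in>comps_of ?m. \<Sum>\<epsilon>\<in>comps_of ?m. Psi n \<gamma>1 * block_count \<gamma>1 \<epsilon> \<delta> * (schur \<alpha> \<gamma>2 * block_count \<gamma>2 [] \<epsilon>))"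
      proof (rule sum.cong[OF refl])
        fix \<gamma>2 assume "\<gamma>2 \<in> comps_of ?m"
        then have "block_count (\<gamma>1 @ \<gamma>2) [] \<delta> = (\<Sum>\<epsilon>\<in>comps_of ?m. block_count \<gamma>1 \<epsilon> \<delta> * block_count \<gamma>2 [] \<epsilon>)"
          using block_count_append[of "[]" \<gamma>1 \<gamma>2 \<delta>] by (simp add: is_comp_def comps_of_def)
        then show "Psi n \<gamma>1 * schur \<alpha> \<gamma>2 * block_count (\<gamma>1 @ \<gamma>2) [] \<delta> =
          (\<Sum>\<epsilon>\<in>comps_of ?m. Psi n \<gamma>1 * block_count \<gamma>1 \<epsilon> \<delta> * (schur \<alpha> \<gamma>2 * block_count \<gamma>2 [] \<epsilon>))"
          by (simp add: sum_distrib_left mult_ac)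
      qed
      also have "\<dots> = (\<Sum>\<epsilon>\<in>comps_of ?m. Psi n \<gamma>1 * block_count \<gamma>1 \<epsilon> \<delta> *
          (\<Sum>\<gamma>2\<in>comps_of ?m. schur \<alpha> \<gamma>2 * block_count \<gamma>2 [] \<epsilon>))"
        by (subst sum.swap) (simp only: sum_distrib_left)
      also have "\<dots> = (\<Sum>\<epsilon>\<in>comps_of ?m. Psi n \<gamma>1 * block_count \<gamma>1 \<epsilon> \<delta> * of_bool (\<alpha> = \<epsilon>))"
        by (intro sum.cong refl arg_cong2[of _ _ _ _ "(*)"] schur_block_count[OF assms(1)]) (simp add: comps_of_def)
      also have "\<dots> = Psi n \<gamma>1 * block_count \<gamma>1 \<alpha> \<delta>"
        using \<alpha> by (subst sum.remove[of _ \<alpha>]) (auto intro!: sum.neutral)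
      finally show "(\<Sum>\<gamma>2\<in>comps_of ?m. Psi n \<gamma>1 * schur \<alpha> \<gamma>2 * block_count (\<gamma>1 @ \<gamma>2) [] \<delta>) =
        Psi n \<gamma>1 * block_count \<gamma>1 \<alpha> \<delta>" .
    qed
    also have "\<dots> = (\<Sum>\<gamma>1\<in>comps_of n. \<Sum>k<n. (-1) ^ k * (ribbon (replicate k 1 @ [n - k]) \<gamma>1 * block_count \<gamma>1 \<alpha> \<delta>))"
      unfolding Psi_def by (simp only: sum_distrib_right mult.assoc)
    also have "\<dots> = (\<Sum>k<n. (-1) ^ k * (\<Sum>\<gamma>1\<in>comps_of n. ribbon (replicate k 1 @ [n - k]) \<gamma>1 * block_count \<gamma>1 \<alpha> \<delta>))"
      by (subst sum.swap) (simp only: sum_distrib_left)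
    also have "\<dots> = (\<Sum>k<n. (-1) ^ k * of_nat (card (desc_words (replicate k 1 @ [n - k]) \<alpha> \<delta>)))"
    proof (intro sum.cong refl arg_cong2[of _ _ _ _ "(*)"])
      fix k assume "k \<in> {..<n}"
      then show "(\<Sum>\<gamma>1\<in>comps_of n. ribbon (replicate k 1 @ [n - k]) \<gamma>1 * block_count \<gamma>1 \<alpha> \<delta>) =
        of_nat (card (desc_words (replicate k 1 @ [n - k]) \<alpha> \<delta>))"
        using card_desc_words[OF is_comp_hook(1), of k n \<alpha> \<delta>] is_comp_hook(2)[of k n] by simp
    qed
    also have "\<dots> = (if \<delta> \<in> P_set \<alpha> n then (-1) ^ ht \<delta> \<alpha> else 0)"
      by (rule hook_coefficient[OF assms(1) \<delta> assms(2)])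
    finally show ?thesis .
  qed
  \<comment> \<open>The inverse matrix recovers \<open>f\<close> from these coefficients as a
    combination of the \<open>schur \<delta>\<close>.\<close>
  have "f \<zeta> = (\<Sum>\<gamma>\<in>?C. f \<gamma> * of_bool (\<gamma> = \<zeta>))"
  proof (cases "\<zeta> \<in> ?C")
    case True
    then show ?thesis by (subst sum.remove[of _ \<zeta>]) (auto intro!: sum.neutral)
  next
    case False
    then show ?thesis using supp[of \<zeta>] by (auto intro!: sum.neutral[symmetric])
  qed
  also have "\<dots> = (\<Sum>\<gamma>\<in>?C. f \<gamma> * (\<Sum>\<delta>\<in>?C. block_count \<gamma> [] \<delta> * schur \<delta> \<zeta>))"
  proof (intro sum.cong refl arg_cong2[of _ _ _ _ "(*)"])
    fix \<gamma> assume "\<gamma> \<in> ?C"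
    then show "of_bool (\<gamma> = \<zeta>) = (\<Sum>\<delta>\<in>?C. block_count \<gamma> [] \<delta> * schur \<delta> \<zeta>)"
      using block_count_schur[of \<gamma> \<zeta>] by (simp add: comps_of_def)
  qed
  also have "\<dots> = (\<Sum>\<delta>\<in>?C. (\<Sum>\<gamma>\<in>?C. f \<gamma> * block_count \<gamma> [] \<delta>) * schur \<delta> \<zeta>)"
    by (subst sum_distrib_left, subst sum.swap) (simp only: sum_distrib_right mult.assoc)
  also have "\<dots> = (\<Sum>\<delta>\<in>?C. (if \<delta> \<in> P_set \<alpha> n then (-1) ^ ht \<delta> \<alpha> else 0) * schur \<delta> \<zeta>)"
    by (intro sum.cong refl arg_cong2[of _ _ _ _ "(*)"] coeff)
  \<comment> \<open>\<open>P_set \<alpha> n\<close> lies in the finite set \<open>?C\<close>, so the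
    case distinction can be absorbed into the range of summation.\<close>
  also have "\<dots> = (\<Sum>\<beta>\<in>P_set \<alpha> n. (-1) ^ ht \<beta> \<alpha> * schur \<beta> \<zeta>)"
    using P_set_comps_of[OF assms(1)] by (intro sum.mono_neutral_cong_right) auto
  also have "\<dots> = (\<Sum>\<beta>\<in>P_set \<alpha> n. (-1) ^ ht \<beta> \<alpha> * ncs \<beta> \<zeta>)"
    using P_set_comps_of[OF assms(1), of _ n] by (intro sum.cong refl) (auto simp: ncs_eq_schur comps_of_def)
  finally show "nsym_mult (Psi n) (ncs \<alpha>) \<zeta> = (\<Sum>\<beta>\<in>P_set \<alpha> n. (-1) ^ ht \<beta> \<alpha> * ncs \<beta> \<zeta>)"
    using assms(1) by (simp add: f_def ncs_eq_schur)
qed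

end
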